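(* Let $\{F_j\}_{j\in\mathbb Z_+}$ be an i.i.d. sequence under $\mathbb P$ taking values in a finite set of distributions $\{H_1,\dots,H_L\}$. Assume that for each $\ell$, $$\int_{-\infty}^0H_\ell(x)^{1/2}\,dx+\int_0^\infty\bigl(1-H_\ell(x)\bigr)^{1/2}\,dx<\infty .$$ Then, as $\alpha\searrow0$, $$\Psi(1,\alpha)\le\mu^*+2\sigma^*\sqrt\alpha+o(\sqrt\alpha),$$ where $\mu^*=\max_\ell\mu(H_\ell)$ and $\sigma^*=\sqrt{\max_\ell\sigma^2(H_\ell)}$.
   Context: $\mathbb P$ is the distribution of the sequence $(F_j)_{j\in\mathbb Z_+}$ of random Borel probability distributions on $\mathbb R$ (the environment); distributions are identified with their distribution functions. Given $(F_j)$, the weights $\{X(i,j):(i,j)\in\mathbb Z_+^2\}$ are independent with $X(i,j)\sim F_j$. $T(k,\ell)$ is the maximum of $\sum_{z\in\pi}X(z)$ over all nearest-neighbor lattice paths $\pi$ from $(0,0)$ to $(k,\ell)$ with steps $(1,0)$ or $(0,1)$, the endpoint $(k,\ell)$ excluded. $\Psi(x,y)=\lim_{n\to\infty}\frac1nT(\lfloor nx\rfloor,\lfloor ny\rfloor)$, $(x,y)\in(0,\infty)^2$, is the deterministic limit, almost sure and in $L^1$ over environment and weights. $\mu(H)$ and $\sigma^2(H)$ are the mean and variance of the distribution $H$. *)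

theory Defs
  imports "HOL-Probability.Probability" "HOL-Library.Landau_Symbols"
begin

definition lattice_step :: "nat \<times> nat \<Rightarrow> nat \<times> nat \<Rightarrow> bool" where
  "lattice_step p q \<longleftrightarrow> q = (Suc (fst p), snd p) \<or> q = (fst p, Suc (snd p))"

definition lattice_paths :: "nat \<Rightarrow> nat \<Rightarrow> (nat \<times> nat) list set" where
  "lattice_paths k l =
     {\<pi>. \<pi> \<noteq> [] \<and> hd \<pi> = (0, 0) \<and> last \<pi> = (k, l) \<and> successively lattice_step \<pi>}"

text \<open>The weight of the endpoint \<open>(k, l)\<close> is not counted, hence \<^const>\<open>butlast\<close>.\<close>

definition last_passage :: "(nat \<times> nat \<Rightarrow> real) \<Rightarrow> nat \<Rightarrow> nat \<Rightarrow> real" where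
  "last_passage w k l = Max ((\<lambda>\<pi>. \<Sum>z\<leftarrow>butlast \<pi>. w z) ` lattice_paths k l)"

text \<open>The maximum above is over a finite nonempty set.\<close>

lemma lattice_path_bounds:
  "successively lattice_step \<pi> \<Longrightarrow> \<pi> \<noteq> [] \<Longrightarrow>
     set \<pi> \<subseteq> {..fst (last \<pi>)} \<times> {..snd (last \<pi>)} \<and>
     length \<pi> + fst (hd \<pi>) + snd (hd \<pi>) = Suc (fst (last \<pi>) + snd (last \<pi>))"
proof (induction \<pi>)
  case Nil
  then show ?case by simp
next
  case (Cons p \<pi>)
  show ?case
  proof (cases \<pi>)
    case Nil
    then show ?thesis by (cases p) auto
  next
    case (Cons q \<pi>')
    then show ?thesis
      using Cons.IH Cons.prems by (cases p; cases q) (auto simp: lattice_step_def)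
  qed
qed

lemma finite_lattice_paths: "finite (lattice_paths k l)"
proof (rule finite_subset)
  show "lattice_paths k l \<subseteq> {\<pi>. set \<pi> \<subseteq> {..k} \<times> {..l} \<and> length \<pi> \<le> Suc (k + l)}"
    unfolding lattice_paths_def using lattice_path_bounds by fastforce
  show "finite {\<pi>. set \<pi> \<subseteq> {..k} \<times> {..l} \<and> length \<pi> \<le> Suc (k + l)}"
    by (rule finite_lists_length_le) simp
qed

lemma lattice_paths_snoc:
  "\<pi> \<in> lattice_paths k l \<Longrightarrow> lattice_step (k, l) (k', l') \<Longrightarrow>
     \<pi> @ [(k', l')] \<in> lattice_paths k' l'"
  by (auto simp: lattice_paths_def successively_append_iff)

lemma lattice_paths_nonempty: "lattice_paths k l \<noteq> {}"
proof (induction l)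
  case 0
  show ?case
  proof (induction k)
    case 0
    have "[(0, 0)] \<in> lattice_paths 0 0" by (simp add: lattice_paths_def)
    then show ?case by blast
  next
    case (Suc k)
    then show ?case using lattice_paths_snoc[of _ k 0 "Suc k" 0]
      by (fastforce simp: lattice_step_def)
  qed
next
  case (Suc l)
  then show ?case using lattice_paths_snoc[of _ k l k "Suc l"]
    by (fastforce simp: lattice_step_def)
qed

text \<open>
  Environment \<open>F\<close> and weights \<open>X\<close> live on a common probability space. The last assumption says
  that, conditionally on \<open>\<sigma>(F)\<close>, the weights \<open>X (i, j)\<close> are independent with
  law \<open>F j\<close>: the conditional probability of \<open>\<forall>z\<in>J. X z \<in> B z\<close> is
  \<open>\<Prod>z\<in>J. F (snd z) (B z)\<close>.
\<close>

locale weights_in_environment = prob_space M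
  for M :: "'w measure"
    and F :: "nat \<Rightarrow> 'w \<Rightarrow> real measure"
    and X :: "nat \<times> nat \<Rightarrow> 'w \<Rightarrow> real" +
  assumes environment_measurable: "\<And>j. F j \<in> measurable M (prob_algebra borel)"
    and weights_measurable: "\<And>z. X z \<in> borel_measurable M"
    and quenched_law:
      "\<And>A J B. A \<in> sets (\<Pi>\<^sub>M j\<in>UNIV. prob_algebra borel) \<Longrightarrow> finite J \<Longrightarrow>
         (\<And>z. z \<in> J \<Longrightarrow> B z \<in> sets borel) \<Longrightarrow>
         prob {\<omega> \<in> space M. (\<lambda>j. F j \<omega>) \<in> A \<and> (\<forall>z\<in>J. X z \<omega> \<in> B z)} =
         expectation (\<lambda>\<omega>. indicator A (\<lambda>j. F j \<omega>) * (\<Prod>z\<in>J. measure (F (snd z) \<omega>) (B z)))"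

definition iid_environment :: "'w measure \<Rightarrow> (nat \<Rightarrow> 'w \<Rightarrow> real measure) \<Rightarrow> bool" where
  "iid_environment M F \<longleftrightarrow>
     prob_space.indep_vars M (\<lambda>_. prob_algebra borel) F UNIV \<and>
     (\<forall>j. distr M (prob_algebra borel) (F j) = distr M (prob_algebra borel) (F 0))"

definition scaled_passage ::
    "(nat \<times> nat \<Rightarrow> 'w \<Rightarrow> real) \<Rightarrow> real \<Rightarrow> real \<Rightarrow> nat \<Rightarrow> 'w \<Rightarrow> real" where
  "scaled_passage X x y n \<omega> =
     last_passage (\<lambda>z. X z \<omega>) (nat \<lfloor>real n * x\<rfloor>) (nat \<lfloor>real n * y\<rfloor>) / real n"

text \<open>\<open>\<Psi>\<close> is the deterministic limit of the scaled passage times, almost surely and in \<open>L\<^sup>1\<close>;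
  only its values on the open quadrant are constrained.\<close>

definition is_limit_shape ::
    "'w measure \<Rightarrow> (nat \<times> nat \<Rightarrow> 'w \<Rightarrow> real) \<Rightarrow> (real \<Rightarrow> real \<Rightarrow> real) \<Rightarrow> bool" where
  "is_limit_shape M X \<Psi> \<longleftrightarrow>
     (\<forall>x>0. \<forall>y>0.
        (AE \<omega> in M. (\<lambda>n. scaled_passage X x y n \<omega>) \<longlonglongrightarrow> \<Psi> x y) \<and>
        (\<lambda>n. \<integral>\<^sup>+\<omega>. ennreal \<bar>scaled_passage X x y n \<omega> - \<Psi> x y\<bar> \<partial>M) \<longlonglongrightarrow> 0)"

definition dist_mean :: "real measure \<Rightarrow> real" where
  "dist_mean H = prob_space.expectation H (\<lambda>x. x)"

definition dist_variance :: "real measure \<Rightarrow> real" where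
  "dist_variance H = prob_space.variance H (\<lambda>x. x)"

end

theory Submission
  imports Defs "HOL-Real_Asymp.Real_Asymp"
begin

text \<open>
  A path collects one weight per column at its horizontal steps and one per row at its vertical steps.
  The vertical steps visit only \<open>\<alpha> n\<close> points, and they contribute \<open>o(sqrt \<alpha>)\<close>; so the
  problem is last-passage percolation with one point per column and weakly increasing rows.

  For Bernoulli(\<open>p\<close>) weights this model is solvable. The rows form a tandem of discrete queues, whose
  stationary version has Bernoulli(\<open>u\<close>) arrivals, \<open>u > p\<close>, and geometric queue lengths (Burke).
  The stationary passage time dominates, and optimising over \<open>u\<close> bounds the expectation by
  \<open>k p + 2 sqrt (k (l + 1) p (1 - p))\<close> for \<open>k\<close> columns and rows \<open>0..l\<close>.

  A weight outside \<open>[-B, B]\<close> is an integral over its levels \<open>x\<close> of Bernoulli indicators, so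
  the centred tails contribute at most a constant times \<open>sqrt \<alpha>\<close> times the part of
  \<open>\<integral> sqrt (H (1 - H))\<close> outside \<open>[-B, B]\<close>; rows with another distribution are filled with independent centred
  weights, which only increases the expected maximum. The bounded part has variance at most \<open>\<sigma>*\<^sup>2\<close>,
  and a Lindeberg replacement in the free energy, column by column, compares it with the symmetric weights
  \<open>\<plusminus>\<sigma>*\<close>, for which the Bernoulli(1/2) bound gives \<open>2 \<sigma>* sqrt \<alpha>\<close>.
  All of this holds uniformly for every fixed environment with values in \<open>{H\<^sub>1, \<dots>, H\<^sub>L}\<close>.
\<close>

section \<open>Up-right paths with one point per column\<close>

text \<open>Neither method works alone. Layers over all levels would give
  \<open>2 \<integral> sqrt (H (1 - H))\<close>, which is at least \<open>2 \<sigma>\<close> and in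
  general larger, times the number of distributions. Replacement needs bounded weights or third
  moments, while the tail condition yields only second moments. Cutting at \<open>B\<close> gives
  the sharp constant to the bounded part and leaves a crude constant times a small number outside.
  For symmetric signs the layer bound loses nothing, since there a single level carries the whole
  weight; this is why signs are the reference field.

  The choices are made in the order \<open>\<eta>\<close>, \<open>d\<close>, \<open>B\<close>, and
  then \<alpha> tends to 0, so \<open>B\<close> counts as a constant. Per column, the logarithm of
  the number of paths is of order \<alpha> ln (1/\<alpha>); smoothing the maximum at inverse
  temperature \<beta> costs this divided by \<beta>, and replacement costs \<beta>^2 B^3. Both are
  small against sqrt \<alpha> when \<beta> lies well between sqrt \<alpha> ln (1/\<alpha>) and
  \<alpha>^(1/4); the exponent 3/8 is midway between 1/2 and 1/4.

  Expectations are enough because the limit is deterministic and is attained in the mean.\<close>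

primrec hpaths :: "nat \<Rightarrow> nat \<Rightarrow> (nat \<times> nat) set set" where
  "hpaths 0 l = {{}}"
| "hpaths (Suc k) l = (\<Union>j\<le>l. insert (k, j) ` hpaths k j)"

definition max_weight :: "'a set set \<Rightarrow> ('a \<Rightarrow> real) \<Rightarrow> real" where
  "max_weight P w = (MAX \<pi>\<in>P. sum w \<pi>)"

text \<open>The row argument is a cap and not an endpoint: the recursion peels off the last column
  and hands its row down as the new cap, so rows increase weakly and both end rows are free.
  Forgetting the endpoints only enlarges the family, which is safe for an upper bound.\<close>

lemma hpaths_mono: "l \<le> l' \<Longrightarrow> hpaths k l \<subseteq> hpaths k l'"
proof (cases k)
  case (Suc k')
  assume "l \<le> l'"
  then have "{..l} \<subseteq> {..l'}" by simp
  then show ?thesis unfolding Suc hpaths.simps by (rule UN_mono) simp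
qed simp

lemma finite_hpaths: "finite (hpaths k l)"
  by (induction k arbitrary: l) auto

lemma hpaths_nonempty: "hpaths k l \<noteq> {}"
  by (induction k arbitrary: l) auto

lemma hpaths_subset: "\<pi> \<in> hpaths k l \<Longrightarrow> \<pi> \<subseteq> {..<k} \<times> {..l}"
proof (induction k arbitrary: l \<pi>)
  case (Suc k)
  then obtain j \<pi>' where "j \<le> l" "\<pi>' \<in> hpaths k j" "\<pi> = insert (k, j) \<pi>'" by auto
  with Suc.IH[of \<pi>' j] show ?case by force
qed auto

lemma hpaths_column: "\<pi> \<in> hpaths k l \<Longrightarrow> i < k \<Longrightarrow> card (\<pi> \<inter> {i} \<times> UNIV) = 1"
proof (induction k arbitrary: l \<pi>)
  case (Suc k)
  then obtain j \<pi>' where \<pi>: "j \<le> l" "\<pi>' \<in> hpaths k j" "\<pi> = insert (k, j) \<pi>'" by auto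
  have sub: "\<pi>' \<subseteq> {..<k} \<times> {..j}" using \<pi> hpaths_subset by blast
  show ?case
  proof (cases "i = k")
    case True
    have "\<pi> \<inter> {i} \<times> UNIV = {(k,j)}" using sub \<pi>(3) True by auto
    then show ?thesis by simp
  next
    case False
    have "\<pi> \<inter> {i} \<times> UNIV = \<pi>' \<inter> {i} \<times> UNIV" using \<pi>(3) False by auto
    with Suc.IH[OF \<pi>(2)] False Suc.prems show ?thesis by simp
  qed
qed auto

lemma card_hpath: "\<pi> \<in> hpaths k l \<Longrightarrow> card \<pi> = k"
proof (induction k arbitrary: l \<pi>)
  case (Suc k)
  then obtain j \<pi>' where \<pi>: "j \<le> l" "\<pi>' \<in> hpaths k j" "\<pi> = insert (k, j) \<pi>'" by auto
  have "finite \<pi>'" "(k,j) \<notin> \<pi>'" using hpaths_subset[OF \<pi>(2)] by (auto intro: finite_subset)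
  then show ?case using Suc.IH \<pi> by simp
qed auto

text \<open>A generating-function bound: discounting each row by \<open>x\<close> turns the
  recursion over columns into a geometric series. Taking \<open>x\<close> to be the aspect ratio
  \<alpha> later gives the entropy rate \<open>- \<alpha> ln \<alpha> - ln (1 - \<alpha>)\<close>
  per column.\<close>

lemma card_hpaths_le:
  fixes x :: real assumes "0 < x" "x < 1"
  shows "real (card (hpaths k l)) * x ^ l \<le> (1 / (1 - x)) ^ k"
proof (induction k arbitrary: l)
  case 0
  then show ?case using assms by (simp add: power_le_one)
next
  case (Suc k)
  have "card (hpaths (Suc k) l) \<le> (\<Sum>j\<le>l. card (insert (k, j) ` hpaths k j))"
    by (simp add: card_UN_le)
  also have "\<dots> \<le> (\<Sum>j\<le>l. card (hpaths k j))"
    by (intro sum_mono card_image_le finite_hpaths)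
  finally have "real (card (hpaths (Suc k) l)) * x ^ l \<le> (\<Sum>j\<le>l. real (card (hpaths k j))) * x ^ l"
    using assms by (intro mult_right_mono) (simp_all flip: of_nat_sum)
  also have "\<dots> = (\<Sum>j\<le>l. (real (card (hpaths k j)) * x ^ j) * x ^ (l - j))"
    by (simp add: sum_distrib_right mult.assoc flip: power_add)
  also have "\<dots> \<le> (\<Sum>j\<le>l. (1 / (1 - x)) ^ k * x ^ (l - j))"
    using assms by (intro sum_mono mult_right_mono Suc.IH) auto
  also have "\<dots> = (1 / (1 - x)) ^ k * (\<Sum>j\<le>l. x ^ j)"
    unfolding sum_distrib_left[symmetric]
    by (subst sum.nat_diff_reindex[symmetric, of _ "Suc l", simplified lessThan_Suc_atMost]) simp
  also have "\<dots> \<le> (1 / (1 - x)) ^ k * (1 / (1 - x))"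
  proof (intro mult_left_mono)
    have "(\<Sum>j\<le>l. x ^ j) = (1 - x ^ Suc l) / (1 - x)"
      using assms by (simp add: sum_gp0)
    also have "\<dots> \<le> 1 / (1 - x)"
      using assms by (intro divide_right_mono) auto
    finally show "(\<Sum>j\<le>l. x ^ j) \<le> 1 / (1 - x)" .
  qed (use assms in auto)
  finally show ?case by simp
qed

section \<open>Burke property of the tandem of queues\<close>

text \<open>Consider passage times with
  \<open>G (j+1) (i+1) = max (G (j+1) i + x) (G j (i+1))\<close>. Let
  \<open>a = G j (i+1) - G j i\<close> be the increment along the bottom of a cell and
  \<open>q = G (j+1) i - G j i\<close> the one along its left side. Then \<open>queue_step\<close>
  is the increment along the right side and \<open>departures\<close> the one along the top.\<close>

abbreviation queue_step :: "bool \<Rightarrow> bool \<Rightarrow> nat \<Rightarrow> nat" where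
  "queue_step x a q \<equiv> if x then (if a then q else Suc q) else if a then q - 1 else q"

primrec queue :: "(nat \<Rightarrow> bool) \<Rightarrow> (nat \<Rightarrow> bool) \<Rightarrow> nat \<Rightarrow> nat \<Rightarrow> nat" where
  "queue a x e 0 = e"
| "queue a x e (Suc i) =
     queue_step (x i) (a i) (queue a x e i)"

text \<open>The cut-off \<open>i < k\<close> makes the output vanish outside \<open>{..<k}\<close>,
  like a sample of \<open>coins\<close>, so that input and output can have equal laws as whole
  functions.\<close>

definition departures :: "nat \<Rightarrow> (nat \<Rightarrow> bool) \<Rightarrow> (nat \<Rightarrow> bool) \<Rightarrow> nat \<Rightarrow> nat \<Rightarrow> bool" where
  "departures k a x e i \<longleftrightarrow> i < k \<and> (x i \<or> a i \<and> queue a x e i = 0)"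

lemma queue_cong:
  "(\<And>i. i < k \<Longrightarrow> a i = a' i \<and> x i = x' i) \<Longrightarrow> queue a x e k = queue a' x' e k"
  by (induction k) (auto simp: Let_def)

text \<open>Increments of a passage time do not depend on the way around a rectangle: bottom and
  then right side give the same as left side and then top.\<close>

lemma queue_balance:
  "queue a x e i + (\<Sum>t<i. of_bool (a t)) = e + (\<Sum>t<i. of_bool (x t \<or> a t \<and> queue a x e t = 0))"
  by (induction i) (auto simp: Let_def)

abbreviation coin_field :: "'i set \<Rightarrow> real \<Rightarrow> ('i \<Rightarrow> bool) pmf" where
  "coin_field J p \<equiv> Pi_pmf J False (\<lambda>_. bernoulli_pmf p)"

abbreviation coins :: "real \<Rightarrow> nat \<Rightarrow> (nat \<Rightarrow> bool) pmf" where
  "coins p k \<equiv> coin_field {..<k} p"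

lemma coins_Suc: "coins p (Suc k) = do {f \<leftarrow> coins p k; y \<leftarrow> bernoulli_pmf p; return_pmf (f(k := y))}"
  unfolding lessThan_Suc by (subst Pi_pmf_insert') (auto intro: bind_commute_pmf)

lemma departures_upd:
  "departures (Suc k) (a(k := \<alpha>)) (x(k := \<xi>)) e = (departures k a x e)(k := \<xi> \<or> \<alpha> \<and> queue a x e k = 0)"
proof
  fix i
  have "queue (a(k := \<alpha>)) (x(k := \<xi>)) e i = queue a x e i" if "i \<le> k"
    using that by (intro queue_cong) auto
  then show "departures (Suc k) (a(k := \<alpha>)) (x(k := \<xi>)) e i = ((departures k a x e)(k := \<xi> \<or> \<alpha> \<and> queue a x e k = 0)) i"
    by (auto simp: departures_def less_Suc_eq)
qed

lemma queue_upd: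
  "queue (a(k := \<alpha>)) (x(k := \<xi>)) e (Suc k) =
    queue_step \<xi> \<alpha> (queue a x e k)"
proof -
  have "queue (a(k := \<alpha>)) (x(k := \<xi>)) e k = queue a x e k" by (intro queue_cong) auto
  then show ?thesis unfolding queue.simps fun_upd_same by (simp only:)
qed

section \<open>Queues in series and their stationary law\<close>

primrec tandem :: "nat \<Rightarrow> (nat \<Rightarrow> bool) \<Rightarrow> (nat \<Rightarrow> nat \<Rightarrow> bool) \<Rightarrow> (nat \<Rightarrow> nat) \<Rightarrow> nat \<Rightarrow> nat \<Rightarrow> bool" where
  "tandem k a w e 0 = a"
| "tandem k a w e (Suc j) = departures k (tandem k a w e j) (w j) (e j)"

abbreviation coin_rows :: "real \<Rightarrow> nat \<Rightarrow> nat \<Rightarrow> (nat \<Rightarrow> nat \<Rightarrow> bool) pmf" where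
  "coin_rows p k l \<equiv> Pi_pmf {..<l} (\<lambda>_. False) (\<lambda>_. coins p k)"

abbreviation geometrics :: "real \<Rightarrow> nat \<Rightarrow> (nat \<Rightarrow> nat) pmf" where
  "geometrics s l \<equiv> Pi_pmf {..<l} 0 (\<lambda>_. geometric_pmf s)"

lemma tandem_cong:
  "(\<And>j. j < l \<Longrightarrow> w j = w' j \<and> e j = e' j) \<Longrightarrow> tandem k a w e l = tandem k a w' e' l"
  by (induction l) auto

text \<open>The last equation is detailed balance for the queue length: it rises with probability
  \<open>p (1 - u)\<close>, falls from a positive value with probability \<open>(1 - p) u\<close>,
  and the geometric law has constant ratio \<open>1 - s\<close>.\<close>

locale stationary_queue =
  fixes p u s :: real
  assumes p: "0 \<le> p" "p \<le> 1" and u: "0 \<le> u" "u \<le> 1" and s: "0 < s" "s \<le> 1"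
    and stationary: "(1 - s) * ((1 - p) * u) = p * (1 - u)"
begin

text \<open>Besides the stationarity of the length, the output bit is independent of the new length.
  A departure that leaves length \<open>n > 0\<close> comes from a coincidence at length
  \<open>n\<close> or from a rise out of \<open>n - 1\<close>; detailed balance turns the second
  contribution into exactly the mass that the first one lacks.\<close>

lemma burke_step:
  shows "bind_pmf (bernoulli_pmf u) (\<lambda>\<alpha>. bind_pmf (bernoulli_pmf p) (\<lambda>\<xi>.
      map_pmf (\<lambda>e. (\<xi> \<or> \<alpha> \<and> e = 0,
         queue_step \<xi> \<alpha> e)) (geometric_pmf s)))
    = pair_pmf (bernoulli_pmf u) (geometric_pmf s)" (is "?L = ?R")
proof (rule pmf_eqI)
  fix z :: "bool \<times> nat"
  obtain b n where z: "z = (b, n)" by (cases z)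
  define g where "g = pmf (geometric_pmf s)"
  have g: "g m = (1 - s) ^ m * s" for m using s by (simp add: g_def)
  let ?f = "\<lambda>\<xi> \<alpha> e. (\<xi> \<or> \<alpha> \<and> e = 0, queue_step \<xi> \<alpha> e)"
  have L: "pmf ?L z =
    u * (p * measure (geometric_pmf s) {e. ?f True True e = z} + (1 - p) * measure (geometric_pmf s) {e. ?f False True e = z}) +
    (1 - u) * (p * measure (geometric_pmf s) {e. ?f True False e = z} + (1 - p) * measure (geometric_pmf s) {e. ?f False False e = z})"
    using p u by (simp add: pmf_bind pmf_map vimage_def algebra_simps)
  have s1: "u * (1 - p) * s = u - p" using stationary by (simp add: algebra_simps)
  have gS: "u * (1 - p) * g (Suc m) = p * (1 - u) * g m" for m
  proof -
    have "u * (1 - p) * g (Suc m) = ((1 - s) * ((1 - p) * u)) * g m" by (simp add: g)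
    then show ?thesis by (simp add: stationary)
  qed
  have m1: "measure (geometric_pmf s) {e. ?f True True e = z} = (if b then g n else 0)"
    by (auto simp: z g_def measure_pmf_single)
  have m2: "measure (geometric_pmf s) {e. ?f True False e = z} = (if b \<and> n > 0 then g (n - 1) else 0)"
  proof (cases "b \<and> n > 0")
    case True
    then have "{e. ?f True False e = z} = {n - 1}" by (auto simp: z)
    then show ?thesis using True by (simp add: g_def measure_pmf_single)
  next
    case False
    then have "{e. ?f True False e = z} = {}" by (auto simp: z)
    then show ?thesis using False by (auto simp: g_def measure_pmf_single)
  qed
  have m3: "measure (geometric_pmf s) {e. ?f False True e = z} =
      (if b then if n = 0 then g 0 else 0 else g (Suc n))"
  proof -
    have "{e. ?f False True e = z} = (if b then if n = 0 then {0} else {} else {Suc n})" by (auto simp: z)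
    then show ?thesis by (simp add: g_def measure_pmf_single)
  qed
  have m4: "measure (geometric_pmf s) {e. ?f False False e = z} = (if b then 0 else g n)"
    by (auto simp: z g_def measure_pmf_single)
  have R: "pmf ?R z = (if b then u else 1 - u) * g n"
    using u by (simp add: z pmf_pair g_def)
  show "pmf ?L z = pmf ?R z"
  proof (cases b)
    case True
    show ?thesis
    proof (cases n)
      case 0
      have "u * (p * g 0 + (1 - p) * g 0) = u * g 0" by (simp add: algebra_simps)
      then show ?thesis unfolding L m1 m2 m3 m4 R using True 0 by simp
    next
      case (Suc m)
      have "u * (p * g n) + (1 - u) * (p * g m) = u * p * g n + p * (1 - u) * g m"
        by (simp add: algebra_simps)
      also have "\<dots> = u * g n" unfolding gS[symmetric] Suc by (simp add: algebra_simps)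
      finally show ?thesis unfolding L m1 m2 m3 m4 R using True Suc by simp
    qed
  next
    case False
    have "u * ((1 - p) * g (Suc n)) + (1 - u) * ((1 - p) * g n) = u * (1 - p) * g (Suc n) + (1 - u) * (1 - p) * g n"
      by (simp add: algebra_simps)
    also have "\<dots> = (1 - u) * g n" unfolding gS by (simp add: algebra_simps)
    finally show ?thesis unfolding L m1 m2 m3 m4 R using False by simp
  qed
qed

text \<open>The final queue length stays in the statement, independent of all departures so far,
  because the next time step acts on exactly that pair.\<close>

lemma burke_row:
  shows "do {e \<leftarrow> geometric_pmf s; a \<leftarrow> coins u k; x \<leftarrow> coins p k;
           return_pmf (departures k a x e, queue a x e k)} = pair_pmf (coins u k) (geometric_pmf s)"
proof (induction k)
  case 0
  have "departures 0 a x e = (\<lambda>_. False)" for a x e by (auto simp: departures_def)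
  then show ?case by (simp add: pair_return_pmf1 bind_return_pmf map_pmf_def)
next
  case (Suc k)
  have "do {e \<leftarrow> geometric_pmf s; a \<leftarrow> coins u (Suc k); x \<leftarrow> coins p (Suc k);
           return_pmf (departures (Suc k) a x e, queue a x e (Suc k))} =
    do {e \<leftarrow> geometric_pmf s; a \<leftarrow> coins u k; \<alpha> \<leftarrow> bernoulli_pmf u; x \<leftarrow> coins p k; \<xi> \<leftarrow> bernoulli_pmf p;
           return_pmf ((departures k a x e)(k := \<xi> \<or> \<alpha> \<and> queue a x e k = 0),
           queue_step \<xi> \<alpha> (queue a x e k))}"
    by (simp add: coins_Suc bind_assoc_pmf bind_return_pmf departures_upd queue_upd del: queue.simps)
  also have "\<dots> = do {e \<leftarrow> geometric_pmf s; a \<leftarrow> coins u k; x \<leftarrow> coins p k; \<alpha> \<leftarrow> bernoulli_pmf u; \<xi> \<leftarrow> bernoulli_pmf p;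
           return_pmf ((departures k a x e)(k := \<xi> \<or> \<alpha> \<and> queue a x e k = 0),
           queue_step \<xi> \<alpha> (queue a x e k))}"
    by (intro bind_pmf_cong refl bind_commute_pmf)
  also have "\<dots> = do {(d, q) \<leftarrow> do {e \<leftarrow> geometric_pmf s; a \<leftarrow> coins u k; x \<leftarrow> coins p k;
           return_pmf (departures k a x e, queue a x e k)}; \<alpha> \<leftarrow> bernoulli_pmf u; \<xi> \<leftarrow> bernoulli_pmf p;
           return_pmf (d(k := \<xi> \<or> \<alpha> \<and> q = 0),
            queue_step \<xi> \<alpha> q)}"
    by (simp add: bind_assoc_pmf bind_return_pmf Let_def)
  also have "\<dots> = do {d \<leftarrow> coins u k; q \<leftarrow> geometric_pmf s; \<alpha> \<leftarrow> bernoulli_pmf u; \<xi> \<leftarrow> bernoulli_pmf p;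
           return_pmf (d(k := \<xi> \<or> \<alpha> \<and> q = 0),
            queue_step \<xi> \<alpha> q)}"
    unfolding Suc by (simp add: pair_pmf_def bind_assoc_pmf bind_return_pmf)
  also have "\<dots> = do {d \<leftarrow> coins u k; (b, q) \<leftarrow> do {\<alpha> \<leftarrow> bernoulli_pmf u; \<xi> \<leftarrow> bernoulli_pmf p; 
           map_pmf (\<lambda>e. (\<xi> \<or> \<alpha> \<and> e = 0,
         queue_step \<xi> \<alpha> e)) (geometric_pmf s)};
           return_pmf (d(k := b), q)}"
    unfolding map_pmf_def bind_assoc_pmf bind_return_pmf prod.case
    apply (intro bind_pmf_cong refl)
    apply (subst bind_commute_pmf)
    apply (intro bind_pmf_cong refl)
    apply (subst bind_commute_pmf)
    apply (intro bind_pmf_cong refl)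
    done
  also have "\<dots> = pair_pmf (coins u (Suc k)) (geometric_pmf s)"
    unfolding burke_step by (simp add: pair_pmf_def bind_assoc_pmf bind_return_pmf coins_Suc)
  finally show ?case .
qed

text \<open>The output of one row is the input of the next, and each row brings fresh coins and a
  fresh initial length, so the law \<open>coins u k\<close> is passed on unchanged.\<close>

lemma burke_tandem:
  shows "do {a \<leftarrow> coins u k; w \<leftarrow> coin_rows p k l; e \<leftarrow> geometrics s l;
           return_pmf (tandem k a w e l)} = coins u k"
proof (induction l)
  case 0
  then show ?case by (simp add: bind_return_pmf bind_return_pmf')
next
  case (Suc l)
  have *: "tandem k a (w(l := x)) (e(l := y)) (Suc l) = departures k (tandem k a w e l) x y" for a w e x y
  proof -
    have "tandem k a (w(l := x)) (e(l := y)) l = tandem k a w e l" by (rule tandem_cong) auto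
    then show ?thesis by simp
  qed
  have rw: "coin_rows p k (Suc l) = do {w \<leftarrow> coin_rows p k l; x \<leftarrow> coins p k; return_pmf (w(l := x))}"
    unfolding lessThan_Suc[of l] by (subst Pi_pmf_insert') (auto intro: bind_commute_pmf)
  have gm: "geometrics s (Suc l) = do {w \<leftarrow> geometrics s l; x \<leftarrow> geometric_pmf s; return_pmf (w(l := x))}"
    unfolding lessThan_Suc[of l] by (subst Pi_pmf_insert') (auto intro: bind_commute_pmf)
  have "do {a \<leftarrow> coins u k; w \<leftarrow> coin_rows p k (Suc l); e \<leftarrow> geometrics s (Suc l);
           return_pmf (tandem k a w e (Suc l))} =
    do {a \<leftarrow> coins u k; w \<leftarrow> coin_rows p k l; x \<leftarrow> coins p k; e \<leftarrow> geometrics s l; y \<leftarrow> geometric_pmf s;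
           return_pmf (departures k (tandem k a w e l) x y)}"
    unfolding rw gm bind_assoc_pmf bind_return_pmf * ..
  also have "\<dots> = do {a \<leftarrow> coins u k; w \<leftarrow> coin_rows p k l; e \<leftarrow> geometrics s l; x \<leftarrow> coins p k; y \<leftarrow> geometric_pmf s;
           return_pmf (departures k (tandem k a w e l) x y)}"
    by (intro bind_pmf_cong refl bind_commute_pmf)
  also have "\<dots> = do {a \<leftarrow> do {a \<leftarrow> coins u k; w \<leftarrow> coin_rows p k l; e \<leftarrow> geometrics s l;
           return_pmf (tandem k a w e l)}; x \<leftarrow> coins p k; y \<leftarrow> geometric_pmf s;
           return_pmf (departures k a x y)}"
    by (simp add: bind_assoc_pmf bind_return_pmf)
  also have "\<dots> = do {a \<leftarrow> coins u k; x \<leftarrow> coins p k; y \<leftarrow> geometric_pmf s;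
           return_pmf (departures k a x y)}"
    unfolding Suc ..
  also have "\<dots> = do {a \<leftarrow> coins u k; y \<leftarrow> geometric_pmf s; x \<leftarrow> coins p k;
           return_pmf (departures k a x y)}"
    by (intro bind_pmf_cong refl bind_commute_pmf)
  also have "\<dots> = do {y \<leftarrow> geometric_pmf s; a \<leftarrow> coins u k; x \<leftarrow> coins p k;
           return_pmf (departures k a x y)}"
    by (rule bind_commute_pmf)
  also have "\<dots> = map_pmf fst (do {e \<leftarrow> geometric_pmf s; a \<leftarrow> coins u k; x \<leftarrow> coins p k;
           return_pmf (departures k a x e, queue a x e k)})"
    by (simp add: map_bind_pmf)
  also have "\<dots> = coins u k"
    unfolding burke_row by (simp add: map_fst_pair_pmf)
  finally show ?case .
qed

end

text \<open>The tandem describes passage times with nonnegative boundary data, which can only help a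
  path. Rows \<open>0..l\<close> need \<open>Suc l\<close> stations.\<close>

lemma hpaths_sum_le_tandem:
  fixes a :: "nat \<Rightarrow> bool" and w :: "nat \<Rightarrow> nat \<Rightarrow> bool" and e :: "nat \<Rightarrow> nat"
  assumes "\<pi> \<in> hpaths i l" "i \<le> k"
  shows "(\<Sum>z\<in>\<pi>. of_bool (w (snd z) (fst z))) \<le>
     (\<Sum>j\<le>l. e j) + (\<Sum>t<i. of_bool (tandem k a w e (Suc l) t) :: nat)"
  using assms
proof (induction i arbitrary: l \<pi>)
  case (Suc i)
  \<comment> \<open>The stationary passage time: up the left side, then along the output of station
    \<open>j\<close>. Its vertical increments are queue lengths, hence nonnegative, and
    \<open>D (Suc j)\<close> is the first value that has seen row \<open>j\<close>.\<close>
  define D where "D j i = (\<Sum>j<j. e j) + (\<Sum>t<i. of_bool (tandem k a w e j t) :: nat)" for j i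
  have dep: "(\<Sum>t<i. of_bool (departures k a x y t) :: nat) = (\<Sum>t<i. of_bool (x t \<or> a t \<and> queue a x y t = 0))"
    if "i \<le> k" for a x y i
    using that by (intro sum.cong) (auto simp: departures_def)
  have D_Suc: "D (Suc j) i = D j i + queue (tandem k a w e j) (w j) (e j) i" if "i \<le> k" for j i
    using queue_balance[of "tandem k a w e j" "w j" "e j" i]
    unfolding D_def tandem.simps dep[OF that] sum.lessThan_Suc[of e] by linarith
  have D_mono: "j \<le> j' \<Longrightarrow> D j (Suc i) \<le> D j' (Suc i)" for j j'
    by (rule lift_Suc_mono_le[of "\<lambda>j. D j (Suc i)"]) (use Suc.prems in \<open>auto simp: D_Suc\<close>)
  obtain j \<pi>' where \<pi>: "j \<le> l" "\<pi>' \<in> hpaths i j" "\<pi> = insert (i, j) \<pi>'" using Suc.prems by auto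
  have "finite \<pi>'" "(i,j) \<notin> \<pi>'" using hpaths_subset[OF \<pi>(2)] by (auto intro: finite_subset)
  then have "(\<Sum>z\<in>\<pi>. of_bool (w (snd z) (fst z))) = of_bool (w j i) + (\<Sum>z\<in>\<pi>'. of_bool (w (snd z) (fst z)) :: nat)"
    using \<pi>(3) by simp
  also have "\<dots> \<le> of_bool (w j i) + D (Suc j) i"
    using Suc.IH[OF \<pi>(2)] Suc.prems unfolding D_def lessThan_Suc_atMost by simp
  also have "\<dots> \<le> D (Suc j) (Suc i)"
    using Suc.prems by (auto simp: D_def departures_def)
  also have "\<dots> \<le> D (Suc l) (Suc i)" using \<pi>(1) by (intro D_mono) auto
  finally show ?case unfolding D_def lessThan_Suc_atMost .
qed simp

section \<open>Bernoulli weights\<close>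

lemma max_weight_ge: "finite P \<Longrightarrow> \<pi> \<in> P \<Longrightarrow> sum w \<pi> \<le> max_weight P w"
  unfolding max_weight_def by (intro Max_ge) auto

lemma max_weight_le: "finite P \<Longrightarrow> P \<noteq> {} \<Longrightarrow> (\<And>\<pi>. \<pi> \<in> P \<Longrightarrow> sum w \<pi> \<le> c) \<Longrightarrow> max_weight P w \<le> c"
  unfolding max_weight_def by (intro Max.boundedI) auto

lemma max_weight_cong:
  assumes "\<And>\<pi> z. \<pi> \<in> P \<Longrightarrow> z \<in> \<pi> \<Longrightarrow> w z = w' z"
  shows "max_weight P w = max_weight P w'"
proof -
  have "sum w ` P = sum w' ` P" by (intro image_cong refl sum.cong assms)
  then show ?thesis by (simp add: max_weight_def)
qed

lemma nn_integral_pmf_const: "(\<integral>\<^sup>+x. c \<partial>measure_pmf M) = c"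
  by (simp add: measure_pmf.emeasure_space_1)

lemma divide_divide_eq_cancel: "(c::real) \<noteq> 0 \<Longrightarrow> (a / c) / (b / c) = a / b"
  by simp

lemma nn_integral_geometrics:
  assumes "0 < s" "s \<le> 1"
  shows "(\<integral>\<^sup>+e. of_nat (\<Sum>j\<le>l. e j) \<partial>geometrics s (Suc l)) = ennreal (real (Suc l) * ((1 - s) / s))"
proof -
  let ?G = "geometrics s (Suc l)"
  have geo: "(\<integral>\<^sup>+n. ennreal (real n) \<partial>geometric_pmf s) = ennreal ((1 - s) / s)"
    using assms by (subst nn_integral_eq_integral)
      (auto intro!: integrable_real_geometric_pmf expectation_geometric_pmf arg_cong[where f=ennreal])
  have "(\<integral>\<^sup>+e. of_nat (\<Sum>j\<le>l. e j) \<partial>?G) =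
      (\<Sum>j\<le>l. \<integral>\<^sup>+e. of_nat (e j) \<partial>?G)"
    by (simp add: nn_integral_sum)
  also have "\<dots> = (\<Sum>j\<le>l. \<integral>\<^sup>+n. of_nat n \<partial>map_pmf (\<lambda>e. e j) (?G))"
    by simp
  also have "\<dots> = (\<Sum>j\<le>l. \<integral>\<^sup>+n. of_nat n \<partial>geometric_pmf s)"
    by (intro sum.cong refl) (subst Pi_pmf_component, auto)
  also have "\<dots> = of_nat (Suc l) * ennreal ((1 - s) / s)"
    using geo by (simp add: ennreal_of_nat_eq_real_of_nat)
  also have "\<dots> = ennreal (real (Suc l) * ((1 - s) / s))"
    using assms by (simp only: ennreal_of_nat_eq_real_of_nat) (intro ennreal_mult[symmetric], auto)
  finally show ?thesis .
qed

lemma nn_integral_coins: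
  assumes "0 \<le> u" "u \<le> 1"
  shows "(\<integral>\<^sup>+d. of_nat (\<Sum>t<k. of_bool (d t)) \<partial>coins u k) = ennreal (real k * u)"
proof -
  have "(\<integral>\<^sup>+d. of_nat (\<Sum>t<k. of_bool (d t)) \<partial>coins u k) =
      (\<integral>\<^sup>+d. (\<Sum>t<k. of_bool (d t)) \<partial>coins u k)"
    by (intro nn_integral_cong) (simp add: of_nat_sum)
  also have "\<dots> = (\<Sum>t<k. \<integral>\<^sup>+d. of_bool (d t) \<partial>coins u k)"
    by (subst nn_integral_sum) auto
  also have "\<dots> = (\<Sum>t<k. \<integral>\<^sup>+b. of_bool b \<partial>map_pmf (\<lambda>d. d t) (coins u k))"
    by simp
  also have "\<dots> = (\<Sum>t<k. \<integral>\<^sup>+b. of_bool b \<partial>bernoulli_pmf u)"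
    by (intro sum.cong refl) (subst Pi_pmf_component, auto)
  also have "\<dots> = (\<Sum>t<k. ennreal u)"
    using assms by (simp add: nn_integral_bernoulli_pmf)
  also have "\<dots> = ennreal (real k * u)"
    using assms by (simp add: ennreal_of_nat_eq_real_of_nat ennreal_mult)
  finally show ?thesis .
qed

text \<open>The dominating passage time is read along the left side and the top, where the means are
  explicit: \<open>l + 1\<close> geometric lengths and, by Burke, \<open>k\<close> coins of
  parameter \<open>u\<close>. Only expectations are added, so the dependence between the two sides
  does not matter.\<close>

lemma coin_rows_bound_stationary:
  fixes p u :: real
  assumes p: "0 \<le> p" "p < 1" and u: "p < u" "u \<le> 1"
  shows "(\<integral>\<^sup>+w. ennreal (max_weight (hpaths k l) (\<lambda>z. of_bool (w (snd z) (fst z)))) \<partial>coin_rows p k (Suc l))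
    \<le> ennreal (real k * u + real (Suc l) * (p * (1 - u) / (u - p)))"
proof -
  let ?m = "\<lambda>w :: nat \<Rightarrow> nat \<Rightarrow> bool. max_weight (hpaths k l) (\<lambda>z. of_bool (w (snd z) (fst z)))"
  \<comment> \<open>The solution of the stationarity equation for given \<open>p\<close> and
    \<open>u\<close>.\<close>
  define s where "s = (u - p) / ((1 - p) * u)"
  have pos: "0 < (1 - p) * u" using p u by simp
  have nz: "(1 - p) * u \<noteq> 0" using pos by linarith
  have s: "0 < s" "s \<le> 1" "(1 - s) * ((1 - p) * u) = p * (1 - u)"
  proof -
    show "0 < s" using p u pos by (simp add: s_def)
    have "p * u \<le> p" using p u by (simp add: mult_left_le)
    then have "u - p \<le> (1 - p) * u" by (simp add: algebra_simps)
    then show "s \<le> 1" using pos by (simp add: s_def)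
    have "(1 - s) * ((1 - p) * u) = (1 - p) * u - s * ((1 - p) * u)" by (simp add: algebra_simps)
    also have "s * ((1 - p) * u) = u - p" unfolding s_def by (rule nonzero_divide_eq_eq[OF nz, THEN iffD1, OF refl, symmetric])
    finally show "(1 - s) * ((1 - p) * u) = p * (1 - u)" by (simp add: algebra_simps)
  qed
  have ratio: "(1 - s) / s = p * (1 - u) / (u - p)"
  proof -
    have "1 - s = p * (1 - u) / ((1 - p) * u)"
      by (rule eq_divide_imp) (use pos s(3) in auto)
    then have "(1 - s) / s = (p * (1 - u) / ((1 - p) * u)) / ((u - p) / ((1 - p) * u))"
      unfolding s_def by (rule arg_cong2[where f="(/)"]) rule
    also have "\<dots> = p * (1 - u) / (u - p)" by (rule divide_divide_eq_cancel[OF nz])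
    finally show ?thesis .
  qed
  let ?M = "\<lambda>w. ennreal (?m w)"
  let ?N = "\<lambda>a w e. (\<Sum>t<k. of_bool (tandem k a w e (Suc l) t) :: nat)"
  have M_le: "?M w \<le> of_nat (\<Sum>j\<le>l. e j) + of_nat (?N a w e)" for a w e
  proof -
    have "?m w \<le>
      real ((\<Sum>j\<le>l. e j) + ?N a w e)"
    proof (rule max_weight_le[OF finite_hpaths hpaths_nonempty])
      fix \<pi> assume "\<pi> \<in> hpaths k l"
      from hpaths_sum_le_tandem[OF this order.refl, of w e a]
      have "real (\<Sum>z\<in>\<pi>. of_bool (w (snd z) (fst z))) \<le> real ((\<Sum>j\<le>l. e j) + ?N a w e)"
        unfolding of_nat_le_iff .
      then show "(\<Sum>z\<in>\<pi>. of_bool (w (snd z) (fst z))) \<le> real ((\<Sum>j\<le>l. e j) + ?N a w e)"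
        unfolding of_nat_sum of_nat_of_bool .
    qed
    then have "?M w \<le> ennreal (real ((\<Sum>j\<le>l. e j) + ?N a w e))" by (rule ennreal_leI)
    then show ?thesis unfolding ennreal_of_nat_eq_real_of_nat[symmetric] unfolding of_nat_add .
  qed
  \<comment> \<open>The boundary variables \<open>a\<close> and \<open>e\<close> are integrated in
    as dummies; \<open>M_le\<close> holds for every realisation of them.\<close>
  have "(\<integral>\<^sup>+w. ?M w \<partial>coin_rows p k (Suc l)) =
     (\<integral>\<^sup>+a. \<integral>\<^sup>+w. \<integral>\<^sup>+e. ?M w \<partial>geometrics s (Suc l) \<partial>coin_rows p k (Suc l) \<partial>coins u k)"
    unfolding nn_integral_pmf_const ..
  also have "\<dots> \<le> (\<integral>\<^sup>+a. \<integral>\<^sup>+w. \<integral>\<^sup>+e. (of_nat (\<Sum>j\<le>l. e j) + of_nat (?N a w e))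
      \<partial>geometrics s (Suc l) \<partial>coin_rows p k (Suc l) \<partial>coins u k)"
    by (intro nn_integral_mono M_le)
  also have "\<dots> = (\<integral>\<^sup>+e. of_nat (\<Sum>j\<le>l. e j) \<partial>geometrics s (Suc l)) +
     (\<integral>\<^sup>+a. \<integral>\<^sup>+w. \<integral>\<^sup>+e. of_nat (?N a w e) \<partial>geometrics s (Suc l) \<partial>coin_rows p k (Suc l) \<partial>coins u k)"
    by (subst nn_integral_add, simp, simp)+ (simp only: nn_integral_pmf_const)
  also have "(\<integral>\<^sup>+a. \<integral>\<^sup>+w. \<integral>\<^sup>+e. of_nat (?N a w e) \<partial>geometrics s (Suc l) \<partial>coin_rows p k (Suc l) \<partial>coins u k) =
     (\<integral>\<^sup>+d. of_nat (\<Sum>t<k. of_bool (d t)) \<partial>measure_pmf (do {a \<leftarrow> coins u k; w \<leftarrow> coin_rows p k (Suc l);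
           e \<leftarrow> geometrics s (Suc l); return_pmf (tandem k a w e (Suc l))}))"
    by (simp only: nn_integral_bind_pmf nn_integral_return_pmf zero_le)
  also have "\<dots> = ennreal (real k * u)"
    using stationary_queue.burke_tandem[of p u s k "Suc l"] s p u nn_integral_coins[of u k]
    by (simp add: stationary_queue_def)
  also have "(\<integral>\<^sup>+e. of_nat (\<Sum>j\<le>l. e j) \<partial>geometrics s (Suc l)) = ennreal (real (Suc l) * ((1 - s) / s))"
    using s(1,2) by (rule nn_integral_geometrics)
  also have "\<dots> + ennreal (real k * u) = ennreal (real (Suc l) * ((1 - s) / s) + real k * u)"
    using s p u by (subst ennreal_plus) auto
  finally show ?thesis unfolding ratio by (simp add: add.commute)
qed

lemma hpaths_of_bool_le: "max_weight (hpaths k l) (\<lambda>z. of_bool (f z)) \<le> real k"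
proof (rule max_weight_le[OF finite_hpaths hpaths_nonempty])
  fix \<pi> assume "\<pi> \<in> hpaths k l"
  then show "(\<Sum>z\<in>\<pi>. of_bool (f z)) \<le> real k"
    using sum_bounded_above[of \<pi> "\<lambda>z. of_bool (f z)" "1::real"] by (simp add: card_hpath)
qed

text \<open>The free parameter of the stationary bound is optimised at \<open>u = p + sqrt ((l + 1) p (1 - p) / k)\<close>.\<close>

lemma coin_rows_bound:
  fixes p :: real
  assumes p: "0 \<le> p" "p \<le> 1"
  shows "(\<integral>\<^sup>+w. ennreal (max_weight (hpaths k l) (\<lambda>z. of_bool (w (snd z) (fst z)))) \<partial>coin_rows p k (Suc l))
    \<le> ennreal (real k * p + 2 * sqrt (real (k * Suc l) * (p * (1 - p))))" (is "?E \<le> ennreal ?B")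
proof -
  have triv: "?E \<le> ennreal (real k)"
  proof -
    have "?E \<le> (\<integral>\<^sup>+w. ennreal (real k) \<partial>coin_rows p k (Suc l))"
      by (intro nn_integral_mono ennreal_leI hpaths_of_bool_le)
    then show ?thesis by (simp only: nn_integral_pmf_const)
  qed
  consider "k = 0 \<or> p = 1" | "p = 0" | "0 < k" "0 < p" "p < 1" using p by fastforce
  then show ?thesis
  proof cases
    case 1
    then have "real k \<le> ?B" by auto
    then show ?thesis by (intro order_trans[OF triv] ennreal_leI)
  next
    case 2
    \<comment> \<open>For \<open>p = 0\<close> the optimal \<open>u\<close> would be
      \<open>p\<close> itself, which the stationary bound excludes;
      \<open>u = \<epsilon> / k\<close> approaches it.\<close>
    have "?E \<le> 0 + ennreal \<epsilon>" if "\<epsilon> > 0" for \<epsilon>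
    proof (cases "\<epsilon> < k")
      case True
      have "?E \<le> ennreal (real k * (\<epsilon> / k) + real (Suc l) * (p * (1 - \<epsilon> / k) / (\<epsilon> / k - p)))"
        using True that 2 by (intro coin_rows_bound_stationary) auto
      also have "real k * (\<epsilon> / k) + real (Suc l) * (p * (1 - \<epsilon> / k) / (\<epsilon> / k - p)) = \<epsilon>"
      proof -
        have "real k \<noteq> 0" using True that by linarith
        then show ?thesis using 2 by simp
      qed
      finally show ?thesis unfolding add_0 .
    next
      case False
      then have "ennreal (real k) \<le> 0 + ennreal \<epsilon>" by (simp add: ennreal_leI)
      then show ?thesis by (rule order_trans[OF triv])
    qed
    then have "?E \<le> 0" by (rule ennreal_le_epsilon)
    then show ?thesis by simp
  next
    case 3
    define d where "d = sqrt (real (Suc l) * (p * (1 - p)) / k)"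
    have d: "d > 0" using 3 by (simp add: d_def)
    have sq: "real k * d\<^sup>2 = real (Suc l) * (p * (1 - p))"
      using 3 by (simp add: d_def)
    have kd: "real k * d = sqrt (real (k * Suc l) * (p * (1 - p)))"
    proof (rule real_sqrt_unique[symmetric])
      have "(real k * d)\<^sup>2 = real k * (real k * d\<^sup>2)" by (simp add: power2_eq_square)
      then show "(real k * d)\<^sup>2 = real (k * Suc l) * (p * (1 - p))" unfolding sq by (simp add: algebra_simps)
    qed (use d in simp)
    show ?thesis
    \<comment> \<open>If the optimal \<open>u = p + d\<close> exceeds 1 it is not a probability, but
      then the trivial bound \<open>k\<close> already lies below the target.\<close>
    proof (cases "p + d \<le> 1")
      case True
      have "?E \<le> ennreal (real k * (p + d) + real (Suc l) * (p * (1 - (p + d)) / (p + d - p)))"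
        using 3 d True by (intro coin_rows_bound_stationary) auto
      also have "\<dots> \<le> ennreal ?B"
      proof (rule ennreal_leI)
        have "real (Suc l) * (p * (1 - (p + d)) / (p + d - p)) \<le> real (Suc l) * (p * (1 - p) / d)"
          using 3 d by (intro mult_left_mono) (auto intro!: divide_right_mono)
        also have "\<dots> = real k * d\<^sup>2 / d" unfolding sq by simp
        also have "\<dots> = real k * d" using d by (simp add: power2_eq_square)
        finally show "real k * (p + d) + real (Suc l) * (p * (1 - (p + d)) / (p + d - p)) \<le> ?B"
          unfolding kd[symmetric] by (simp add: algebra_simps)
      qed
      finally show ?thesis .
    next
      case False
      then have "real k \<le> real k * (p + d)" by (simp add: mult_le_cancel_left1)
      also have "\<dots> \<le> ?B" unfolding kd[symmetric] using d by (simp add: algebra_simps)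
      finally show ?thesis by (intro order_trans[OF triv] ennreal_leI)
    qed
  qed
qed

section \<open>Coin bounds for paths in both directions\<close>

lemma coin_rows_conv:
  "coin_rows p k (Suc l) = map_pmf (\<lambda>\<omega> j i. \<omega> (i, j)) (coin_field ({..<k} \<times> {..l}) p)"
proof (rule pmf_eqI)
  fix w :: "nat \<Rightarrow> nat \<Rightarrow> bool"
  let ?c = "\<lambda>\<omega> j i. \<omega> (i, j) :: bool"
  have inj: "inj ?c" by (auto simp: inj_def fun_eq_iff)
  have "pmf (map_pmf ?c (coin_field ({..<k} \<times> {..l}) p)) w =
      pmf (coin_field ({..<k} \<times> {..l}) p) (\<lambda>(i, j). w j i)"
    using pmf_map_inj'[OF inj, of "coin_field ({..<k} \<times> {..l}) p" "\<lambda>(i, j). w j i"]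
    by simp
  also have "\<dots> = pmf (coin_rows p k (Suc l)) w"
  proof (cases "\<forall>i j. \<not> (i < k \<and> j \<le> l) \<longrightarrow> \<not> w j i")
    case True
    have "(\<Prod>x\<in>{..<k} \<times> {..l}. pmf (bernoulli_pmf p) (case x of (i, j) \<Rightarrow> w j i)) =
       (\<Prod>j\<le>l. \<Prod>i<k. pmf (bernoulli_pmf p) (w j i))"
      by (subst prod.swap) (simp add: prod.cartesian_product case_prod_unfold)
    then show ?thesis using True by (auto simp: pmf_Pi lessThan_Suc_atMost fun_eq_iff)
  next
    case False
    then obtain i j where ij: "\<not> (i < k \<and> j \<le> l)" "w j i" by blast
    have "pmf (coin_rows p k (Suc l)) w = 0"
    proof (cases "j \<le> l")
      case True
      then have "pmf (coins p k) (w j) = 0" using ij by (auto simp: pmf_Pi)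
      then have "(\<Prod>x\<in>{..<Suc l}. pmf (coins p k) (w x)) = 0"
        using True by (intro prod_zero bexI[of _ j]) simp_all
      then show ?thesis by (subst pmf_Pi) simp_all
    next
      case False
      then have "w j \<noteq> (\<lambda>_. False)" using ij by (auto simp: fun_eq_iff)
      then show ?thesis using False by (subst pmf_Pi) (auto simp: lessThan_Suc_atMost)
    qed
    moreover have "pmf (coin_field ({..<k} \<times> {..l}) p) (\<lambda>(i, j). w j i) = 0"
      using ij by (subst pmf_Pi) auto
    ultimately show ?thesis by simp
  qed
  finally show "pmf (coin_rows p k (Suc l)) w =
    pmf (map_pmf ?c (coin_field ({..<k} \<times> {..l}) p)) w" by simp
qed

text \<open>All that the later sections take from the queueing argument, stated for any family of
  sets so that horizontal and vertical paths can share what follows. In both cases \<open>K\<close>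
  is the product of the side lengths of the rectangle.\<close>

definition coin_bound :: "'a set \<Rightarrow> 'a set set \<Rightarrow> nat \<Rightarrow> real \<Rightarrow> bool" where
  "coin_bound J P k K \<longleftrightarrow> (\<forall>p\<in>{0..1}.
     (\<integral>\<^sup>+\<omega>. ennreal (max_weight P (\<lambda>z. of_bool (\<omega> z))) \<partial>coin_field J p)
       \<le> ennreal (real k * p + 2 * sqrt (K * (p * (1 - p)))))"

lemma coin_bound_hpaths: "coin_bound ({..<k} \<times> {..l}) (hpaths k l) k (real (k * Suc l))"
  unfolding coin_bound_def
proof
  fix p :: real assume "p \<in> {0..1}"
  then show "(\<integral>\<^sup>+\<omega>. ennreal (max_weight (hpaths k l) (\<lambda>z. of_bool (\<omega> z))) \<partial>coin_field ({..<k} \<times> {..l}) p)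
     \<le> ennreal (real k * p + 2 * sqrt (real (k * Suc l) * (p * (1 - p))))"
    using coin_rows_bound[where p=p and k=k and l=l] unfolding coin_rows_conv nn_integral_map_pmf by simp
qed

definition vpaths :: "nat \<Rightarrow> nat \<Rightarrow> (nat \<times> nat) set set" where
  "vpaths l k = (`) prod.swap ` hpaths l k"

lemma max_weight_vpaths: "max_weight (vpaths l k) w = max_weight (hpaths l k) (w \<circ> prod.swap)"
proof -
  have "sum w (prod.swap ` \<pi>) = sum (w \<circ> prod.swap) \<pi>" for \<pi> :: "(nat \<times> nat) set"
    by (subst sum.reindex) auto
  then show ?thesis unfolding max_weight_def vpaths_def image_image by simp
qed

lemma finite_vpaths: "finite (vpaths l k)" and vpaths_nonempty: "vpaths l k \<noteq> {}"
  by (auto simp: vpaths_def finite_hpaths hpaths_nonempty)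

lemma vpaths_subset: "\<pi> \<in> vpaths l k \<Longrightarrow> \<pi> \<subseteq> {..k} \<times> {..<l}"
  using hpaths_subset by (fastforce simp: vpaths_def)

lemma card_vpath: "\<pi> \<in> vpaths l k \<Longrightarrow> card \<pi> = l"
  by (auto simp: vpaths_def card_image card_hpath)

text \<open>Reflection maps vertical paths to horizontal ones and preserves the law of an i.i.d.
  field.\<close>

lemma coin_bound_vpaths: "coin_bound ({..k} \<times> {..<l}) (vpaths l k) l (real (l * Suc k))"
  unfolding coin_bound_def
proof
  fix p :: real assume p: "p \<in> {0..1}"
  have eq: "coin_field ({..<l} \<times> {..k}) p = map_pmf (\<lambda>g. g \<circ> prod.swap) (coin_field ({..k} \<times> {..<l}) p)"
    by (rule Pi_pmf_bij_betw) (auto simp: bij_betw_def)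
  from bspec[OF coin_bound_hpaths[of l k, unfolded coin_bound_def] p]
  show "(\<integral>\<^sup>+\<omega>. ennreal (max_weight (vpaths l k) (\<lambda>z. of_bool (\<omega> z))) \<partial>coin_field ({..k} \<times> {..<l}) p)
     \<le> ennreal (real l * p + 2 * sqrt (real (l * Suc k) * (p * (1 - p))))"
    unfolding eq nn_integral_map_pmf max_weight_vpaths o_def .
qed

text \<open>Which points of \<open>J\<close> exceed the level \<open>x\<close> is a finite question;
  splitting by that set avoids any measurability condition on \<open>f\<close>. Outside
  \<open>J\<close> the indicator is \<open>False\<close>, to match the default value in
  \<open>Pi_pmf\<close>.\<close>

lemma nn_integral_threshold:
  fixes Q :: "real measure" and f :: "('i \<Rightarrow> bool) \<Rightarrow> ennreal"
  assumes J: "finite J" and Q: "prob_space Q" "sets Q = sets borel"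
  shows "(\<integral>\<^sup>+w. f (\<lambda>z. z \<in> J \<and> x < w z) \<partial>PiM J (\<lambda>_. Q)) =
    (\<integral>\<^sup>+\<omega>. f \<omega> \<partial>Pi_pmf J False (\<lambda>_. bernoulli_pmf (measure Q {x<..})))"
proof -
  interpret Q: prob_space Q by fact
  interpret product_prob_space "\<lambda>_. Q" J ..
  have spQ: "space Q = UNIV" using sets_eq_imp_space_eq[OF Q(2)] by simp
  define p where "p = measure Q {x<..}"
  let ?C = "coin_field J p" and ?Q = "PiM J (\<lambda>_. Q)" and ?S = "(\<lambda>B z. z \<in> B) ` Pow J"
  have p: "0 \<le> p" "p \<le> 1" by (auto simp: p_def)
  \<comment> \<open>The event that the points of \<open>J\<close> above the level \<open>x\<close>
    are exactly those of \<open>B\<close>.\<close>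
  define E where "E B = Pi\<^sub>E J (\<lambda>z. if z \<in> B then {x<..} else {..x})" for B
  have E_sets: "E B \<in> sets (?Q)" for B
    unfolding E_def using J by (intro sets_PiM_I_finite) (auto simp: Q)
  have em1: "measure Q {..x} = 1 - p"
  proof -
    have "{..x} = space Q - {x<..}" by (auto simp: spQ)
    then show ?thesis using Q.prob_compl[of "{x<..}"] by (simp add: Q p_def)
  qed
  have em: "emeasure (?Q) (E B) = ennreal (\<Prod>z\<in>J. if z \<in> B then p else 1 - p)" for B
  proof -
    have "emeasure (?Q) (E B) = (\<Prod>z\<in>J. emeasure Q (if z \<in> B then {x<..} else {..x}))"
      unfolding E_def using J by (intro emeasure_PiM) (auto simp: Q)
    also have "\<dots> = (\<Prod>z\<in>J. ennreal (if z \<in> B then p else 1 - p))"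
      by (intro prod.cong refl) (simp add: Q.emeasure_eq_measure em1, simp add: p_def)
    finally show ?thesis using p by (simp add: prod_ennreal)
  qed
  have "(\<integral>\<^sup>+w. f (\<lambda>z. z \<in> J \<and> x < w z) \<partial>?Q) =
     (\<integral>\<^sup>+w. (\<Sum>B\<in>Pow J. f (\<lambda>z. z \<in> B) * indicator (E B) w) \<partial>?Q)"
  proof (rule nn_integral_cong)
    fix w assume "w \<in> space (?Q)"
    then have w: "w \<in> extensional J" by (simp add: space_PiM PiE_def)
    have iff: "w \<in> E B \<longleftrightarrow> B = {z\<in>J. x < w z}" if "B \<subseteq> J" for B
      using w that by (auto simp: E_def PiE_def Pi_def not_le not_less split: if_splits)
    have "(\<Sum>B\<in>Pow J. f (\<lambda>z. z \<in> B) * indicator (E B) w) =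
       (\<Sum>B\<in>{{z\<in>J. x < w z}}. f (\<lambda>z. z \<in> B) * indicator (E B) w)"
      using J by (intro sum.mono_neutral_right) (auto simp: iff indicator_def)
    also have "\<dots> = f (\<lambda>z. z \<in> J \<and> x < w z)"
      using iff[of "{z\<in>J. x < w z}"] by simp
    finally show "f (\<lambda>z. z \<in> J \<and> x < w z) = (\<Sum>B\<in>Pow J. f (\<lambda>z. z \<in> B) * indicator (E B) w)" ..
  qed
  also have "\<dots> = (\<Sum>B\<in>Pow J. f (\<lambda>z. z \<in> B) * emeasure (?Q) (E B))"
    using E_sets by (subst nn_integral_sum) (auto simp: nn_integral_cmult_indicator)
  also have "\<dots> = (\<Sum>B\<in>Pow J. f (\<lambda>z. z \<in> B) * ennreal (pmf ?C (\<lambda>z. z \<in> B)))"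
    using J p by (intro sum.cong refl) (auto simp: em pmf_Pi intro!: arg_cong2[where f="(*)"] arg_cong[where f=ennreal] prod.cong)
  also have "\<dots> = (\<Sum>\<omega>\<in>?S. f \<omega> * ennreal (pmf ?C \<omega>))"
    by (subst sum.reindex) (auto simp: inj_on_def fun_eq_iff)
  also have "\<dots> = (\<integral>\<^sup>+\<omega>. f \<omega> * indicator ?S \<omega> \<partial>?C)"
    using J by (subst nn_integral_measure_pmf_support[where A="?S"]) (auto intro!: sum.cong)
  also have "\<dots> = (\<integral>\<^sup>+\<omega>. f \<omega> \<partial>?C)"
  proof (rule nn_integral_cong_AE, unfold AE_measure_pmf_iff, rule)
    fix \<omega> assume "\<omega> \<in> set_pmf ?C"
    then have "\<omega> = (\<lambda>z. z \<in> {z\<in>J. \<omega> z})" using set_Pi_pmf_subset[OF J] by (fastforce simp: fun_eq_iff)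
    then have "\<omega> \<in> ?S" by blast
    then show "f \<omega> * indicator ?S \<omega> = f \<omega>" by simp
  qed
  finally show ?thesis unfolding p_def .
qed

lemma threshold_bound:
  fixes Q :: "real measure"
  assumes J: "finite J" and Q: "prob_space Q" "sets Q = sets borel"
    and P: "coin_bound J P k K" "\<And>\<pi>. \<pi> \<in> P \<Longrightarrow> \<pi> \<subseteq> J"
  shows "(\<integral>\<^sup>+w. ennreal (max_weight P (\<lambda>z. of_bool (x < w z))) \<partial>PiM J (\<lambda>_. Q)) \<le>
    ennreal (real k * measure Q {x<..} + 2 * sqrt (K * (measure Q {x<..} * (1 - measure Q {x<..}))))"
proof -
  interpret Q: prob_space Q by fact
  have "(\<integral>\<^sup>+w. ennreal (max_weight P (\<lambda>z. of_bool (x < w z))) \<partial>PiM J (\<lambda>_. Q)) =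
     (\<integral>\<^sup>+w. (\<lambda>\<omega>. ennreal (max_weight P (\<lambda>z. of_bool (\<omega> z)))) (\<lambda>z. z \<in> J \<and> x < w z) \<partial>PiM J (\<lambda>_. Q))"
  proof (rule nn_integral_cong)
    fix w
    have "max_weight P (\<lambda>z. of_bool (x < w z)) = max_weight P (\<lambda>z. of_bool (z \<in> J \<and> x < w z))"
      using P(2) by (intro max_weight_cong) auto
    then show "ennreal (max_weight P (\<lambda>z. of_bool (x < w z))) =
      (\<lambda>\<omega>. ennreal (max_weight P (\<lambda>z. of_bool (\<omega> z)))) (\<lambda>z. z \<in> J \<and> x < w z)" by simp
  qed
  then show ?thesis
    using nn_integral_threshold[OF J Q, of "\<lambda>\<omega>. ennreal (max_weight P (\<lambda>z. of_bool (\<omega> z)))" x] P(1)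
    by (simp add: coin_bound_def)
qed

section \<open>Clipped weights\<close>

text \<open>Equal cardinality of the paths is what makes centring free: a constant added to all
  weights shifts every path sum, hence the maximum, by the same amount.\<close>

locale path_family =
  fixes J :: "'i set" and P :: "'i set set" and k :: nat
  assumes finite_J: "finite J" and finite_P: "finite P" and P_nonempty: "P \<noteq> {}"
    and P_subset: "\<And>\<pi>. \<pi> \<in> P \<Longrightarrow> \<pi> \<subseteq> J" and P_card: "\<And>\<pi>. \<pi> \<in> P \<Longrightarrow> card \<pi> = k"
begin

lemma max_weight_attained: obtains \<pi> where "\<pi> \<in> P" "max_weight P w = sum w \<pi>"
proof -
  have "max_weight P w \<in> sum w ` P"
    unfolding max_weight_def using finite_P P_nonempty by (intro Max_in) auto
  then show ?thesis using that by auto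
qed

lemma max_weight_add: "max_weight P (\<lambda>z. f z + g z) \<le> max_weight P f + max_weight P g"
  by (rule max_weight_le[OF finite_P P_nonempty])
    (simp add: sum.distrib add_mono max_weight_ge[OF finite_P])

lemma max_weight_mono:
  assumes "\<And>z. z \<in> J \<Longrightarrow> f z \<le> g z"
  shows "max_weight P f \<le> max_weight P g"
proof (rule max_weight_le[OF finite_P P_nonempty])
  fix \<pi> assume \<pi>: "\<pi> \<in> P"
  then have "sum f \<pi> \<le> sum g \<pi>" using P_subset assms by (intro sum_mono) auto
  then show "sum f \<pi> \<le> max_weight P g" using max_weight_ge[OF finite_P \<pi>, of g] by linarith
qed

lemma max_weight_const: "max_weight P (\<lambda>z. c) = real k * c"
proof -
  obtain \<pi> where "\<pi> \<in> P" "max_weight P (\<lambda>z. c) = sum (\<lambda>z. c) \<pi>" by (rule max_weight_attained)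
  then show ?thesis by (simp add: P_card)
qed

lemma max_weight_add_const: "max_weight P (\<lambda>z. f z + c) = max_weight P f + real k * c"
proof (rule antisym)
  show "max_weight P (\<lambda>z. f z + c) \<le> max_weight P f + real k * c"
    using max_weight_add[of f "\<lambda>_. c"] by (simp add: max_weight_const)
  show "max_weight P f + real k * c \<le> max_weight P (\<lambda>z. f z + c)"
    using max_weight_add[of "\<lambda>z. f z + c" "\<lambda>_. - c"] by (simp add: max_weight_const)
qed

lemma max_weight_sum:
  assumes "finite V"
  shows "max_weight P (\<lambda>z. \<Sum>Q\<in>V. f Q z) \<le> (\<Sum>Q\<in>V. max_weight P (f Q))"
  using assms
proof (induction V rule: finite_induct)
  case empty
  then show ?case using max_weight_const[of 0] by simp
next
  case (insert Q V)
  have "max_weight P (\<lambda>z. \<Sum>Q\<in>insert Q V. f Q z) = max_weight P (\<lambda>z. f Q z + (\<Sum>Q\<in>V. f Q z))"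
    using insert by simp
  also have "\<dots> \<le> max_weight P (f Q) + max_weight P (\<lambda>z. \<Sum>Q\<in>V. f Q z)" by (rule max_weight_add)
  finally show ?case using insert by simp
qed

lemma max_weight_cmult: "0 \<le> c \<Longrightarrow> max_weight P (\<lambda>z. c * f z) = c * max_weight P f"
proof (rule antisym)
  assume c: "0 \<le> c"
  show "max_weight P (\<lambda>z. c * f z) \<le> c * max_weight P f"
    by (rule max_weight_le[OF finite_P P_nonempty])
      (simp add: sum_distrib_left[symmetric] c mult_left_mono max_weight_ge[OF finite_P])
  obtain \<pi> where \<pi>: "\<pi> \<in> P" "max_weight P f = sum f \<pi>" by (rule max_weight_attained)
  show "c * max_weight P f \<le> max_weight P (\<lambda>z. c * f z)"
    using max_weight_ge[OF finite_P \<pi>(1), of "\<lambda>z. c * f z"] \<pi>(2) by (simp add: sum_distrib_left)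
qed

lemma abs_max_weight_le: "\<bar>max_weight P f\<bar> \<le> (\<Sum>z\<in>J. \<bar>f z\<bar>)"
proof -
  obtain \<pi> where \<pi>: "\<pi> \<in> P" "max_weight P f = sum f \<pi>" by (rule max_weight_attained)
  have "\<bar>sum f \<pi>\<bar> \<le> (\<Sum>z\<in>\<pi>. \<bar>f z\<bar>)" by (rule sum_abs)
  also have "\<dots> \<le> (\<Sum>z\<in>J. \<bar>f z\<bar>)" using P_subset[OF \<pi>(1)] finite_J by (intro sum_mono2) auto
  finally show ?thesis using \<pi> by simp
qed

lemma borel_measurable_max_weight:
  assumes "\<And>z. z \<in> J \<Longrightarrow> (\<lambda>x. f x z) \<in> borel_measurable N"
  shows "(\<lambda>x. max_weight P (f x)) \<in> borel_measurable N"
  unfolding max_weight_def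
  using P_subset assms by (intro borel_measurable_Max finite_P borel_measurable_sum) auto

lemma integrable_max_weight:
  assumes "\<And>z. z \<in> J \<Longrightarrow> integrable N (\<lambda>x. f x z)"
  shows "integrable N (\<lambda>x. max_weight P (f x))"
proof (rule Bochner_Integration.integrable_bound)
  show "integrable N (\<lambda>x. \<Sum>z\<in>J. \<bar>f x z\<bar>)" using assms by auto
  show "(\<lambda>x. max_weight P (f x)) \<in> borel_measurable N"
    using assms by (intro borel_measurable_max_weight) auto
  show "AE x in N. norm (max_weight P (f x)) \<le> norm (\<Sum>z\<in>J. \<bar>f x z\<bar>)"
    using abs_max_weight_le by (intro AE_I2) (simp add: sum_nonneg)
qed

end

section \<open>Integrals over coordinates of a product measure\<close>

lemma
  fixes f :: "'a \<Rightarrow> real"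
  assumes "\<And>i. prob_space (M i)" "i \<in> J" "integrable (M i) f"
  shows integrable_PiM_component: "integrable (PiM J M) (\<lambda>w. f (w i))"
    and integral_PiM_component: "(\<integral>w. f (w i) \<partial>PiM J M) = (\<integral>t. f t \<partial>M i)"
proof -
  have d: "distr (PiM J M) (M i) (\<lambda>w. w i) = M i" using assms by (intro distr_PiM_component) auto
  have m: "(\<lambda>w. w i) \<in> PiM J M \<rightarrow>\<^sub>M M i" using assms by (intro measurable_component_singleton)
  show "integrable (PiM J M) (\<lambda>w. f (w i))"
    by (rule integrable_distr[OF m]) (simp add: d assms)
  show "(\<integral>w. f (w i) \<partial>PiM J M) = (\<integral>t. f t \<partial>M i)"
    using integral_distr[OF m, of f] assms(3) by (simp add: d)
qed

context product_sigma_finite begin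

lemma integrable_merge:
  fixes f :: "_ \<Rightarrow> real"
  assumes IJ: "I \<inter> J = {}" and fin: "finite I" "finite J" and f: "integrable (PiM (I \<union> J) M) f"
  shows "integrable (PiM I M) (\<lambda>x. \<integral>y. f (merge I J (x, y)) \<partial>PiM J M)"
proof -
  interpret I: finite_product_sigma_finite M I by standard fact
  interpret J: finite_product_sigma_finite M J by standard fact
  interpret P: pair_sigma_finite "PiM I M" "PiM J M" ..
  have "integrable (PiM I M \<Otimes>\<^sub>M PiM J M) (\<lambda>x. f (merge I J x))"
    by (rule integrable_distr[OF measurable_merge]) (simp add: distr_merge[OF IJ fin] f)
  from P.integrable_fst'[OF this] show ?thesis .
qed

end

context path_family begin

text \<open>Jensen: averaging over the centred coordinates outside \<open>I\<close> can only decrease the maximum.\<close>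

lemma max_weight_restrict_le:
  fixes h :: "'i \<Rightarrow> 'a \<Rightarrow> real"
  assumes M: "\<And>i. prob_space (M i)" and I: "I \<subseteq> J"
    and h: "\<And>z. z \<in> J \<Longrightarrow> integrable (M z) (h z)" "\<And>z. z \<in> J - I \<Longrightarrow> (\<integral>t. h z t \<partial>M z) = 0"
  shows "(\<integral>w. max_weight P (\<lambda>z. if z \<in> I then h z (w z) else 0) \<partial>PiM I M) \<le>
    (\<integral>w. max_weight P (\<lambda>z. h z (w z)) \<partial>PiM J M)"
proof -
  let ?G = "\<lambda>x y z. if z \<in> I then h z (x z) else h z (y z)"
  interpret product_prob_space M J using M by (simp add: product_prob_spaceI)
  define K where "K = J - I"
  interpret K: product_prob_space M K using M by (simp add: product_prob_spaceI)
  have IK: "I \<inter> K = {}" "finite I" "finite K" "I \<union> K = J" "K \<subseteq> J"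
    using I finite_J by (auto simp: K_def intro: finite_subset)
  let ?F = "\<lambda>w. max_weight P (\<lambda>z. h z (w z))"
  let ?F' = "\<lambda>x. \<integral>y. ?F (merge I K (x, y)) \<partial>PiM K M"
  have intF: "integrable (PiM J M) ?F"
    by (intro integrable_max_weight integrable_PiM_component M h)
  have comp: "h z (merge I K (x, y) z) = (?G x y z)" if "z \<in> J" for z x y
    using IK that by auto
  have "(\<integral>w. max_weight P (\<lambda>z. if z \<in> I then h z (w z) else 0) \<partial>PiM I M) \<le>
     (\<integral>x. ?F' x \<partial>PiM I M)"
  proof (rule integral_mono)
    show "integrable (PiM I M) (\<lambda>w. max_weight P (\<lambda>z. if z \<in> I then h z (w z) else 0))"
    proof (rule integrable_max_weight)
      fix z assume "z \<in> J"
      then show "integrable (PiM I M) (\<lambda>w. if z \<in> I then h z (w z) else 0)"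
        using integrable_PiM_component[of M z I "h z", OF M _ h(1)] by (cases "z \<in> I") auto
    qed
    show "integrable (PiM I M) (\<lambda>x. ?F' x)"
      using intF IK by (intro integrable_merge) auto
    fix x
    have int1: "integrable (PiM K M) (\<lambda>y. ?G x y z)" if "z \<in> J" for z
      using integrable_PiM_component[of M z K "h z", OF M _ h(1)] that K.P.integrable_const by (cases "z \<in> I") (simp, simp add: K_def)
    have eq: "?F (merge I K (x, y)) = max_weight P (\<lambda>z. ?G x y z)" for y
    proof (rule max_weight_cong)
      fix \<pi> z assume "\<pi> \<in> P" "z \<in> \<pi>"
      then have "z \<in> J" using P_subset by blast
      then show "h z (merge I K (x, y) z) = (?G x y z)" by (rule comp)
    qed
    have int2: "integrable (PiM K M) (\<lambda>y. ?F (merge I K (x, y)))"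
      unfolding eq by (intro integrable_max_weight int1)
    show "max_weight P (\<lambda>z. if z \<in> I then h z (x z) else 0) \<le> ?F' x"
    proof (rule max_weight_le[OF finite_P P_nonempty])
      fix \<pi> assume \<pi>: "\<pi> \<in> P"
      have "(\<Sum>z\<in>\<pi>. if z \<in> I then h z (x z) else 0) =
        (\<Sum>z\<in>\<pi>. \<integral>y. (?G x y z) \<partial>PiM K M)"
      proof (intro sum.cong refl)
        fix z assume "z \<in> \<pi>"
        then have "z \<in> J" using P_subset[OF \<pi>] by auto
        then show "(if z \<in> I then h z (x z) else 0) = (\<integral>y. (?G x y z) \<partial>PiM K M)"
          using integral_PiM_component[of M z K "h z", OF M] h K.P.prob_space
          by (cases "z \<in> I") (simp_all add: K_def)
      qed
      also have "\<dots> = (\<integral>y. (\<Sum>z\<in>\<pi>. ?G x y z) \<partial>PiM K M)"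
        using P_subset[OF \<pi>] int1 by (subst Bochner_Integration.integral_sum) auto
      also have "\<dots> \<le> ?F' x"
        unfolding eq using int1 P_subset[OF \<pi>]
        by (intro integral_mono integrable_max_weight int1 Bochner_Integration.integrable_sum
            max_weight_ge[OF finite_P \<pi>]) auto
      finally show "(\<Sum>z\<in>\<pi>. if z \<in> I then h z (x z) else 0) \<le> ?F' x" .
    qed
  qed
  also have "\<dots> = (\<integral>w. ?F w \<partial>PiM (I \<union> K) M)"
    using IK intF by (intro product_integral_fold[symmetric]) auto
  finally show ?thesis by (simp add: IK)
qed

end

section \<open>Clipping and the layers of a weight\<close>

definition clip :: "real \<Rightarrow> real \<Rightarrow> real \<Rightarrow> real" where
  "clip a b t = min b (max a t) - a"

lemma clip_bounds: "a \<le> b \<Longrightarrow> 0 \<le> clip a b t" "a \<le> b \<Longrightarrow> clip a b t \<le> b - a"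
  by (auto simp: clip_def)

lemma clip_measurable [measurable]: "clip a b \<in> borel_measurable borel"
  unfolding clip_def[abs_def] by measurable

text \<open>Subtracting \<open>a\<close> in \<open>clip\<close> makes it vanish below
  \<open>a\<close>, and so turns it into a plain integral of level indicators over
  \<open>[a, b]\<close>.\<close>

lemma clip_layers:
  assumes "a \<le> b"
  shows "(\<integral>\<^sup>+x. indicator {a..b} x * of_bool (x < t) \<partial>lborel) = ennreal (clip a b t)"
proof -
  have "(\<integral>\<^sup>+x. indicator {a..b} x * of_bool (x < t) \<partial>lborel) = (\<integral>\<^sup>+x. indicator ({a..b} \<inter> {..<t}) x \<partial>lborel)"
    by (intro nn_integral_cong) (auto simp: indicator_def)
  also have "\<dots> = emeasure lborel ({a..b} \<inter> {..<t})" by simp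
  also have "\<dots> = ennreal (clip a b t)"
  proof -
    consider "t \<le> a" | "a < t" "t \<le> b" | "b < t" by linarith
    then show ?thesis
    proof cases
      case 1
      then have e: "{a..b} \<inter> {..<t} = {}" by auto
      show ?thesis unfolding e using 1 assms by (simp add: clip_def)
    next
      case 2
      then have e: "{a..b} \<inter> {..<t} = {a..<t}" by auto
      show ?thesis unfolding e using 2 by (simp add: clip_def)
    next
      case 3
      then have e: "{a..b} \<inter> {..<t} = {a..b}" by auto
      show ?thesis unfolding e using 3 assms by (simp add: clip_def)
    qed
  qed
  finally show ?thesis .
qed

text \<open>The standard deviations of the level indicators, integrated over the levels. By the coin
  bound this is the factor of \<open>2 sqrt K\<close> in the cost of a clipped weight.\<close>

definition spread :: "real measure \<Rightarrow> real \<Rightarrow> real \<Rightarrow> ennreal" where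
  "spread Q a b = (\<integral>\<^sup>+x. indicator {a..b} x *
     ennreal (sqrt (measure Q {x<..} * (1 - measure Q {x<..}))) \<partial>lborel)"

context real_distribution begin

lemma one_minus_cdf: "1 - cdf M x = measure M {x<..}"
  using prob_compl[of "{..x}"] by (simp add: cdf_def Compl_eq_Diff_UNIV[symmetric])

lemma cdf_measurable [measurable]: "cdf M \<in> borel_measurable borel"
  by (intro borel_measurable_mono monoI cdf_nondecreasing)

lemma tail_measurable [measurable]: "(\<lambda>x. measure M {x<..}) \<in> borel_measurable borel"
  unfolding one_minus_cdf[symmetric] by measurable

lemma integrable_clip: "a \<le> b \<Longrightarrow> integrable M (clip a b)"
  using clip_bounds[of a b] by (intro integrable_const_bound[of _ "b - a"]) auto

end

lemma (in real_distribution) clip_expectation: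
  assumes "a \<le> b"
  shows "(\<integral>\<^sup>+x. indicator {a..b} x * ennreal (measure M {x<..}) \<partial>lborel) = (\<integral>\<^sup>+t. ennreal (clip a b t) \<partial>M)"
proof -
  interpret pair_sigma_finite lborel M ..
  have [measurable]: "(\<lambda>(x, t). indicator {a..b} x * of_bool (x < t) :: ennreal) \<in> borel_measurable (lborel \<Otimes>\<^sub>M M)"
    unfolding of_bool_def by measurable
  have "(\<integral>\<^sup>+t. ennreal (clip a b t) \<partial>M) = (\<integral>\<^sup>+t. \<integral>\<^sup>+x. indicator {a..b} x * of_bool (x < t) \<partial>lborel \<partial>M)"
    by (simp add: clip_layers[OF assms])
  also have "\<dots> = (\<integral>\<^sup>+x. \<integral>\<^sup>+t. indicator {a..b} x * of_bool (x < t) \<partial>M \<partial>lborel)"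
    by (rule Fubini') measurable
  also have "\<dots> = (\<integral>\<^sup>+x. indicator {a..b} x * ennreal (measure M {x<..}) \<partial>lborel)"
  proof (intro nn_integral_cong)
    fix x
    have "(\<integral>\<^sup>+t. indicator {a..b} x * of_bool (x < t) \<partial>M) = (\<integral>\<^sup>+t. indicator {a..b} x * indicator {x<..} t \<partial>M)"
      by (intro nn_integral_cong) (auto simp: indicator_def)
    also have "\<dots> = indicator {a..b} x * emeasure M {x<..}" by (simp add: nn_integral_cmult_indicator)
    finally show "(\<integral>\<^sup>+t. indicator {a..b} x * of_bool (x < t) \<partial>M) = indicator {a..b} x * ennreal (measure M {x<..})"
      by (simp add: emeasure_eq_measure)
  qed
  finally show ?thesis ..
qed

context path_family begin

text \<open>Each level may choose its own best path, so a maximum of integrals is at most the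
  integral of the maxima. This is where layers lose the sharp constant.\<close>

lemma max_weight_clip_le_layers:
  assumes "a \<le> b"
  shows "ennreal (max_weight P (\<lambda>z. clip a b (w z))) \<le>
    (\<integral>\<^sup>+x. indicator {a..b} x * ennreal (max_weight P (\<lambda>z. of_bool (x < w z))) \<partial>lborel)"
proof -
  obtain \<pi> where \<pi>: "\<pi> \<in> P" "max_weight P (\<lambda>z. clip a b (w z)) = (\<Sum>z\<in>\<pi>. clip a b (w z))"
    by (rule max_weight_attained)
  have "ennreal (\<Sum>z\<in>\<pi>. clip a b (w z)) = (\<Sum>z\<in>\<pi>. ennreal (clip a b (w z)))"
    using assms by (subst sum_ennreal) (auto simp: clip_bounds)
  also have "\<dots> = (\<Sum>z\<in>\<pi>. \<integral>\<^sup>+x. indicator {a..b} x * of_bool (x < w z) \<partial>lborel)"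
    by (simp add: clip_layers[OF assms])
  also have "\<dots> = (\<integral>\<^sup>+x. (\<Sum>z\<in>\<pi>. indicator {a..b} x * of_bool (x < w z)) \<partial>lborel)"
    by (intro nn_integral_sum[symmetric]) (simp add: of_bool_def)
  also have "\<dots> \<le> (\<integral>\<^sup>+x. indicator {a..b} x * ennreal (max_weight P (\<lambda>z. of_bool (x < w z))) \<partial>lborel)"
  proof (intro nn_integral_mono)
    fix x
    have "(\<Sum>z\<in>\<pi>. of_bool (x < w z) :: ennreal) = (\<Sum>z\<in>\<pi>. ennreal (of_bool (x < w z)))"
      by (intro sum.cong) auto
    also have "\<dots> = ennreal (\<Sum>z\<in>\<pi>. of_bool (x < w z))" by (intro sum_ennreal) auto
    also have "\<dots> \<le> ennreal (max_weight P (\<lambda>z. of_bool (x < w z)))"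
      by (intro ennreal_leI max_weight_ge[OF finite_P \<pi>(1)])
    finally show "(\<Sum>z\<in>\<pi>. indicator {a..b} x * of_bool (x < w z)) \<le>
        indicator {a..b} x * ennreal (max_weight P (\<lambda>z. of_bool (x < w z)))"
      unfolding sum_distrib_left[symmetric] by (rule mult_left_mono) simp
  qed
  finally show ?thesis using \<pi>(2) by simp
qed

text \<open>The coin bound is integrated over the levels: the terms \<open>k p\<close> add up to
  \<open>k\<close> times the mean, the square roots to the spread.\<close>

lemma iid_clip_bound:
  assumes Q: "real_distribution Q" and cb: "coin_bound J P k K" "0 \<le> K" and ab: "a \<le> b"
    and d: "spread Q a b \<le> ennreal d" "0 \<le> d"
  shows "(\<integral>w. max_weight P (\<lambda>z. clip a b (w z)) \<partial>PiM J (\<lambda>_. Q)) \<le> real k * (\<integral>t. clip a b t \<partial>Q) + 2 * sqrt K * d"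
proof -
  let ?W = "\<lambda>x w. ennreal (max_weight P (\<lambda>z. of_bool (x < w z)))"
  let ?c = "\<lambda>w. max_weight P (\<lambda>z. clip a b (w z))"
  let ?I = "\<lambda>x. indicator {a..b} x :: ennreal"
  let ?J = "PiM J (\<lambda>_. Q)"
  let ?e = "\<integral>t. clip a b t \<partial>Q"
  interpret Q: real_distribution Q by fact
  interpret product_prob_space "\<lambda>_. Q" J ..
  interpret pair_sigma_finite lborel "?J" ..
  note int_clip = Q.integrable_clip[OF ab]
  have nonneg: "0 \<le> ?c w" for w
    using max_weight_mono[of "\<lambda>_. 0" "\<lambda>z. clip a b (w z)"] clip_bounds(1)[OF ab] by (simp add: max_weight_const)
  have int: "integrable (?J) (\<lambda>w. ?c w)"
    by (intro integrable_max_weight integrable_PiM_component int_clip Q.prob_space_axioms)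
  have [measurable]: "(\<lambda>(x, w). ?I x * ?W x w)
      \<in> borel_measurable (lborel \<Otimes>\<^sub>M ?J)"
  proof -
    have "(\<lambda>p. max_weight P (\<lambda>z. of_bool (fst p < snd p z))) \<in> borel_measurable (lborel \<Otimes>\<^sub>M ?J)"
    proof (rule borel_measurable_max_weight)
      fix z assume [measurable]: "z \<in> J"
      show "(\<lambda>p. of_bool (fst p < snd p z) :: real) \<in> borel_measurable (lborel \<Otimes>\<^sub>M ?J)"
        unfolding of_bool_def by measurable
    qed
    then show ?thesis unfolding case_prod_unfold by measurable
  qed
  let ?p = "\<lambda>x. measure Q {x<..}"
  have "ennreal (\<integral>w. ?c w \<partial>?J) =
     (\<integral>\<^sup>+w. ennreal (?c w) \<partial>?J)"
    using int nonneg by (intro nn_integral_eq_integral[symmetric]) auto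
  also have "\<dots> \<le> (\<integral>\<^sup>+w. \<integral>\<^sup>+x. ?I x * ?W x w \<partial>lborel \<partial>?J)"
    by (intro nn_integral_mono max_weight_clip_le_layers ab)
  also have "\<dots> = (\<integral>\<^sup>+x. \<integral>\<^sup>+w. ?I x * ?W x w \<partial>?J \<partial>lborel)"
    by (rule Fubini') measurable
  also have "\<dots> \<le> (\<integral>\<^sup>+x. ennreal (real k) * (?I x * ennreal (?p x)) +
      ennreal (2 * sqrt K) * (?I x * ennreal (sqrt (?p x * (1 - ?p x)))) \<partial>lborel)"
  proof (rule nn_integral_mono)
    fix x
    have m: "(\<lambda>w. max_weight P (\<lambda>z. of_bool (x < w z))) \<in> borel_measurable (?J)"
    proof (rule borel_measurable_max_weight)
      fix z assume [measurable]: "z \<in> J"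
      show "(\<lambda>w. of_bool (x < w z) :: real) \<in> borel_measurable (?J)"
        unfolding of_bool_def by measurable
    qed
    have "(\<integral>\<^sup>+w. ?I x * ?W x w \<partial>?J) =
       ?I x * (\<integral>\<^sup>+w. ?W x w \<partial>?J)"
      using m by (intro nn_integral_cmult) auto
    also have "\<dots> \<le> ?I x * ennreal (real k * ?p x + 2 * sqrt (K * (?p x * (1 - ?p x))))"
      by (intro mult_left_mono threshold_bound[OF finite_J Q.prob_space_axioms Q.events_eq_borel cb(1) P_subset]) auto
    also have "ennreal (real k * ?p x + 2 * sqrt (K * (?p x * (1 - ?p x)))) =
        ennreal (real k) * ennreal (?p x) + ennreal (2 * sqrt K) * ennreal (sqrt (?p x * (1 - ?p x)))"
      using cb(2) by (simp add: real_sqrt_mult ennreal_mult' ennreal_plus mult.assoc)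
    finally show "(\<integral>\<^sup>+w. ?I x * ?W x w \<partial>?J) \<le>
        ennreal (real k) * (?I x * ennreal (?p x)) +
      ennreal (2 * sqrt K) * (?I x * ennreal (sqrt (?p x * (1 - ?p x))))"
      by (simp add: distrib_left mult.left_commute mult.commute)
  qed
  also have "\<dots> = ennreal (real k) * (\<integral>\<^sup>+x. ?I x * ennreal (?p x) \<partial>lborel) + ennreal (2 * sqrt K) * spread Q a b"
    unfolding spread_def by (simp add: nn_integral_add nn_integral_cmult)
  also have "\<dots> = ennreal (real k) * ennreal ?e + ennreal (2 * sqrt K) * spread Q a b"
    unfolding Q.clip_expectation[OF ab] using int_clip clip_bounds(1)[OF ab] by (simp add: nn_integral_eq_integral)
  also have "\<dots> \<le> ennreal (real k) * ennreal ?e + ennreal (2 * sqrt K) * ennreal d"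
    by (intro add_left_mono mult_left_mono d) auto
  also have "\<dots> = ennreal (real k * ?e + 2 * sqrt K * d)"
    using d cb(2) clip_bounds(1)[OF ab] by (simp add: ennreal_mult ennreal_plus)
  finally show ?thesis
    using d cb(2) clip_bounds(1)[OF ab] by (subst (asm) ennreal_le_iff) auto
qed

text \<open>Sublinearity of the maximum separates the points by their law \<open>Q\<close>, and
  filling up the absent points makes each part i.i.d. The price is the factor \<open>card V\<close>,
  harmless because \<open>d\<close> will be chosen after \<open>V\<close>.\<close>

lemma centred_clip_bound:
  fixes v :: "'i \<Rightarrow> real measure"
  assumes v: "\<And>z. real_distribution (v z)" "\<And>z. z \<in> J \<Longrightarrow> v z \<in> V" and V: "finite V" "\<And>Q. Q \<in> V \<Longrightarrow> real_distribution Q"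
    and cb: "coin_bound J P k K" "0 \<le> K" and ab: "a \<le> b"
    and d: "\<And>Q. Q \<in> V \<Longrightarrow> spread Q a b \<le> ennreal d" "0 \<le> d"
  shows "(\<integral>w. max_weight P (\<lambda>z. clip a b (w z) - (\<integral>t. clip a b t \<partial>v z)) \<partial>PiM J v) \<le> real (card V) * (2 * sqrt K * d)"
proof -
  let ?J = "PiM J v"
  note int_clip = real_distribution.integrable_clip[OF _ ab]
  have ps: "prob_space (v z)" for z using v(1) by (simp add: real_distribution_def)
  let ?c = "\<lambda>Q t. clip a b t - (\<integral>t. clip a b t \<partial>Q)"
  have int_c: "integrable Q (?c Q)" if "real_distribution Q" for Q
  proof -
    interpret real_distribution Q by fact
    show ?thesis using int_clip[OF that] by auto
  qed
  let ?g = "\<lambda>Q w z. if z \<in> {z\<in>J. v z = Q} then ?c Q (w z) else 0"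
  have int_g: "integrable (?J) (\<lambda>w. ?g Q w z)" if "z \<in> J" for z Q
    using integrable_PiM_component[of v z J "?c (v z)", OF ps that int_c[OF v(1)]] that by (cases "v z = Q") auto
  have "(\<integral>w. max_weight P (\<lambda>z. ?c (v z) (w z)) \<partial>?J) = (\<integral>w. max_weight P (\<lambda>z. \<Sum>Q\<in>V. ?g Q w z) \<partial>?J)"
  proof (intro Bochner_Integration.integral_cong refl max_weight_cong)
    fix w \<pi> z assume "\<pi> \<in> P" "z \<in> \<pi>"
    then have "z \<in> J" using P_subset by auto
    then have "(\<Sum>Q\<in>V. ?g Q w z) = (\<Sum>Q\<in>V. if v z = Q then ?c Q (w z) else 0)" by (intro sum.cong) auto
    also have "\<dots> = ?c (v z) (w z)" using V(1) v(2)[OF \<open>z \<in> J\<close>] by (simp add: sum.delta')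
    finally show "?c (v z) (w z) = (\<Sum>Q\<in>V. ?g Q w z)" ..
  qed
  also have "\<dots> \<le> (\<integral>w. (\<Sum>Q\<in>V. max_weight P (?g Q w)) \<partial>?J)"
    by (intro integral_mono integrable_max_weight Bochner_Integration.integrable_sum int_g max_weight_sum V)
  also have "\<dots> = (\<Sum>Q\<in>V. \<integral>w. max_weight P (?g Q w) \<partial>?J)"
    by (intro Bochner_Integration.integral_sum integrable_max_weight int_g)
  also have "\<dots> \<le> (\<Sum>Q\<in>V. 2 * sqrt K * d)"
  proof (rule sum_mono)
    fix Q assume Q: "Q \<in> V"
    then have rQ: "real_distribution Q" using V by auto
    interpret Q: real_distribution Q by fact
    interpret product_prob_space "\<lambda>_. Q" J ..
    let ?I = "{z\<in>J. v z = Q}"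
    \<comment> \<open>Only coordinates of law \<open>Q\<close> enter, so the integral can be taken
      over their marginal, which is a power of \<open>Q\<close>.\<close>
    have "(\<integral>w. max_weight P (?g Q w) \<partial>?J) =
        (\<integral>w. max_weight P (?g Q w) \<partial>distr (?J) (PiM ?I v) (\<lambda>w. restrict w ?I))"
    proof (subst integral_distr)
      show "(\<lambda>w. restrict w ?I) \<in> ?J \<rightarrow>\<^sub>M PiM ?I v" by (intro measurable_restrict_subset) auto
      show "(\<lambda>w. max_weight P (?g Q w)) \<in> borel_measurable (PiM ?I v)"
      proof (rule borel_measurable_max_weight)
        fix z
        show "(\<lambda>w. ?g Q w z) \<in> borel_measurable (PiM ?I v)"
          using integrable_PiM_component[of v z ?I "?c (v z)", OF ps _ int_c[OF v(1)]] by (cases "z \<in> ?I") (auto dest!: borel_measurable_integrable)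
      qed
      show "(\<integral>w. max_weight P (?g Q w) \<partial>?J) = (\<integral>w. max_weight P (?g Q (restrict w ?I)) \<partial>?J)"
        by (intro Bochner_Integration.integral_cong refl max_weight_cong) auto
    qed
    also have "distr (?J) (PiM ?I v) (\<lambda>w. restrict w ?I) = PiM ?I v"
    proof -
      interpret v: product_prob_space v J using ps by (simp add: product_prob_spaceI)
      show ?thesis using finite_J by (intro v.distr_PiM_restrict_finite) auto
    qed
    also have "PiM ?I v = PiM ?I (\<lambda>_. Q)" by (intro PiM_cong) auto
    also have "(\<integral>w. max_weight P (?g Q w) \<partial>PiM ?I (\<lambda>_. Q)) \<le> (\<integral>w. max_weight P (\<lambda>z. ?c Q (w z)) \<partial>PiM J (\<lambda>_. Q))"
      using Q.prob_space_axioms int_c[OF rQ] int_clip[OF rQ] Q.prob_space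
      by (intro max_weight_restrict_le[where h="\<lambda>_. ?c Q"]) auto
    also have "\<dots> = (\<integral>w. max_weight P (\<lambda>z. clip a b (w z)) - real k * (\<integral>t. clip a b t \<partial>Q) \<partial>PiM J (\<lambda>_. Q))"
      using max_weight_add_const[where c="- (\<integral>t. clip a b t \<partial>Q)"] by simp
    also have "\<dots> = (\<integral>w. max_weight P (\<lambda>z. clip a b (w z)) \<partial>PiM J (\<lambda>_. Q)) - real k * (\<integral>t. clip a b t \<partial>Q)"
      using P.prob_space
      by (subst Bochner_Integration.integral_diff)
        (auto intro!: integrable_max_weight integrable_PiM_component Q.prob_space_axioms int_clip[OF rQ])
    also have "\<dots> \<le> 2 * sqrt K * d"
      using iid_clip_bound[OF rQ cb ab d(1)[OF Q] d(2)] by simp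
    finally show "(\<integral>w. max_weight P (?g Q w) \<partial>?J) \<le> 2 * sqrt K * d" .
  qed
  finally show ?thesis by simp
qed

end

section \<open>Lindeberg replacement\<close>

lemma abs_exp_minus_quadratic_le:
  fixes x :: real assumes "\<bar>x\<bar> \<le> 1"
  shows "\<bar>exp x - (1 + x + x\<^sup>2 / 2)\<bar> \<le> \<bar>x\<bar> ^ 3"
proof -
  obtain t where t: "\<bar>t\<bar> \<le> \<bar>x\<bar>" "exp x = (\<Sum>m<3. x ^ m / fact m) + exp t / fact 3 * x ^ 3"
    using Maclaurin_exp_le[of x 3] by blast
  have "exp x - (1 + x + x\<^sup>2 / 2) = exp t / 6 * x ^ 3"
    unfolding t(2) by (simp add: eval_nat_numeral)
  then have "\<bar>exp x - (1 + x + x\<^sup>2 / 2)\<bar> = exp t / 6 * \<bar>x\<bar> ^ 3"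
    by (simp only: abs_mult power_abs) simp
  moreover have "exp t / 6 \<le> 1"
  proof -
    have "exp t \<le> exp 1" using t(1) assms by simp
    then show ?thesis using exp_le by linarith
  qed
  then have "exp t / 6 * \<bar>x\<bar> ^ 3 \<le> \<bar>x\<bar> ^ 3"
    using mult_right_mono[of "exp t / 6" 1 "\<bar>x\<bar> ^ 3"] by simp
  ultimately show ?thesis by linarith
qed

lemma abs_ln_one_plus_minus_quadratic_le:
  fixes y :: real assumes "\<bar>y\<bar> \<le> 1 / 2"
  shows "\<bar>ln (1 + y) - (y - y\<^sup>2 / 2)\<bar> \<le> 2 * \<bar>y\<bar> ^ 3"
proof -
  let ?f = "\<lambda>y::real. ln (1 + y) - (y - y\<^sup>2 / 2)"
  have der: "(?f has_real_derivative t\<^sup>2 / (1 + t)) (at t within {- \<bar>y\<bar>..\<bar>y\<bar>})"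
    if "t \<in> {- \<bar>y\<bar>..\<bar>y\<bar>}" for t
  proof -
    have t: "1 + t > 0" using that assms by auto
    have "(?f has_real_derivative (1 / (1 + t) - (1 - t))) (at t within {- \<bar>y\<bar>..\<bar>y\<bar>})"
      using t by (auto intro!: derivative_eq_intros)
    also have "1 / (1 + t) - (1 - t) = t\<^sup>2 / (1 + t)"
      using t by (simp add: field_simps power2_eq_square)
    finally show ?thesis .
  qed
  have bound: "norm (t\<^sup>2 / (1 + t)) \<le> 2 * y\<^sup>2" if "t \<in> {- \<bar>y\<bar>..\<bar>y\<bar>}" for t
  proof -
    have t: "1 / 2 \<le> 1 + t" "t\<^sup>2 \<le> y\<^sup>2" using that assms abs_le_square_iff[of t y] by auto
    have "t\<^sup>2 / (1 + t) \<le> t\<^sup>2 / (1 / 2)" using t by (intro divide_left_mono) auto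
    then show ?thesis using t by simp
  qed
  have "norm (?f y - ?f 0) \<le> (2 * y\<^sup>2) * norm (y - 0)"
    by (rule field_differentiable_bound[OF _ der bound]) auto
  also have "(2 * y\<^sup>2) * norm (y - 0) = 2 * \<bar>y\<bar> ^ 3"
    by (simp add: power3_eq_cube power2_eq_square abs_mult[symmetric] mult.assoc)
  finally show ?thesis by simp
qed

text \<open>The cumulant expansion up to the variance. Because the \<open>c j\<close> are
  probability weights, every error is controlled by the bound on the \<open>x j\<close> and not by
  the number of terms.\<close>

lemma ln_sum_exp_expansion:
  fixes c x :: "'a \<Rightarrow> real"
  assumes K: "finite K" and c: "\<And>j. j \<in> K \<Longrightarrow> 0 \<le> c j" "sum c K = 1"
    and x: "\<And>j. j \<in> K \<Longrightarrow> \<bar>x j\<bar> \<le> \<rho>" and \<rho>: "0 \<le> \<rho>" "\<rho> \<le> 1 / 4"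
  shows "\<bar>ln (\<Sum>j\<in>K. c j * exp (x j)) -
     ((\<Sum>j\<in>K. c j * x j) + ((\<Sum>j\<in>K. c j * (x j)\<^sup>2) - (\<Sum>j\<in>K. c j * x j)\<^sup>2) / 2)\<bar> \<le> 10 * \<rho> ^ 3"
proof -
  define m where "m = (\<Sum>j\<in>K. c j * x j)"
  define q where "q = (\<Sum>j\<in>K. c j * (x j)\<^sup>2)"
  define r where "r = (\<Sum>j\<in>K. c j * (exp (x j) - (1 + x j + (x j)\<^sup>2 / 2)))"
  have avg: "\<bar>\<Sum>j\<in>K. c j * g j\<bar> \<le> b" if "\<And>j. j \<in> K \<Longrightarrow> \<bar>g j\<bar> \<le> b" for g b
  proof -
    have "\<bar>\<Sum>j\<in>K. c j * g j\<bar> \<le> (\<Sum>j\<in>K. c j * b)"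
      using c that by (intro order_trans[OF sum_abs] sum_mono) (auto simp: abs_mult intro!: mult_left_mono)
    then show ?thesis using c by (simp add: sum_distrib_right[symmetric])
  qed
  have r: "\<bar>r\<bar> \<le> \<rho> ^ 3"
    unfolding r_def
  proof (rule avg)
    fix j assume j: "j \<in> K"
    have "\<bar>exp (x j) - (1 + x j + (x j)\<^sup>2 / 2)\<bar> \<le> \<bar>x j\<bar> ^ 3"
      using x[OF j] \<rho> by (intro abs_exp_minus_quadratic_le) auto
    also have "\<dots> \<le> \<rho> ^ 3" using x[OF j] by (intro power_mono) auto
    finally show "\<bar>exp (x j) - (1 + x j + (x j)\<^sup>2 / 2)\<bar> \<le> \<rho> ^ 3" .
  qed
  have m: "\<bar>m\<bar> \<le> \<rho>" unfolding m_def by (intro avg x)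
  have q: "\<bar>q\<bar> \<le> \<rho>\<^sup>2" unfolding q_def
  proof (rule avg)
    fix j assume "j \<in> K"
    from power_mono[OF x[OF this] abs_ge_zero, of 2] show "\<bar>(x j)\<^sup>2\<bar> \<le> \<rho>\<^sup>2" by simp
  qed
  define z where "z = q / 2 + r"
  define y where "y = m + z"
  have sum_eq: "(\<Sum>j\<in>K. c j * exp (x j)) = 1 + y"
  proof -
    have "(\<Sum>j\<in>K. c j * exp (x j)) =
      (\<Sum>j\<in>K. c j + c j * x j + c j * (x j)\<^sup>2 / 2 + c j * (exp (x j) - (1 + x j + (x j)\<^sup>2 / 2)))"
      by (intro sum.cong refl) (simp add: algebra_simps)
    also have "\<dots> = 1 + y"
      by (simp add: sum.distrib c(2) y_def z_def m_def q_def r_def sum_divide_distrib[symmetric])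
    finally show ?thesis .
  qed
  have \<rho>3: "\<rho> ^ 3 \<le> \<rho>\<^sup>2 / 4" "\<rho>\<^sup>2 \<le> \<rho> / 4"
    using \<rho> mult_left_mono[of \<rho> "1/4" "\<rho>\<^sup>2"] mult_left_mono[of \<rho> "1/4" \<rho>]
    by (auto simp: power3_eq_cube power2_eq_square)
  have z: "\<bar>z\<bar> \<le> \<rho>\<^sup>2" using q r \<rho>3 by (simp add: z_def)
  have y: "\<bar>y\<bar> \<le> 5 / 4 * \<rho>" using m z \<rho>3 abs_triangle_ineq[of m z] unfolding y_def by linarith
  have "\<bar>ln (1 + y) - (y - y\<^sup>2 / 2)\<bar> \<le> 2 * \<bar>y\<bar> ^ 3"
    using y \<rho> by (intro abs_ln_one_plus_minus_quadratic_le) auto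
  also have "\<bar>y\<bar> ^ 3 \<le> (5 / 4 * \<rho>) ^ 3" using y by (intro power_mono) auto
  finally have main: "\<bar>ln (1 + y) - (y - y\<^sup>2 / 2)\<bar> \<le> 125 / 32 * \<rho> ^ 3"
    by (simp add: power3_eq_cube algebra_simps)
  have "y\<^sup>2 - m\<^sup>2 = 2 * (m * z) + z\<^sup>2" by (simp add: y_def power2_eq_square algebra_simps)
  moreover have "\<bar>m * z\<bar> \<le> \<rho> ^ 3"
    unfolding abs_mult using mult_mono[OF m z] \<rho> by (simp add: power3_eq_cube power2_eq_square mult.assoc)
  moreover have "z\<^sup>2 \<le> \<rho> ^ 3"
  proof -
    have "z\<^sup>2 \<le> (\<rho>\<^sup>2)\<^sup>2" using power_mono[OF z abs_ge_zero, of 2] by simp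
    also have "\<dots> = \<rho> * \<rho> ^ 3" by (simp add: power2_eq_square power3_eq_cube)
    also have "\<dots> \<le> 1 * \<rho> ^ 3" using \<rho> by (intro mult_right_mono) auto
    finally show ?thesis by simp
  qed
  ultimately have "\<bar>y\<^sup>2 - m\<^sup>2\<bar> \<le> 3 * \<rho> ^ 3" using zero_le_power2[of z] by linarith
  \<comment> \<open>In units of \<open>\<rho> ^ 3\<close> the error is \<open>125/32\<close> from
    the logarithm, 1 from \<open>r\<close> and \<open>3/2\<close> from replacing \<open>y\<close> by
    \<open>m\<close> in the square.\<close>
  have "\<bar>ln (1 + y) - (m + (q - m\<^sup>2) / 2)\<bar> \<le> 10 * \<rho> ^ 3"
  proof -
    have "y = m + q / 2 + r" "0 \<le> \<rho> ^ 3" using \<rho> by (simp_all add: y_def z_def)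
    then show ?thesis using main r \<open>\<bar>y\<^sup>2 - m\<^sup>2\<bar> \<le> 3 * \<rho> ^ 3\<close> by argo
  qed
  then show ?thesis unfolding sum_eq by (simp add: m_def q_def)
qed

lemma integral_PiM_product:
  fixes f g :: "'a \<Rightarrow> real"
  assumes M: "\<And>i. prob_space (M i)" and K: "finite K" "i \<in> K" "j \<in> K" "i \<noteq> j"
    and f: "integrable (M i) f" and g: "integrable (M j) g"
  shows "(\<integral>w. f (w i) * g (w j) \<partial>PiM K M) = (\<integral>t. f t \<partial>M i) * (\<integral>t. g t \<partial>M j)"
proof -
  interpret product_prob_space M K using M by (simp add: product_prob_spaceI)
  define F where "F r = (if r = i then f else if r = j then g else (\<lambda>_. 1))" for r
  have prod: "(\<Prod>r\<in>K. G r) = G i * G j" if "\<And>r. r \<noteq> i \<Longrightarrow> r \<noteq> j \<Longrightarrow> G r = 1" for G :: "'b \<Rightarrow> real"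
  proof -
    have "(\<Prod>r\<in>K. G r) = (\<Prod>r\<in>{i, j}. G r)"
      using K that by (intro prod.mono_neutral_right) auto
    then show ?thesis using K by simp
  qed
  have int: "integrable (M r) (F r)" for r using f g by (auto simp: F_def)
  have "(\<integral>w. (\<Prod>r\<in>K. F r (w r)) \<partial>PiM K M) = (\<Prod>r\<in>K. \<integral>t. F r t \<partial>M r)"
    by (rule product_integral_prod[OF K(1) int])
  moreover have "(\<Prod>r\<in>K. F r (w r)) = f (w i) * g (w j)" for w
    using K by (subst prod) (auto simp: F_def)
  moreover have "(\<Prod>r\<in>K. \<integral>t. F r t \<partial>M r) = (\<integral>t. f t \<partial>M i) * (\<integral>t. g t \<partial>M j)"
    using K M by (subst prod) (auto simp: F_def prob_space.prob_space)
  ultimately show ?thesis by simp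
qed

text \<open>Independence and centring kill the cross terms, so the expected Gibbs variance is the
  sum of \<open>p j\<close> times the variance of entry \<open>j\<close>, minus the same sum with
  \<open>p j\<close> squared. The resulting coefficients \<open>p j (1 - p j)\<close> are
  nonnegative, so the leading term is monotone in each variance.\<close>

lemma ln_sum_exp_expectation:
  fixes \<phi> :: "'i \<Rightarrow> 'a \<Rightarrow> real"
  assumes M: "\<And>i. prob_space (M i)" and K: "finite K" and c: "\<And>j. j \<in> K \<Longrightarrow> 0 \<le> c j" "0 < sum c K"
    and \<phi>: "\<And>j. j \<in> K \<Longrightarrow> \<phi> j \<in> borel_measurable (M j)" "\<And>j t. j \<in> K \<Longrightarrow> \<bar>\<phi> j t\<bar> \<le> R"
      "\<And>j. j \<in> K \<Longrightarrow> (\<integral>t. \<phi> j t \<partial>M j) = 0"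
    and \<beta>: "0 \<le> \<beta>" "0 \<le> R" "\<beta> * R \<le> 1 / 4"
  defines "p \<equiv> \<lambda>j. c j / sum c K"
  shows "\<bar>(\<integral>w. ln (\<Sum>j\<in>K. c j * exp (\<beta> * \<phi> j (w j))) \<partial>PiM K M) -
     (ln (sum c K) + \<beta>\<^sup>2 / 2 * (\<Sum>j\<in>K. p j * (1 - p j) * (\<integral>t. (\<phi> j t)\<^sup>2 \<partial>M j)))\<bar> \<le> 10 * (\<beta> * R) ^ 3"
proof -
  let ?P = "PiM K M"
  interpret product_prob_space M K using M by (simp add: product_prob_spaceI)
  have p: "0 \<le> p j" if "j \<in> K" for j using c that by (simp add: p_def)
  have p1: "sum p K = 1" unfolding p_def sum_divide_distrib[symmetric] using c by simp
  have bnd: "AE t in M j. norm (\<phi> j t) \<le> R" if "j \<in> K" for j using \<phi>(2) that by auto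
  have int1: "integrable (M j) (\<phi> j)" if "j \<in> K" for j
    using \<phi>(1)[OF that] bnd[OF that] M prob_space.finite_measure finite_measure.integrable_const_bound by blast
  have int2: "integrable (M j) (\<lambda>t. (\<phi> j t)\<^sup>2)" if "j \<in> K" for j
  proof (rule finite_measure.integrable_const_bound[where B="R\<^sup>2"])
    show "finite_measure (M j)" using M prob_space.finite_measure by blast
    show "AE t in M j. norm ((\<phi> j t)\<^sup>2) \<le> R\<^sup>2"
      using power_mono[OF \<phi>(2)[OF that] abs_ge_zero, where n=2] by auto
    show "(\<lambda>t. (\<phi> j t)\<^sup>2) \<in> borel_measurable (M j)" using \<phi>(1)[OF that] by simp
  qed
  have iw1: "integrable (?P) (\<lambda>w. \<phi> j (w j))" if "j \<in> K" for j
    using that by (intro integrable_PiM_component M int1)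
  have iw2: "integrable (?P) (\<lambda>w. (\<phi> j (w j))\<^sup>2)" if "j \<in> K" for j
    using that by (intro integrable_PiM_component[of M j K "\<lambda>t. (\<phi> j t)\<^sup>2"] M int2)
  have iwp: "integrable (?P) (\<lambda>w. \<phi> i (w i) * \<phi> j (w j))" if "i \<in> K" "j \<in> K" for i j
  proof (rule P.integrable_const_bound[where B="R * R"])
    show "AE w in ?P. norm (\<phi> i (w i) * \<phi> j (w j)) \<le> R * R"
      using \<phi>(2) that by (intro AE_I2) (auto simp: abs_mult intro!: mult_mono \<beta>)
    show "(\<lambda>w. \<phi> i (w i) * \<phi> j (w j)) \<in> borel_measurable (?P)"
      using iw1[OF that(1)] iw1[OF that(2)] by auto
  qed
  let ?m = "\<lambda>w. \<Sum>j\<in>K. p j * (\<beta> * \<phi> j (w j))"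
  let ?q = "\<lambda>w. \<Sum>j\<in>K. p j * (\<beta> * \<phi> j (w j))\<^sup>2"
  let ?A = "\<lambda>w. ln (\<Sum>j\<in>K. p j * exp (\<beta> * \<phi> j (w j)))"
  let ?R = "\<lambda>w. ?m w + (?q w - (?m w)\<^sup>2) / 2"
  have exp: "\<bar>?A w - ?R w\<bar> \<le> 10 * (\<beta> * R) ^ 3" for w
    using K p p1 \<phi>(2) \<beta> by (intro ln_sum_exp_expansion) (auto simp: abs_mult intro!: mult_left_mono)
  have m2: "(?m w)\<^sup>2 = (\<Sum>i\<in>K. \<Sum>j\<in>K. (p i * p j * \<beta>\<^sup>2) * (\<phi> i (w i) * \<phi> j (w j)))" for w
    unfolding power2_eq_square sum_product by (intro sum.cong refl) (simp add: algebra_simps)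
  have q: "?q w = (\<Sum>j\<in>K. (p j * \<beta>\<^sup>2) * (\<phi> j (w j))\<^sup>2)" for w
    by (intro sum.cong refl) (simp add: power_mult_distrib)
  have int_m: "integrable (?P) ?m" using iw1 by auto
  have int_q: "integrable (?P) ?q" unfolding q using iw2 by auto
  have int_m2: "integrable (?P) (\<lambda>w. (?m w)\<^sup>2)" unfolding m2 using iwp by auto
  have Ew1: "(\<integral>w. \<phi> j (w j) \<partial>?P) = 0" if "j \<in> K" for j
    using integral_PiM_component[of M j K "\<phi> j", OF M that int1[OF that]] \<phi>(3)[OF that] by simp
  have Ew2: "(\<integral>w. (\<phi> j (w j))\<^sup>2 \<partial>?P) = (\<integral>t. (\<phi> j t)\<^sup>2 \<partial>M j)" if "j \<in> K" for j
    using integral_PiM_component[of M j K "\<lambda>t. (\<phi> j t)\<^sup>2", OF M that int2[OF that]] .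
  have E_m: "(\<integral>w. ?m w \<partial>?P) = 0"
    using iw1 Ew1 by simp
  let ?s = "\<lambda>j. \<integral>t. (\<phi> j t)\<^sup>2 \<partial>M j"
  have E_q: "(\<integral>w. ?q w \<partial>?P) = (\<Sum>j\<in>K. p j * \<beta>\<^sup>2 * ?s j)"
    unfolding q using iw2 Ew2 by simp
  have cross: "(\<integral>w. \<phi> i (w i) * \<phi> j (w j) \<partial>?P) = (if i = j then ?s i else 0)" if "i \<in> K" "j \<in> K" for i j
  proof (cases "i = j")
    case True
    then show ?thesis
      using Ew2[OF that(1)] by (simp add: power2_eq_square)
  next
    case False
    then show ?thesis using integral_PiM_product[OF M K that False int1 int1] that \<phi>(3) by simp
  qed
  have E_m2: "(\<integral>w. (?m w)\<^sup>2 \<partial>?P) = (\<Sum>j\<in>K. (p j)\<^sup>2 * \<beta>\<^sup>2 * ?s j)"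
  proof -
    have "(\<integral>w. (?m w)\<^sup>2 \<partial>?P) = (\<Sum>i\<in>K. \<Sum>j\<in>K. (p i * p j * \<beta>\<^sup>2) * (\<integral>w. \<phi> i (w i) * \<phi> j (w j) \<partial>?P))"
      unfolding m2 using iwp by (simp add: Bochner_Integration.integral_sum)
    also have "\<dots> = (\<Sum>i\<in>K. \<Sum>j\<in>K. if i = j then (p i * p i * \<beta>\<^sup>2) * ?s i else 0)"
      by (intro sum.cong refl) (simp add: cross)
    finally show ?thesis using K by (simp add: sum.delta power2_eq_square)
  qed
  have int_R: "integrable (?P) (\<lambda>w. ?R w)"
    using int_m int_q int_m2 by auto
  have A_meas: "?A \<in> borel_measurable (?P)"
    by (intro borel_measurable_ln borel_measurable_sum borel_measurable_times borel_measurable_const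
        measurable_compose[OF _ borel_measurable_exp] borel_measurable_integrable[OF iw1])
  have int_D: "integrable (?P) (\<lambda>w. ?A w - ?R w)"
    using exp A_meas int_R by (intro P.integrable_const_bound[where B="10 * (\<beta> * R) ^ 3"]) auto
  have int_A: "integrable (?P) ?A"
    using Bochner_Integration.integrable_add[OF int_D int_R] by simp
  have "\<bar>\<integral>w. ?A w - ?R w \<partial>?P\<bar> \<le> (\<integral>w. 10 * (\<beta> * R) ^ 3 \<partial>?P)"
    using exp int_D by (intro order_trans[OF integral_abs_bound] integral_mono) auto
  also have "(\<integral>w. 10 * (\<beta> * R) ^ 3 \<partial>?P) = 10 * (\<beta> * R) ^ 3" by (simp add: P.prob_space)
  also have "(\<integral>w. ?A w - ?R w \<partial>?P) =
      (\<integral>w. ?A w \<partial>?P) - ((\<integral>w. ?m w \<partial>?P) + ((\<integral>w. ?q w \<partial>?P) - (\<integral>w. (?m w)\<^sup>2 \<partial>?P)) / 2)"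
    using int_A int_m int_q int_m2 by (simp del: integral_sum)
  also have "\<dots> = (\<integral>w. ?A w \<partial>?P) - \<beta>\<^sup>2 / 2 * (\<Sum>j\<in>K. p j * (1 - p j) * ?s j)"
    unfolding E_m E_q E_m2 by (simp add: sum_subtractf[symmetric] sum_distrib_left sum_divide_distrib power2_eq_square algebra_simps diff_divide_distrib)
  finally have A: "\<bar>(\<integral>w. ?A w \<partial>?P) - \<beta>\<^sup>2 / 2 * (\<Sum>j\<in>K. p j * (1 - p j) * ?s j)\<bar> \<le> 10 * (\<beta> * R) ^ 3" .
  have "ln (\<Sum>j\<in>K. c j * exp (\<beta> * \<phi> j (w j))) = ln (sum c K) + ?A w" for w
  proof -
    have "(\<Sum>j\<in>K. c j * exp (\<beta> * \<phi> j (w j))) = sum c K * (\<Sum>j\<in>K. p j * exp (\<beta> * \<phi> j (w j)))"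
      using c(2) by (simp add: p_def sum_distrib_left)
    moreover have "0 < (\<Sum>j\<in>K. p j * exp (\<beta> * \<phi> j (w j)))"
    proof -
      obtain j where "j \<in> K" "p j \<noteq> 0" using p1 by (metis sum.neutral zero_neq_one)
      then show ?thesis using p K by (intro sum_pos2[of K j]) (auto simp: less_le)
    qed
    ultimately show ?thesis using c(2) by (simp add: ln_mult)
  qed
  then have "(\<integral>w. ln (\<Sum>j\<in>K. c j * exp (\<beta> * \<phi> j (w j))) \<partial>?P) = ln (sum c K) + (\<integral>w. ?A w \<partial>?P)"
    using int_A by (simp add: P.prob_space)
  then show ?thesis using A by (simp add: algebra_simps)
qed

text \<open>By monotonicity in the variances, an inequality takes the place of the usual matching of
  second moments. The constant 20 is twice the expansion error.\<close>

lemma ln_sum_exp_comparison: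
  fixes \<phi> \<psi> :: "'i \<Rightarrow> 'a \<Rightarrow> real"
  assumes M: "\<And>i. prob_space (M i)" and N: "\<And>i. prob_space (N i)"
    and K: "finite K" and c: "\<And>j. j \<in> K \<Longrightarrow> 0 \<le> c j" "0 < sum c K"
    and \<phi>: "\<And>j. j \<in> K \<Longrightarrow> \<phi> j \<in> borel_measurable (M j)" "\<And>j t. j \<in> K \<Longrightarrow> \<bar>\<phi> j t\<bar> \<le> R"
      "\<And>j. j \<in> K \<Longrightarrow> (\<integral>t. \<phi> j t \<partial>M j) = 0"
    and \<psi>: "\<And>j. j \<in> K \<Longrightarrow> \<psi> j \<in> borel_measurable (N j)" "\<And>j t. j \<in> K \<Longrightarrow> \<bar>\<psi> j t\<bar> \<le> R"
      "\<And>j. j \<in> K \<Longrightarrow> (\<integral>t. \<psi> j t \<partial>N j) = 0"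
    and var: "\<And>j. j \<in> K \<Longrightarrow> (\<integral>t. (\<phi> j t)\<^sup>2 \<partial>M j) \<le> (\<integral>t. (\<psi> j t)\<^sup>2 \<partial>N j)"
    and \<beta>: "0 \<le> \<beta>" "0 \<le> R" "\<beta> * R \<le> 1 / 4"
  shows "(\<integral>w. ln (\<Sum>j\<in>K. c j * exp (\<beta> * \<phi> j (w j))) \<partial>PiM K M) \<le>
    (\<integral>w. ln (\<Sum>j\<in>K. c j * exp (\<beta> * \<psi> j (w j))) \<partial>PiM K N) + 20 * (\<beta> * R) ^ 3"
proof -
  define p where "p j = c j / sum c K" for j
  have p: "0 \<le> p j" "p j \<le> 1" if "j \<in> K" for j
    using c that K by (auto simp: p_def intro!: member_le_sum)
  have "(\<Sum>j\<in>K. p j * (1 - p j) * (\<integral>t. (\<phi> j t)\<^sup>2 \<partial>M j)) \<le> (\<Sum>j\<in>K. p j * (1 - p j) * (\<integral>t. (\<psi> j t)\<^sup>2 \<partial>N j))"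
    using p by (intro sum_mono mult_left_mono var) auto
  then have "\<beta>\<^sup>2 / 2 * (\<Sum>j\<in>K. p j * (1 - p j) * (\<integral>t. (\<phi> j t)\<^sup>2 \<partial>M j)) \<le>
     \<beta>\<^sup>2 / 2 * (\<Sum>j\<in>K. p j * (1 - p j) * (\<integral>t. (\<psi> j t)\<^sup>2 \<partial>N j))"
    by (intro mult_left_mono) auto
  moreover note ln_sum_exp_expectation[where M=M and \<phi>=\<phi>, OF M K c \<phi> \<beta>] ln_sum_exp_expectation[where M=N and \<phi>=\<psi>, OF N K c \<psi> \<beta>]
  ultimately show ?thesis unfolding p_def[symmetric] abs_le_iff by linarith
qed

section \<open>Free energy of a path family\<close>

context path_family begin

definition log_partition :: "real \<Rightarrow> ('i \<Rightarrow> real) \<Rightarrow> real" where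
  "log_partition \<beta> w = ln (\<Sum>\<pi>\<in>P. exp (\<beta> * sum w \<pi>))"

lemma partition_pos: "0 < (\<Sum>\<pi>\<in>P. exp (\<beta> * sum w \<pi>) :: real)"
  using finite_P P_nonempty by (intro sum_pos) auto

lemma max_weight_le_log_partition:
  "\<beta> * max_weight P w \<le> log_partition \<beta> w"
proof -
  obtain \<pi> where \<pi>: "\<pi> \<in> P" "max_weight P w = sum w \<pi>" by (rule max_weight_attained)
  have "exp (\<beta> * sum w \<pi>) \<le> (\<Sum>\<pi>\<in>P. exp (\<beta> * sum w \<pi>))"
    using finite_P \<pi>(1) by (intro member_le_sum) auto
  then show ?thesis using partition_pos unfolding log_partition_def \<pi>(2) by (subst ln_ge_iff) auto
qed

lemma log_partition_le_max_weight:
  assumes "0 \<le> \<beta>"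
  shows "log_partition \<beta> w \<le> \<beta> * max_weight P w + ln (real (card P))"
proof -
  have "(\<Sum>\<pi>\<in>P. exp (\<beta> * sum w \<pi>)) \<le> (\<Sum>\<pi>\<in>P. exp (\<beta> * max_weight P w))"
    using assms by (intro sum_mono) (auto intro!: mult_left_mono max_weight_ge finite_P)
  then have "log_partition \<beta> w \<le> ln (real (card P) * exp (\<beta> * max_weight P w))"
    unfolding log_partition_def using partition_pos by (intro ln_mono) auto
  also have "\<dots> = \<beta> * max_weight P w + ln (real (card P))"
    using finite_P P_nonempty by (subst ln_mult) (auto simp: card_gt_0_iff)
  finally show ?thesis .
qed

lemma log_partition_cong:
  assumes "\<And>z. z \<in> J \<Longrightarrow> w z = w' z"
  shows "log_partition \<beta> w = log_partition \<beta> w'"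
proof -
  have "sum w \<pi> = sum w' \<pi>" if "\<pi> \<in> P" for \<pi>
    using P_subset[OF that] assms by (intro sum.cong) auto
  then show ?thesis by (simp add: log_partition_def)
qed

lemma integrable_log_partition:
  assumes N: "finite_measure N" and \<phi>: "\<And>z. z \<in> J \<Longrightarrow> (\<lambda>x. f x z) \<in> borel_measurable N"
    "\<And>x z. z \<in> J \<Longrightarrow> \<bar>f x z\<bar> \<le> R" and \<beta>: "0 \<le> \<beta>"
  shows "integrable N (\<lambda>x. log_partition \<beta> (f x))"
proof (rule finite_measure.integrable_const_bound[OF N, where B="\<beta> * (\<Sum>z\<in>J. R) + ln (real (card P))"])
  show "AE x in N. norm (log_partition \<beta> (f x)) \<le> \<beta> * (\<Sum>z\<in>J. R) + ln (real (card P))"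
  proof (rule AE_I2)
    fix x
    have "(\<Sum>z\<in>J. \<bar>f x z\<bar>) \<le> (\<Sum>z\<in>J. R)" using \<phi>(2) by (intro sum_mono) auto
    then have "\<bar>max_weight P (f x)\<bar> \<le> (\<Sum>z\<in>J. R)" using abs_max_weight_le[of "f x"] by linarith
    then have "\<beta> * \<bar>max_weight P (f x)\<bar> \<le> \<beta> * (\<Sum>z\<in>J. R)" using \<beta> by (rule mult_left_mono)
    then have "\<bar>\<beta> * max_weight P (f x)\<bar> \<le> \<beta> * (\<Sum>z\<in>J. R)" using \<beta> by (simp add: abs_mult)
    moreover have "0 \<le> ln (real (card P))"
      using finite_P P_nonempty by (intro ln_ge_zero) (simp add: Suc_le_eq card_gt_0_iff)
    ultimately show "norm (log_partition \<beta> (f x)) \<le> \<beta> * (\<Sum>z\<in>J. R) + ln (real (card P))"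
      using max_weight_le_log_partition[of \<beta> "f x"] log_partition_le_max_weight[OF \<beta>, of "f x"]
      unfolding real_norm_def by linarith
  qed
  show "(\<lambda>x. log_partition \<beta> (f x)) \<in> borel_measurable N"
    unfolding log_partition_def using P_subset
    by (intro borel_measurable_ln borel_measurable_sum measurable_compose[OF _ borel_measurable_exp]
        borel_measurable_times borel_measurable_const \<phi>(1)) auto
qed

end

locale column_family = path_family J P k for J :: "(nat \<times> nat) set" and P k +
  assumes one_per_column: "\<And>\<pi> i. \<pi> \<in> P \<Longrightarrow> i < k \<Longrightarrow> card (\<pi> \<inter> {i} \<times> UNIV) = 1"
    and J_columns: "J \<subseteq> {..<k} \<times> UNIV"
begin

lemma partition_by_column:
  assumes i: "i < k"
  shows "(\<Sum>\<pi>\<in>P. g \<pi>) = (\<Sum>j\<in>{z\<in>J. fst z = i}. \<Sum>\<pi>\<in>{\<pi>\<in>P. j \<in> \<pi>}. g \<pi> :: real)"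
proof -
  have "(\<Sum>j\<in>{z\<in>J. fst z = i}. \<Sum>\<pi>\<in>{\<pi>\<in>P. j \<in> \<pi>}. g \<pi>) = (\<Sum>j\<in>{z\<in>J. fst z = i}. \<Sum>\<pi>\<in>P. if j \<in> \<pi> then g \<pi> else 0)"
    by (intro sum.cong refl sum.inter_filter finite_P)
  also have "\<dots> = (\<Sum>\<pi>\<in>P. \<Sum>j\<in>{z\<in>J. fst z = i}. if j \<in> \<pi> then g \<pi> else 0)" by (rule sum.swap)
  also have "\<dots> = (\<Sum>\<pi>\<in>P. g \<pi>)"
  proof (intro sum.cong refl)
    fix \<pi> assume \<pi>: "\<pi> \<in> P"
    have "(\<Sum>j\<in>{z\<in>J. fst z = i}. if j \<in> \<pi> then g \<pi> else 0) = (\<Sum>j\<in>{j\<in>{z\<in>J. fst z = i}. j \<in> \<pi>}. g \<pi>)"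
      using finite_J by (intro sum.inter_filter[symmetric]) auto
    also have "{j\<in>{z\<in>J. fst z = i}. j \<in> \<pi>} = \<pi> \<inter> {i} \<times> UNIV" using P_subset[OF \<pi>] by auto
    finally show "(\<Sum>j\<in>{z\<in>J. fst z = i}. if j \<in> \<pi> then g \<pi> else 0) = g \<pi>"
      using one_per_column[OF \<pi> i] by simp
  qed
  finally show ?thesis ..
qed

text \<open>A path meets column \<open>i\<close> in exactly one point, so the partition function is
  linear in the factors \<open>exp (\<beta> * w j)\<close> of that column, with coefficients that
  involve the other columns only.\<close>

lemma log_partition_column:
  assumes i: "i < k"
  shows "log_partition \<beta> w = ln (\<Sum>j\<in>{z\<in>J. fst z = i}.
    (\<Sum>\<pi>\<in>{\<pi>\<in>P. j \<in> \<pi>}. exp (\<beta> * (\<Sum>z\<in>\<pi> - {i} \<times> UNIV. w z))) * exp (\<beta> * w j))"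
  unfolding log_partition_def partition_by_column[OF i] sum_distrib_right
proof (intro arg_cong[where f=ln] sum.cong refl)
  fix j \<pi> assume j: "j \<in> {z\<in>J. fst z = i}" and \<pi>: "\<pi> \<in> {\<pi>\<in>P. j \<in> \<pi>}"
  have fin: "finite \<pi>" using \<pi> P_subset finite_J finite_subset by blast
  obtain z where z: "\<pi> \<inter> {i} \<times> UNIV = {z}" using one_per_column[of \<pi> i] i \<pi> by (auto simp: card_1_singleton_iff)
  have "j \<in> \<pi> \<inter> {i} \<times> UNIV" using j \<pi> by (cases j) auto
  then have "\<pi> \<inter> {i} \<times> UNIV = {j}" using z by simp
  then have "sum w \<pi> = w j + (\<Sum>z\<in>\<pi> - {i} \<times> UNIV. w z)"
    using sum.Int_Diff[OF fin, of w "{i} \<times> UNIV"] by simp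
  then show "exp (\<beta> * sum w \<pi>) = exp (\<beta> * (\<Sum>z\<in>\<pi> - {i} \<times> UNIV. w z)) * exp (\<beta> * w j)"
    by (simp add: exp_add[symmetric] algebra_simps)
qed

text \<open>Lindeberg replacement, one column at a time: since a path meets a column once, the Gibbs weights
  in a column sum to one and each replacement costs \<open>O((\<beta> R)\<^sup>3)\<close>, whatever the number of rows.\<close>

lemma log_partition_replace:
  fixes \<phi> \<psi> :: "nat \<times> nat \<Rightarrow> 'a \<Rightarrow> real"
  assumes M: "\<And>z. prob_space (M z)" and N: "\<And>z. prob_space (N z)"
    and \<phi>: "\<And>z. \<phi> z \<in> borel_measurable (M z)" "\<And>z t. \<bar>\<phi> z t\<bar> \<le> R" "\<And>z. (\<integral>t. \<phi> z t \<partial>M z) = 0"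
    and \<psi>: "\<And>z. \<psi> z \<in> borel_measurable (N z)" "\<And>z t. \<bar>\<psi> z t\<bar> \<le> R" "\<And>z. (\<integral>t. \<psi> z t \<partial>N z) = 0"
    and var: "\<And>z. (\<integral>t. (\<phi> z t)\<^sup>2 \<partial>M z) \<le> (\<integral>t. (\<psi> z t)\<^sup>2 \<partial>N z)"
    and \<beta>: "0 \<le> \<beta>" "0 \<le> R" "\<beta> * R \<le> 1 / 4"
  shows "(\<integral>w. log_partition \<beta> (\<lambda>z. \<phi> z (w z)) \<partial>PiM J M) \<le>
    (\<integral>w. log_partition \<beta> (\<lambda>z. \<psi> z (w z)) \<partial>PiM J N) + real k * (20 * (\<beta> * R) ^ 3)"
proof -
  \<comment> \<open>Hybrid field \<open>i\<close>: the columns left of \<open>i\<close> are already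
    replaced, the others are not. Consecutive hybrids differ in one column.\<close>
  define MM where "MM i z = (if fst z < i then N z else M z)" for i z
  define \<Phi> where "\<Phi> i z = (if fst z < i then \<psi> z else \<phi> z)" for i z
  define E where "E i = (\<integral>w. log_partition \<beta> (\<lambda>z. \<Phi> i z (w z)) \<partial>PiM J (MM i))" for i
  have MM: "prob_space (MM i z)" for i z using M N by (simp add: MM_def)
  have \<Phi>: "\<Phi> i z \<in> borel_measurable (MM i z)" "\<bar>\<Phi> i z t\<bar> \<le> R" for i z t
    using \<phi> \<psi> by (auto simp: \<Phi>_def MM_def)
  have step: "E i \<le> E (Suc i) + 20 * (\<beta> * R) ^ 3" if i: "i < k" for i
  proof -
    define K where "K = {z\<in>J. fst z = i}"
    define I where "I = J - K"
    have IK: "I \<inter> K = {}" "finite I" "finite K" "I \<union> K = J" "K \<subseteq> J"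
      using finite_J by (auto simp: K_def I_def)
    define f where "f i' w = log_partition \<beta> (\<lambda>z. \<Phi> i' z (w z))" for i' w
    let ?in = "\<lambda>i' x. \<integral>y. f i' (merge I K (x, y)) \<partial>PiM K (MM i')"
    have int_f: "integrable (PiM J (MM i')) (f i')" for i'
    proof -
      interpret product_prob_space "MM i'" J using MM by (simp add: product_prob_spaceI)
      show ?thesis unfolding f_def
      proof (rule integrable_log_partition[OF P.finite_measure_axioms _ \<Phi>(2) \<beta>(1)])
        fix z assume "z \<in> J"
        then show "(\<lambda>w. \<Phi> i' z (w z)) \<in> borel_measurable (PiM J (MM i'))"
          by (rule measurable_compose[OF measurable_component_singleton[of z J "MM i'"] \<Phi>(1)])
      qed
    qed
    have fold: "(\<integral>w. f i' w \<partial>PiM J (MM i')) =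
        (\<integral>x. ?in i' x \<partial>PiM I (MM i'))"
      and int_fold: "integrable (PiM I (MM i')) (?in i')" for i'
    proof -
      interpret product_prob_space "MM i'" J using MM by (simp add: product_prob_spaceI)
      show "(\<integral>w. f i' w \<partial>PiM J (MM i')) =
        (\<integral>x. ?in i' x \<partial>PiM I (MM i'))"
        using product_integral_fold[OF IK(1-3), of "f i'"] int_f IK(4) by simp
      show "integrable (PiM I (MM i')) (?in i')"
        using integrable_merge[OF IK(1-3), of "f i'"] int_f IK(4) by simp
    qed
    have I_eq: "PiM I (MM i) = PiM I (MM (Suc i))" by (intro PiM_cong) (auto simp: MM_def I_def K_def)
    have K_eq: "PiM K (MM i) = PiM K M" "PiM K (MM (Suc i)) = PiM K N"
      by (intro PiM_cong; auto simp: MM_def K_def)+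
    \<comment> \<open>The coefficients of column \<open>i\<close>, common to the hybrids
      \<open>i\<close> and \<open>i + 1\<close>. Given the other columns \<open>x\<close> they are
      constants, as the one-column comparison requires.\<close>
    define C where "C x j = (\<Sum>\<pi>\<in>{\<pi>\<in>P. j \<in> \<pi>}. exp (\<beta> * (\<Sum>z\<in>\<pi> - {i} \<times> UNIV. \<Phi> i z (x z))))" for x j
    have col: "f i' (merge I K (x, y)) = ln (\<Sum>j\<in>K. C x j * exp (\<beta> * \<Phi> i' j (y j)))"
      if i': "i' = i \<or> i' = Suc i" for i' x y
      unfolding f_def log_partition_column[OF i] K_def[symmetric]
    proof (intro arg_cong[where f=ln] sum.cong refl arg_cong2[where f="(*)"])
      fix j assume j: "j \<in> K"
      then show "exp (\<beta> * \<Phi> i' j (merge I K (x, y) j)) = exp (\<beta> * \<Phi> i' j (y j))" using IK by simp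
      show "(\<Sum>\<pi>\<in>{\<pi>\<in>P. j \<in> \<pi>}. exp (\<beta> * (\<Sum>z\<in>\<pi> - {i} \<times> UNIV. \<Phi> i' z (merge I K (x, y) z)))) = C x j"
        unfolding C_def
      proof (intro sum.cong refl arg_cong[where f=exp] arg_cong2[where f="(*)"])
        fix \<pi> z assume "\<pi> \<in> {\<pi>\<in>P. j \<in> \<pi>}" and z: "z \<in> \<pi> - {i} \<times> UNIV"
        then have "z \<in> J" using P_subset by auto
        moreover have "fst z \<noteq> i" using z by (cases z) auto
        ultimately have zI: "z \<in> I" by (simp add: I_def K_def)
        have "\<Phi> i' z = \<Phi> i z" using i' \<open>fst z \<noteq> i\<close> by (auto simp: \<Phi>_def)
        then show "\<Phi> i' z (merge I K (x, y) z) = \<Phi> i z (x z)" using zI IK by simp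
      qed
    qed
    have inner: "?in i x \<le>
        ?in (Suc i) x + 20 * (\<beta> * R) ^ 3" for x
    proof -
      have Cpos: "0 < sum (C x) K"
      proof -
        have "sum (C x) K = (\<Sum>\<pi>\<in>P. exp (\<beta> * (\<Sum>z\<in>\<pi> - {i} \<times> UNIV. \<Phi> i z (x z))))"
          unfolding C_def K_def partition_by_column[OF i] ..
        also have "\<dots> > 0" using finite_P P_nonempty by (intro sum_pos) auto
        finally show ?thesis .
      qed
      have 1: "?in i x = (\<integral>y. ln (\<Sum>j\<in>K. C x j * exp (\<beta> * \<phi> j (y j))) \<partial>PiM K M)"
        unfolding K_eq col[OF disjI1[OF refl]]
        by (intro Bochner_Integration.integral_cong refl arg_cong[where f=ln] sum.cong) (auto simp: \<Phi>_def K_def)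
      have 2: "?in (Suc i) x = (\<integral>y. ln (\<Sum>j\<in>K. C x j * exp (\<beta> * \<psi> j (y j))) \<partial>PiM K N)"
        unfolding K_eq col[OF disjI2[OF refl]]
        by (intro Bochner_Integration.integral_cong refl arg_cong[where f=ln] sum.cong) (auto simp: \<Phi>_def K_def)
      show ?thesis unfolding 1 2
        by (rule ln_sum_exp_comparison[OF M N IK(3) _ Cpos \<phi>(1,2,3) \<psi>(1,2,3) var \<beta>])
          (auto simp: C_def intro!: sum_nonneg)
    qed
    interpret I: product_prob_space "MM (Suc i)" I using MM by (simp add: product_prob_spaceI)
    have "E i \<le> (\<integral>x. ?in (Suc i) x + 20 * (\<beta> * R) ^ 3 \<partial>PiM I (MM (Suc i)))"
      unfolding E_def f_def[symmetric] fold[of i] I_eq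
      using int_fold[of i] int_fold[of "Suc i"] inner I.P.integrable_const unfolding I_eq
      by (intro integral_mono) auto
    also have "\<dots> = E (Suc i) + 20 * (\<beta> * R) ^ 3"
      unfolding E_def f_def[symmetric] fold[of "Suc i"]
      using int_fold[of "Suc i"] by (simp add: I.P.prob_space)
    finally show ?thesis .
  qed
  have "E 0 \<le> E i + real i * (20 * (\<beta> * R) ^ 3)" if "i \<le> k" for i
    using that
  proof (induction i)
    case (Suc i)
    then show ?case using step[of i] by (simp add: algebra_simps)
  qed simp
  from this[OF order.refl] have "E 0 \<le> E k + real k * (20 * (\<beta> * R) ^ 3)" .
  moreover have "E 0 = (\<integral>w. log_partition \<beta> (\<lambda>z. \<phi> z (w z)) \<partial>PiM J M)"
    by (simp add: E_def \<Phi>_def MM_def[abs_def])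
  moreover have "E k = (\<integral>w. log_partition \<beta> (\<lambda>z. \<psi> z (w z)) \<partial>PiM J N)"
  proof -
    have "PiM J (MM k) = PiM J N" using J_columns by (intro PiM_cong) (auto simp: MM_def)
    moreover have "log_partition \<beta> (\<lambda>z. \<Phi> k z (w z)) = log_partition \<beta> (\<lambda>z. \<psi> z (w z))" for w
      using J_columns by (intro log_partition_cong) (auto simp: \<Phi>_def)
    ultimately show ?thesis by (simp add: E_def)
  qed
  ultimately show ?thesis by simp
qed

text \<open>The signs \<plusminus>\<sigma> are affine images of fair coins, so the coin bound
  applies at a single level: centring removes the \<open>k / 2\<close> and leaves
  \<open>2 * \<sigma> * sqrt K\<close>. The entropy \<open>ln (card P) / \<beta>\<close> enters only
  once, when the free energy of the signs is turned back into a maximum.\<close>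

lemma bounded_field_bound:
  fixes \<phi> :: "nat \<times> nat \<Rightarrow> real \<Rightarrow> real"
  assumes M: "\<And>z. prob_space (M z)"
    and \<phi>: "\<And>z. \<phi> z \<in> borel_measurable (M z)" "\<And>z t. \<bar>\<phi> z t\<bar> \<le> R" "\<And>z. (\<integral>t. \<phi> z t \<partial>M z) = 0"
    and var: "\<And>z. (\<integral>t. (\<phi> z t)\<^sup>2 \<partial>M z) \<le> \<sigma>\<^sup>2" and \<sigma>: "0 \<le> \<sigma>" "\<sigma> \<le> R"
    and \<beta>: "0 < \<beta>" "\<beta> * R \<le> 1 / 4" and cb: "coin_bound J P k K" "0 \<le> K"
  shows "(\<integral>w. max_weight P (\<lambda>z. \<phi> z (w z)) \<partial>PiM J M) \<le>
    2 * \<sigma> * sqrt K + ln (real (card P)) / \<beta> + real k * (20 * \<beta>\<^sup>2 * R ^ 3)"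
proof -
  let ?M = "PiM J M" and ?f = "\<lambda>w. max_weight P (\<lambda>z. \<phi> z (w z))"
  define N where "N = distr (measure_pmf (bernoulli_pmf (1/2))) borel (of_bool :: bool \<Rightarrow> real)"
  interpret N: real_distribution N
    unfolding N_def by (intro prob_space.real_distribution_distr measure_pmf.prob_space_axioms) simp
  \<comment> \<open>A threshold instead of the affine map \<open>\<sigma> * (2 * t - 1)\<close>: the
    bound by \<open>R\<close> then holds for every real \<open>t\<close> and not only on the
    support, and the maximum takes the form of \<open>threshold_bound\<close>.\<close>
  define \<psi> where "\<psi> t = \<sigma> * (2 * of_bool (1/2 < t) - 1)" for t :: real
  have \<psi>_meas: "\<psi> \<in> borel_measurable borel"
    unfolding \<psi>_def[abs_def] of_bool_def by measurable
  have \<psi>_le: "\<bar>\<psi> t\<bar> \<le> R" for t using \<sigma> by (auto simp: \<psi>_def)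
  have \<psi>_mean: "(\<integral>t. \<psi> t \<partial>N) = 0"
    unfolding N_def by (subst integral_distr) (use \<psi>_meas in \<open>auto simp: \<psi>_def\<close>)
  have \<psi>_var: "(\<integral>t. (\<psi> t)\<^sup>2 \<partial>N) = \<sigma>\<^sup>2"
  proof -
    have "(\<psi> t)\<^sup>2 = \<sigma>\<^sup>2" for t by (auto simp: \<psi>_def)
    then show ?thesis using N.prob_space by simp
  qed
  have half: "measure N {1/2<..} = 1/2"
  proof -
    have "measure N {1/2<..} = measure (measure_pmf (bernoulli_pmf (1/2))) ((of_bool :: bool \<Rightarrow> real) -` {1/2<..})"
      unfolding N_def by (subst measure_distr) auto
    also have "(of_bool :: bool \<Rightarrow> real) -` {1/2<..} = {True}" by (auto split: if_splits simp: of_bool_def)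
    finally show ?thesis by (simp add: measure_pmf_single)
  qed
  let ?N = "PiM J (\<lambda>_. N)" and ?g = "\<lambda>w. max_weight P (\<lambda>z. \<psi> (w z))"
  interpret MJ: product_prob_space M J using M by (simp add: product_prob_spaceI)
  interpret NJ: product_prob_space "\<lambda>_. N" J using N.prob_space_axioms by (simp add: product_prob_spaceI)
  have \<phi>_w: "(\<lambda>w. \<phi> z (w z)) \<in> borel_measurable (?M)" if "z \<in> J" for z
    by (rule measurable_compose[OF measurable_component_singleton[of z J M, OF that] \<phi>(1)])
  have \<psi>_w: "(\<lambda>w. \<psi> (w z)) \<in> borel_measurable (?N)" if "z \<in> J" for z
    using that \<psi>_meas by (intro measurable_compose[OF measurable_component_singleton[of z J "\<lambda>_. N"]]) auto
  have int_\<phi>: "integrable (?M) (\<lambda>w. ?f w)"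
    using \<phi>(2) by (intro integrable_max_weight MJ.P.integrable_const_bound[where B=R] \<phi>_w) auto
  have int_\<psi>: "integrable (?N) (\<lambda>w. ?g w)"
    using \<psi>_le by (intro integrable_max_weight NJ.P.integrable_const_bound[where B=R] \<psi>_w) auto
  have "\<beta> * (\<integral>w. ?f w \<partial>?M) = (\<integral>w. \<beta> * ?f w \<partial>?M)"
    by simp
  also have "\<dots> \<le> (\<integral>w. log_partition \<beta> (\<lambda>z. \<phi> z (w z)) \<partial>?M)"
    using int_\<phi> \<phi>(2) \<beta> by (intro integral_mono max_weight_le_log_partition
      integrable_log_partition[OF MJ.P.finite_measure_axioms \<phi>_w, where R=R]) auto
  also have "\<dots> \<le> (\<integral>w. log_partition \<beta> (\<lambda>z. \<psi> (w z)) \<partial>?N) + real k * (20 * (\<beta> * R) ^ 3)"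
    using M \<phi> \<psi>_meas \<psi>_le \<psi>_mean \<psi>_var var \<beta> \<sigma> N.prob_space_axioms
    by (intro log_partition_replace) auto
  also have "(\<integral>w. log_partition \<beta> (\<lambda>z. \<psi> (w z)) \<partial>?N) \<le>
      (\<integral>w. \<beta> * ?g w + ln (real (card P)) \<partial>?N)"
    using int_\<psi> \<psi>_le \<beta> by (intro integral_mono log_partition_le_max_weight
      integrable_log_partition[OF NJ.P.finite_measure_axioms \<psi>_w, where R=R]) auto
  also have "\<dots> = \<beta> * (\<integral>w. ?g w \<partial>?N) + ln (real (card P))"
    using int_\<psi> by (simp add: NJ.P.prob_space)
  also have "(\<integral>w. ?g w \<partial>?N) \<le> 2 * \<sigma> * sqrt K"
  proof -
    let ?b = "\<lambda>w. max_weight P (\<lambda>z. of_bool (1/2 < w z))"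
    have int_b: "integrable (?N) ?b"
    proof (intro integrable_max_weight NJ.P.integrable_const_bound[where B=1])
      fix z assume [measurable]: "z \<in> J"
      show "(\<lambda>w. of_bool (1/2 < w z) :: real) \<in> borel_measurable (?N)"
        unfolding of_bool_def by measurable
    qed auto
    have nonneg: "0 \<le> ?b w" for w :: "nat \<times> nat \<Rightarrow> real"
      using max_weight_mono[of "\<lambda>_. 0" "\<lambda>z. of_bool (1/2 < w z)"] by (simp add: max_weight_const)
    have "ennreal (\<integral>w. ?b w \<partial>?N) = (\<integral>\<^sup>+w. ennreal (?b w) \<partial>?N)"
      using int_b nonneg by (intro nn_integral_eq_integral[symmetric] AE_I2)
    also have "\<dots> \<le> ennreal (real k * (1/2) + 2 * sqrt (K * (1/2 * (1 - 1/2))))"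
      using threshold_bound[OF finite_J N.prob_space_axioms N.events_eq_borel cb(1) P_subset, of "1/2"]
      unfolding half .
    finally have "(\<integral>w. ?b w \<partial>?N) \<le> real k * (1/2) + 2 * sqrt (K * (1/2 * (1 - 1/2)))"
      using cb(2) by (subst (asm) ennreal_le_iff) auto
    also have "sqrt (K * (1/2 * (1 - 1/2))) = sqrt K / 2"
      by (simp add: real_sqrt_divide)
    finally have b: "(\<integral>w. ?b w \<partial>?N) \<le> real k / 2 + sqrt K" by simp
    have "?g w = 2 * \<sigma> * ?b w - real k * \<sigma>" for w
    proof -
      have "?g w = max_weight P (\<lambda>z. (2 * \<sigma>) * of_bool (1/2 < w z) + (- \<sigma>))"
        by (simp add: \<psi>_def algebra_simps)
      also have "\<dots> = 2 * \<sigma> * ?b w - real k * \<sigma>"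
        using \<sigma> by (subst max_weight_add_const) (simp add: max_weight_cmult)
      finally show ?thesis .
    qed
    then have "(\<integral>w. ?g w \<partial>?N) = 2 * \<sigma> * (\<integral>w. ?b w \<partial>?N) - real k * \<sigma>"
      using int_b by (simp add: NJ.P.prob_space)
    also have "\<dots> \<le> 2 * \<sigma> * (real k / 2 + sqrt K) - real k * \<sigma>"
      using b \<sigma> by (intro diff_right_mono mult_left_mono) auto
    also have "\<dots> = 2 * \<sigma> * sqrt K" by (simp add: algebra_simps)
    finally show ?thesis .
  qed
  finally have "\<beta> * (\<integral>w. ?f w \<partial>?M) \<le>
      \<beta> * (2 * \<sigma> * sqrt K) + ln (real (card P)) + real k * (20 * (\<beta> * R) ^ 3)"
    using \<beta> by (simp add: mult_left_mono)
  also have "\<dots> = \<beta> * (2 * \<sigma> * sqrt K + ln (real (card P)) / \<beta> + real k * (20 * \<beta>\<^sup>2 * R ^ 3))"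
    using \<beta> by (simp add: distrib_left power_mult_distrib power2_eq_square power3_eq_cube)
  finally show ?thesis using \<beta> by (simp only: mult_le_cancel_left_pos)
qed

end

section \<open>Moments and tails\<close>

text \<open>The square of \<open>Y = \<integral> 1{x < Y} dx\<close> is a double integral, and
  \<open>P (max x y < Y) \<le> sqrt (P (x < Y)) * sqrt (P (y < Y))\<close>.\<close>

lemma (in prob_space) nn_integral_square_le:
  fixes Y :: "'a \<Rightarrow> real"
  assumes Y [measurable]: "Y \<in> borel_measurable M" and nonneg: "\<And>t. 0 \<le> Y t"
  shows "(\<integral>\<^sup>+t. ennreal ((Y t)\<^sup>2) \<partial>M) \<le>
    (\<integral>\<^sup>+x. indicator {0..} x * ennreal (sqrt (prob {t\<in>space M. x < Y t})) \<partial>lborel)\<^sup>2"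
proof -
  interpret L: pair_sigma_finite lborel M ..
  define g where "g x t = (indicator {0..} x * of_bool (x < Y t) :: ennreal)" for x t
  have g_meas [measurable]: "(\<lambda>(x, t). g x t) \<in> borel_measurable (lborel \<Otimes>\<^sub>M M)"
    unfolding g_def of_bool_def by measurable
  have g_layers: "ennreal (Y t) = (\<integral>\<^sup>+x. g x t \<partial>lborel)" for t
  proof -
    have "(\<integral>\<^sup>+x. g x t \<partial>lborel) = (\<integral>\<^sup>+x. indicator {0..<Y t} x \<partial>lborel)"
      by (intro nn_integral_cong) (auto simp: g_def indicator_def)
    then show ?thesis using nonneg[of t] by simp
  qed
  let ?s = "\<lambda>x. indicator {0..} x * ennreal (sqrt (prob {t\<in>space M. x < Y t}))"
  have s_meas [measurable]: "?s \<in> borel_measurable borel"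
  proof -
    have "mono (\<lambda>x. - prob {t\<in>space M. x < Y t})"
      by (intro monoI) (auto intro!: finite_measure_mono)
    from borel_measurable_mono[OF this]
    have [measurable]: "(\<lambda>x. prob {t\<in>space M. x < Y t}) \<in> borel_measurable borel"
      unfolding borel_measurable_uminus_eq .
    show ?thesis by measurable
  qed
  have pair: "(\<integral>\<^sup>+t. g x t * g y t \<partial>M) \<le> ?s x * ?s y" for x y
  proof -
    let ?A = "\<lambda>x. {t\<in>space M. x < Y t}"
    have "(\<integral>\<^sup>+t. g x t * g y t \<partial>M) = (\<integral>\<^sup>+t. (indicator {0..} x * indicator {0..} y) * indicator (?A (max x y)) t \<partial>M)"
      by (intro nn_integral_cong) (auto simp: g_def indicator_def)
    also have "\<dots> = (indicator {0..} x * indicator {0..} y) * ennreal (prob (?A (max x y)))"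
      by (subst nn_integral_cmult_indicator) (auto simp: emeasure_eq_measure)
    also have "\<dots> \<le> (indicator {0..} x * indicator {0..} y) * (ennreal (sqrt (prob (?A x))) * ennreal (sqrt (prob (?A y))))"
    proof (intro mult_left_mono)
      have "prob (?A (max x y)) = sqrt (prob (?A (max x y))) * sqrt (prob (?A (max x y)))" by simp
      also have "\<dots> \<le> sqrt (prob (?A x)) * sqrt (prob (?A y))"
        by (intro mult_mono real_sqrt_le_mono finite_measure_mono) auto
      finally show "ennreal (prob (?A (max x y))) \<le> ennreal (sqrt (prob (?A x))) * ennreal (sqrt (prob (?A y)))"
        by (simp add: ennreal_leI flip: ennreal_mult)
    qed simp
    finally show ?thesis by (simp add: ac_simps)
  qed
  have "(\<integral>\<^sup>+t. ennreal ((Y t)\<^sup>2) \<partial>M) = (\<integral>\<^sup>+t. \<integral>\<^sup>+x. g x t * ennreal (Y t) \<partial>lborel \<partial>M)"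
  proof (intro nn_integral_cong)
    fix t
    have "(\<integral>\<^sup>+x. g x t * ennreal (Y t) \<partial>lborel) = ennreal (Y t) * ennreal (Y t)"
      unfolding g_def of_bool_def by (subst nn_integral_multc) (auto simp: g_layers[of t] g_def of_bool_def)
    then show "ennreal ((Y t)\<^sup>2) = (\<integral>\<^sup>+x. g x t * ennreal (Y t) \<partial>lborel)"
      using nonneg[of t] by (simp add: power2_eq_square ennreal_mult)
  qed
  also have "\<dots> = (\<integral>\<^sup>+x. \<integral>\<^sup>+t. g x t * ennreal (Y t) \<partial>M \<partial>lborel)"
    by (rule L.Fubini') measurable
  also have "\<dots> \<le> (\<integral>\<^sup>+x. \<integral>\<^sup>+y. ?s x * ?s y \<partial>lborel \<partial>lborel)"
  proof (intro nn_integral_mono)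
    fix x
    have [measurable]: "g x \<in> borel_measurable M" unfolding g_def of_bool_def by measurable
    have "(\<integral>\<^sup>+t. g x t * ennreal (Y t) \<partial>M) = (\<integral>\<^sup>+t. \<integral>\<^sup>+y. g x t * g y t \<partial>lborel \<partial>M)"
    proof (intro nn_integral_cong)
      fix t
      show "g x t * ennreal (Y t) = (\<integral>\<^sup>+y. g x t * g y t \<partial>lborel)"
        unfolding g_layers by (rule nn_integral_cmult[symmetric]) (simp add: g_def of_bool_def)
    qed
    also have "\<dots> = (\<integral>\<^sup>+y. \<integral>\<^sup>+t. g x t * g y t \<partial>M \<partial>lborel)"
      by (rule L.Fubini') measurable
    also have "\<dots> \<le> (\<integral>\<^sup>+y. ?s x * ?s y \<partial>lborel)"
      by (intro nn_integral_mono pair)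
    finally show "(\<integral>\<^sup>+t. g x t * ennreal (Y t) \<partial>M) \<le> (\<integral>\<^sup>+y. ?s x * ?s y \<partial>lborel)" .
  qed
  also have "\<dots> = (\<integral>\<^sup>+x. ?s x * (\<integral>\<^sup>+y. ?s y \<partial>lborel) \<partial>lborel)"
    by (intro nn_integral_cong nn_integral_cmult) simp
  also have "\<dots> = (\<integral>\<^sup>+x. ?s x \<partial>lborel) * (\<integral>\<^sup>+y. ?s y \<partial>lborel)"
    by (rule nn_integral_multc) simp
  finally show ?thesis by (simp add: power2_eq_square)
qed

section \<open>Consequences of the square-root tail condition\<close>

definition root_integral :: "real measure \<Rightarrow> ennreal" where
  "root_integral Q = (\<integral>\<^sup>+x\<in>{..0}. ennreal (cdf Q x powr (1/2)) \<partial>lborel) +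
     (\<integral>\<^sup>+x\<in>{0..}. ennreal ((1 - cdf Q x) powr (1/2)) \<partial>lborel)"

context real_distribution begin

lemma root_integral_upper: "(\<integral>\<^sup>+x. indicator {0..} x * ennreal (sqrt (measure M {x<..})) \<partial>lborel) \<le> root_integral M"
  and root_integral_lower: "(\<integral>\<^sup>+x. indicator {0..} x * ennreal (sqrt (cdf M (- x))) \<partial>lborel) \<le> root_integral M"
proof -
  have "(\<integral>\<^sup>+x. indicator {0..} x * ennreal (sqrt (measure M {x<..})) \<partial>lborel) =
      (\<integral>\<^sup>+x\<in>{0..}. ennreal ((1 - cdf M x) powr (1/2)) \<partial>lborel)"
    by (intro nn_integral_cong) (simp add: one_minus_cdf powr_half_sqrt mult.commute)
  then show "(\<integral>\<^sup>+x. indicator {0..} x * ennreal (sqrt (measure M {x<..})) \<partial>lborel) \<le> root_integral M"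
    by (simp add: root_integral_def)
  have "(\<integral>\<^sup>+x\<in>{..0}. ennreal (cdf M x powr (1/2)) \<partial>lborel) =
     (\<integral>\<^sup>+x. ennreal (cdf M (- x) powr (1/2)) * indicator {..0} (- x) \<partial>lborel)"
    by (subst nn_integral_real_affine[where c="-1" and t=0]) auto
  also have "\<dots> = (\<integral>\<^sup>+x. indicator {0..} x * ennreal (sqrt (cdf M (- x))) \<partial>lborel)"
    by (intro nn_integral_cong) (auto simp: powr_half_sqrt cdf_nonneg indicator_def)
  finally show "(\<integral>\<^sup>+x. indicator {0..} x * ennreal (sqrt (cdf M (- x))) \<partial>lborel) \<le> root_integral M"
    by (simp add: root_integral_def)
qed

text \<open>The tail condition controls the second moments of the positive and of the negative part.
  Hence the variances are genuine and not default values of a non-integrable function.\<close>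

lemma square_integrable:
  assumes "root_integral M < \<infinity>"
  shows "integrable M (\<lambda>t. t\<^sup>2)"
proof -
  let ?I = "\<lambda>f. \<integral>\<^sup>+x. indicator {0..} x * ennreal (sqrt (f x)) \<partial>lborel"
  let ?E = "\<lambda>f. \<integral>\<^sup>+t. ennreal ((f t)\<^sup>2) \<partial>M"
  let ?pos = "\<lambda>t::real. max 0 t" and ?neg = "\<lambda>t::real. max 0 (- t)"
  have "?E ?pos \<le>
      (?I (\<lambda>x. prob {t\<in>space M. x < ?pos t}))\<^sup>2"
    by (rule nn_integral_square_le) auto
  also have "(?I (\<lambda>x. prob {t\<in>space M. x < ?pos t})) =
      (\<integral>\<^sup>+x. indicator {0..} x * ennreal (sqrt (measure M {x<..})) \<partial>lborel)"
  proof (intro nn_integral_cong)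
    fix x :: real
    have "{t\<in>space M. x < ?pos t} = {x<..}" if "0 \<le> x" using that by auto
    then show "indicator {0..} x * ennreal (sqrt (prob {t\<in>space M. x < ?pos t})) =
      indicator {0..} x * ennreal (sqrt (measure M {x<..}))" by (cases "0 \<le> x") auto
  qed
  also have "\<dots>\<^sup>2 \<le> (root_integral M)\<^sup>2" by (intro power_mono root_integral_upper) simp
  finally have pos: "?E ?pos \<le> (root_integral M)\<^sup>2" .
  have "?E ?neg \<le>
      (?I (\<lambda>x. prob {t\<in>space M. x < ?neg t}))\<^sup>2"
    by (rule nn_integral_square_le) auto
  also have "(?I (\<lambda>x. prob {t\<in>space M. x < ?neg t})) \<le>
      (\<integral>\<^sup>+x. indicator {0..} x * ennreal (sqrt (cdf M (- x))) \<partial>lborel)"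
  proof (intro nn_integral_mono)
    fix x :: real
    show "indicator {0..} x * ennreal (sqrt (prob {t\<in>space M. x < ?neg t})) \<le>
      indicator {0..} x * ennreal (sqrt (cdf M (- x)))"
    proof (cases "0 \<le> x")
      case True
      then have "prob {t\<in>space M. x < ?neg t} \<le> cdf M (- x)"
        unfolding cdf_def by (intro finite_measure_mono) auto
      then show ?thesis by (intro mult_left_mono ennreal_leI real_sqrt_le_mono) auto
    qed auto
  qed
  then have "(?I (\<lambda>x. prob {t\<in>space M. x < ?neg t}))\<^sup>2 \<le> (root_integral M)\<^sup>2"
    using root_integral_lower by (intro power_mono) auto
  finally have neg: "?E ?neg \<le> (root_integral M)\<^sup>2" .
  have "(\<integral>\<^sup>+t. ennreal (t\<^sup>2) \<partial>M) = (\<integral>\<^sup>+t. ennreal ((?pos t)\<^sup>2) + ennreal ((?neg t)\<^sup>2) \<partial>M)"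
    by (intro nn_integral_cong) (auto simp: max_def)
  also have "\<dots> = ?E ?pos + ?E ?neg"
    by (intro nn_integral_add) auto
  also have "\<dots> \<le> (root_integral M)\<^sup>2 + (root_integral M)\<^sup>2" using pos neg by (rule add_mono)
  also have "\<dots> < \<infinity>" using assms by (simp add: power2_eq_square ennreal_mult_less_top)
  finally show ?thesis by (intro integrableI_nonneg) auto
qed

lemma integrable_id:
  assumes "root_integral M < \<infinity>"
  shows "integrable M (\<lambda>t. t)"
  by (rule square_integrable_imp_integrable[OF _ square_integrable[OF assms]]) simp

end

lemma tail_nn_integral_small:
  fixes f :: "real \<Rightarrow> ennreal"
  assumes [measurable]: "f \<in> borel_measurable borel" and fin: "(\<integral>\<^sup>+x. f x \<partial>lborel) < \<infinity>" and d: "d > 0"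
  shows "\<forall>\<^sub>F B in at_top. (\<integral>\<^sup>+x. indicator {B..} x * f x \<partial>lborel) \<le> ennreal d"
proof -
  let ?I = "\<lambda>B. \<integral>\<^sup>+x. indicator {B..} x * f x \<partial>lborel"
  have "(\<lambda>n. ?I (real n)) \<longlonglongrightarrow> (\<integral>\<^sup>+x. 0 \<partial>(lborel :: real measure))"
  proof (rule nn_integral_dominated_convergence[where w=f])
    show "AE x in lborel. (\<lambda>n. indicator {real n..} x * f x) \<longlonglongrightarrow> 0"
    proof (rule AE_I2)
      fix x
      have "\<forall>\<^sub>F n in sequentially. x < real n"
        using filterlim_real_sequentially by (simp add: filterlim_at_top_dense)
      then have "\<forall>\<^sub>F n in sequentially. indicator {real n..} x * f x = 0"
        by eventually_elim simp
      then show "(\<lambda>n. indicator {real n..} x * f x) \<longlonglongrightarrow> 0" by (rule tendsto_eventually)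
    qed
  qed (use fin in \<open>auto simp: indicator_def\<close>)
  then have "\<forall>\<^sub>F n in sequentially. ?I (real n) < ennreal d"
    using d by (intro order_tendstoD(2)) auto
  then obtain n where n: "?I (real n) < ennreal d"
    by (auto simp: eventually_sequentially)
  show ?thesis
  proof (rule eventually_mono[OF eventually_ge_at_top[of "real n"]])
    fix B assume "real n \<le> B"
    then have "?I B \<le> ?I (real n)"
      by (intro nn_integral_mono mult_right_mono) (auto simp: indicator_def)
    then show "?I B \<le> ennreal d" using n by simp
  qed
qed

text \<open>Far to the right, \<open>sqrt (p (1 - p))\<close> is at most the root of the upper tail;
  far to the left, at most the root of the lower tail. \<open>N\<close> is quantified inside, so
  \<open>B\<close> can be fixed before the outer cut \<open>N\<close> tends to infinity.\<close>

lemma (in real_distribution) spread_small: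
  assumes fin: "root_integral M < \<infinity>" and d: "d > 0"
  shows "\<forall>\<^sub>F B in at_top. \<forall>N. spread M B N \<le> ennreal d \<and> spread M (- N) (- B) \<le> ennreal d"
proof -
  let ?u = "\<lambda>x. indicator {0..} x * ennreal (sqrt (measure M {x<..}))"
  let ?l = "\<lambda>x. indicator {0..} x * ennreal (sqrt (cdf M (- x)))"
  have "\<forall>\<^sub>F B in at_top. (\<integral>\<^sup>+x. indicator {B..} x * ?u x \<partial>lborel) \<le> ennreal d"
    using root_integral_upper fin by (intro tail_nn_integral_small d) auto
  moreover have "\<forall>\<^sub>F B in at_top. (\<integral>\<^sup>+x. indicator {B..} x * ?l x \<partial>lborel) \<le> ennreal d"
    using root_integral_lower fin by (intro tail_nn_integral_small d) auto
  ultimately show ?thesis using eventually_ge_at_top[of 0]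
  proof eventually_elim
    case (elim B)
    show ?case
    proof (intro allI conjI)
      fix N
      have "spread M B N \<le> (\<integral>\<^sup>+x. indicator {B..} x * ?u x \<partial>lborel)"
        unfolding spread_def
      proof (intro nn_integral_mono)
        fix x
        have "sqrt (measure M {x<..} * (1 - measure M {x<..})) \<le> sqrt (measure M {x<..})"
          by (intro real_sqrt_le_mono) (simp add: mult_left_le)
        then show "indicator {B..N} x * ennreal (sqrt (measure M {x<..} * (1 - measure M {x<..}))) \<le> indicator {B..} x * ?u x"
          using elim(3) by (auto simp: indicator_def ennreal_leI)
      qed
      then show "spread M B N \<le> ennreal d" using elim(1) by simp
      have "spread M (- N) (- B) = (\<integral>\<^sup>+x. indicator {- N..- B} (- x) *
          ennreal (sqrt (measure M {- x<..} * (1 - measure M {- x<..}))) \<partial>lborel)"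
        unfolding spread_def by (subst nn_integral_real_affine[where c="-1" and t=0]) auto
      also have "\<dots> \<le> (\<integral>\<^sup>+x. indicator {B..} x * ?l x \<partial>lborel)"
      proof (intro nn_integral_mono)
        fix x
        have "1 - measure M {- x<..} = cdf M (- x)" using one_minus_cdf[of "- x"] by simp
        moreover have "measure M {- x<..} * cdf M (- x) \<le> cdf M (- x)"
          by (simp add: mult_left_le_one_le cdf_nonneg)
        ultimately have "sqrt (measure M {- x<..} * (1 - measure M {- x<..})) \<le> sqrt (cdf M (- x))" by simp
        then show "indicator {- N..- B} (- x) * ennreal (sqrt (measure M {- x<..} * (1 - measure M {- x<..}))) \<le>
            indicator {B..} x * ?l x"
          using elim(3) by (auto simp: indicator_def ennreal_leI)
      qed
      finally show "spread M (- N) (- B) \<le> ennreal d" using elim(2) by simp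
    qed
  qed
qed

text \<open>The mean minimises the mean squared deviation, so the centre may be moved to the clipped
  value of the original mean; clipping is 1-Lipschitz.\<close>

lemma (in real_distribution) clip_variance_le:
  assumes sq: "integrable M (\<lambda>t. t\<^sup>2)" and ab: "a \<le> b"
  shows "(\<integral>t. (clip a b t - (\<integral>t. clip a b t \<partial>M))\<^sup>2 \<partial>M) \<le> dist_variance M"
proof -
  define m where "m = (\<integral>t. t \<partial>M)"
  define e where "e = (\<integral>t. clip a b t \<partial>M)"
  have int_id: "integrable M (\<lambda>t. t)" by (rule square_integrable_imp_integrable[OF _ sq]) simp
  note int_clip = integrable_clip[OF ab]
  have int_clip2: "integrable M (\<lambda>t. (clip a b t)\<^sup>2)"
    using clip_bounds[OF ab] by (intro integrable_const_bound[of _ "(b - a)\<^sup>2"]) (auto intro!: power_mono)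
  have expand: "(\<integral>t. (clip a b t - c)\<^sup>2 \<partial>M) = (\<integral>t. (clip a b t)\<^sup>2 \<partial>M) - 2 * c * e + c\<^sup>2" for c
    using int_clip int_clip2 prob_space by (simp add: power2_diff e_def mult.commute mult.left_commute)
  have "(\<integral>t. (clip a b t - e)\<^sup>2 \<partial>M) \<le> (\<integral>t. (clip a b t - clip a b m)\<^sup>2 \<partial>M)"
    using zero_le_power2[of "e - clip a b m"] unfolding expand by (simp add: power2_eq_square algebra_simps)
  also have "\<dots> \<le> (\<integral>t. (t - m)\<^sup>2 \<partial>M)"
  proof (rule integral_mono)
    show "integrable M (\<lambda>t. (clip a b t - clip a b m)\<^sup>2)"
      unfolding power2_diff using int_clip int_clip2 by auto
    show "integrable M (\<lambda>t. (t - m)\<^sup>2)"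
      unfolding power2_diff using int_id sq by auto
    fix t
    have "\<bar>clip a b t - clip a b m\<bar> \<le> \<bar>t - m\<bar>" by (auto simp: clip_def min_def max_def)
    then show "(clip a b t - clip a b m)\<^sup>2 \<le> (t - m)\<^sup>2" by (simp add: abs_le_square_iff)
  qed
  finally show ?thesis unfolding e_def m_def dist_variance_def .
qed

lemma (in real_distribution) excess_tendsto_0:
  assumes "integrable M (\<lambda>t. t)"
  shows "((\<lambda>n. \<integral>t. max 0 (\<bar>t\<bar> - real n) \<partial>M) \<longlongrightarrow> 0) sequentially"
proof -
  have "(\<lambda>n. \<integral>t. max 0 (\<bar>t\<bar> - real n) \<partial>M) \<longlonglongrightarrow> (\<integral>t. 0 \<partial>M)"
  proof (rule integral_dominated_convergence[where w="\<lambda>t. \<bar>t\<bar>"])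
    show "AE t in M. (\<lambda>n. max 0 (\<bar>t\<bar> - real n)) \<longlonglongrightarrow> 0"
    proof (rule AE_I2)
      fix t
      have "\<forall>\<^sub>F n in sequentially. \<bar>t\<bar> < real n"
        using filterlim_real_sequentially by (simp add: filterlim_at_top_dense)
      then have "\<forall>\<^sub>F n in sequentially. max 0 (\<bar>t\<bar> - real n) = 0" by eventually_elim simp
      then show "(\<lambda>n. max 0 (\<bar>t\<bar> - real n)) \<longlonglongrightarrow> 0" by (rule tendsto_eventually)
    qed
    show "integrable M (\<lambda>t. \<bar>t\<bar>)" using assms by (rule integrable_abs)
    show "AE t in M. norm (max 0 (\<bar>t\<bar> - real n)) \<le> \<bar>t\<bar>" for n by (intro AE_I2) simp
  qed simp_all
  then show ?thesis by simp
qed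

section \<open>Bounds for a fixed environment\<close>

text \<open>A core on \<open>[-B, B]\<close>, two shoulders reaching to \<open>N\<close>, and a
  remainder. The subtracted constants undo the normalisation of \<open>clip\<close>, so that each
  piece vanishes at 0.\<close>

lemma clip_decomposition:
  assumes "0 \<le> B" "B \<le> N"
  shows "t = (clip (- B) B t - B) + (clip (- N) (- B) t - (N - B)) + clip B N t + (t - max (- N) (min N t))"
    and "\<bar>t - max (- N) (min N t)\<bar> = max 0 (\<bar>t\<bar> - N)"
proof -
  consider "t \<le> - N" | "- N < t" "t \<le> - B" | "- B < t" "t \<le> B" | "B < t" "t \<le> N" | "N < t" by linarith
  note cs = this
  from cs show "t = (clip (- B) B t - B) + (clip (- N) (- B) t - (N - B)) + clip B N t + (t - max (- N) (min N t))"
    by cases (use assms in \<open>simp_all add: clip_def\<close>)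
  from cs show "\<bar>t - max (- N) (min N t)\<bar> = max 0 (\<bar>t\<bar> - N)"
    by cases (use assms in simp_all)
qed

text \<open>The remainder is estimated by its sum over all of \<open>J\<close>, far more than one
  path collects; but \<open>J\<close> stays fixed while \<open>n\<close> tends to infinity, so
  nothing of it survives.\<close>

lemma le_of_excess_bound:
  fixes v :: "'i \<Rightarrow> real measure"
  assumes J: "finite J" and v: "\<And>z. real_distribution (v z)" "\<And>z. integrable (v z) (\<lambda>t. t)"
    and le: "\<And>n. B \<le> real n \<Longrightarrow> E \<le> A + (\<Sum>z\<in>J. 2 * (\<integral>t. max 0 (\<bar>t\<bar> - real n) \<partial>v z))"
  shows "E \<le> A"
proof (rule tendsto_lowerbound)
  let ?S = "\<lambda>n. \<Sum>z\<in>J. 2 * (\<integral>t. max 0 (\<bar>t\<bar> - real n) \<partial>v z)"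
  have "(\<lambda>n. A + ?S n) \<longlonglongrightarrow> A + (\<Sum>z\<in>J. 2 * 0)"
    by (intro tendsto_intros real_distribution.excess_tendsto_0 v)
  then show "(\<lambda>n. A + ?S n) \<longlonglongrightarrow> A" by simp
  have "\<forall>\<^sub>F n in sequentially. B \<le> real n"
    using filterlim_real_sequentially by (simp add: filterlim_at_top)
  then show "\<forall>\<^sub>F n in sequentially. E \<le> A + ?S n"
    by eventually_elim (rule le)
qed simp

text \<open>\<open>B\<close> separates the core, handled by replacement, from the shoulders, handled
  by layers; \<open>d\<close> bounds the spread of every shoulder, whatever the outer cut
  \<open>N\<close>.\<close>

locale tame_distributions =
  fixes V :: "real measure set" and B d :: real
  assumes finite_V: "finite V" and V_dist: "\<And>Q. Q \<in> V \<Longrightarrow> real_distribution Q"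
    and V_root: "\<And>Q. Q \<in> V \<Longrightarrow> root_integral Q < \<infinity>"
    and B_nonneg: "0 \<le> B" and d_nonneg: "0 \<le> d"
    and spread_le: "\<And>Q N. Q \<in> V \<Longrightarrow> spread Q B N \<le> ennreal d" "\<And>Q N. Q \<in> V \<Longrightarrow> spread Q (- N) (- B) \<le> ennreal d"
begin

lemma V_integrable: "Q \<in> V \<Longrightarrow> integrable Q (\<lambda>t. t)"
  using V_dist V_root by (intro real_distribution.integrable_id)

lemma V_square_integrable: "Q \<in> V \<Longrightarrow> integrable Q (\<lambda>t. t\<^sup>2)"
  using V_dist V_root by (intro real_distribution.square_integrable)

lemma V_excess_integrable: "Q \<in> V \<Longrightarrow> integrable Q (\<lambda>t. max 0 (\<bar>t\<bar> - N))"
proof -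
  assume Q: "Q \<in> V"
  interpret real_distribution Q using V_dist[OF Q] .
  show ?thesis using V_integrable[OF Q] by (intro Bochner_Integration.integrable_max) auto
qed

text \<open>The core gets the sharp constant from \<open>bounded_field_bound\<close> with
  \<open>R = 2 * B\<close>, since a value of \<open>clip (- B) B\<close> differs from its mean by at
  most \<open>2 * B\<close>. Each of the two shoulders costs
  \<open>card V * (2 * sqrt K * d)\<close>.\<close>

lemma horizontal_bound:
  assumes "column_family J P k" and v: "\<And>z. v z \<in> V"
    and \<mu>: "\<And>Q. Q \<in> V \<Longrightarrow> dist_mean Q \<le> \<mu>" and var: "\<And>Q. Q \<in> V \<Longrightarrow> dist_variance Q \<le> \<sigma>\<^sup>2"
    and \<sigma>: "0 \<le> \<sigma>" "\<sigma> \<le> 2 * B" and \<beta>: "0 < \<beta>" "\<beta> * (2 * B) \<le> 1 / 4"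
    and cb: "coin_bound J P k K" "0 \<le> K"
  shows "(\<integral>w. max_weight P w \<partial>PiM J v) \<le> real k * \<mu> +
    (2 * \<sigma> * sqrt K + ln (real (card P)) / \<beta> + real k * (20 * \<beta>\<^sup>2 * (2 * B) ^ 3)) + 4 * real (card V) * sqrt K * d"
proof -
  interpret column_family J P k by fact
  have vd: "real_distribution (v z)" for z using V_dist v by auto
  have vp: "prob_space (v z)" for z using vd by (simp add: real_distribution_def)
  interpret product_prob_space v J using vp by (simp add: product_prob_spaceI)
  note comp = integrable_PiM_component[of v, OF vp]
  let ?D = "\<lambda>a b z t. clip a b t - (\<integral>t. clip a b t \<partial>v z)"
  let ?mw = "\<lambda>a b w. max_weight P (\<lambda>z. ?D a b z (w z))"
  let ?c = "\<lambda>a b z. \<integral>t. clip a b t \<partial>v z"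
  have int_D: "integrable (v z) (?D a b z)" if "a \<le> b" for a b z
    using real_distribution.integrable_clip[OF vd that] finite_measure.integrable_const[OF prob_space.finite_measure[OF vp]]
    by (intro Bochner_Integration.integrable_diff) auto
  let ?J = "PiM J v"
  show ?thesis
  proof (rule le_of_excess_bound[OF finite_J vd V_integrable[OF v]])
    fix n assume n: "B \<le> real n"
    define N where "N = real n"
    have BN: "B \<le> N" "- N \<le> - B" "- B \<le> B" using n B_nonneg by (auto simp: N_def)
    let ?r = "\<lambda>t. t - max (- N) (min N t)" and ?e = "\<lambda>t. max 0 (\<bar>t\<bar> - N)"
    let ?ee = "\<lambda>z. \<integral>t. ?e t \<partial>v z"
    have int_e: "integrable (v z) ?e" for z by (rule V_excess_integrable[OF v])
    have int_r: "integrable (v z) ?r" for z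
    proof (rule Bochner_Integration.integrable_bound[OF int_e])
      interpret real_distribution "v z" by (rule vd)
      show "?r \<in> borel_measurable (v z)" by measurable
      show "AE t in v z. norm (?r t) \<le> norm (?e t)"
        using clip_decomposition(2)[OF B_nonneg BN(1)] by (intro AE_I2) simp
    qed
    \<comment> \<open>Centring the pieces removes their means. Up to the remainder these add up to
      the mean of \<open>v z\<close>, so they are paid for by \<open>\<mu>\<close> and the mean
      excess.\<close>
    have dec: "t \<le> ?D (- B) B z t + ?D (- N) (- B) z t + ?D B N z t + (?e t + ?ee z) + \<mu>" for t z
    proof -
      interpret real_distribution "v z" by (rule vd)
      note i = real_distribution.integrable_clip[OF vd BN(1), of z] real_distribution.integrable_clip[OF vd BN(2), of z] real_distribution.integrable_clip[OF vd BN(3), of z] int_r[of z]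
      have "(\<integral>t. t \<partial>v z) = (\<integral>t. (clip (- B) B t - B) + (clip (- N) (- B) t - (N - B)) + clip B N t + ?r t \<partial>v z)"
        by (rule Bochner_Integration.integral_cong[OF refl clip_decomposition(1)[OF B_nonneg BN(1)]])
      also have "\<dots> = (?c (- B) B z - B) + (?c (- N) (- B) z - (N - B)) + ?c B N z + (\<integral>t. ?r t \<partial>v z)"
        using i prob_space.prob_space[OF vp[of z]] by simp
      finally have "(?c (- B) B z - B) + (?c (- N) (- B) z - (N - B)) + ?c B N z + (\<integral>t. ?r t \<partial>v z) \<le> \<mu>"
        using \<mu>[OF v[of z]] by (simp add: dist_mean_def)
      moreover have "?r t \<le> ?e t" using clip_decomposition(2)[OF B_nonneg BN(1), of t] by linarith
      moreover have "- (\<integral>t. ?r t \<partial>v z) \<le> ?ee z"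
      proof -
        have "- (\<integral>t. ?r t \<partial>v z) = (\<integral>t. - ?r t \<partial>v z)" by (rule integral_minus[symmetric])
        also have "\<dots> \<le> ?ee z"
        proof (rule integral_mono[OF integrable_minus[OF int_r] int_e])
          fix t show "- ?r t \<le> ?e t" using clip_decomposition(2)[OF B_nonneg BN(1), of t] by linarith
        qed
        finally show ?thesis .
      qed
      ultimately show ?thesis using clip_decomposition(1)[OF B_nonneg BN(1), of t] by linarith
    qed
    let ?S = "\<lambda>w. (\<Sum>z\<in>J. ?e (w z) + ?ee z)"
    have pw: "max_weight P w \<le> ?mw (- B) B w + ?mw (- N) (- B) w +
        ?mw B N w + ?S w + real k * \<mu>" for w
    proof -
      have "max_weight P w \<le> max_weight P (\<lambda>z. ?D (- B) B z (w z) + ?D (- N) (- B) z (w z) + ?D B N z (w z) +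
          (?e (w z) + ?ee z) + \<mu>)"
        by (intro max_weight_mono dec)
      also have "\<dots> \<le> ?mw (- B) B w + ?mw (- N) (- B) w +
        ?mw B N w + max_weight P (\<lambda>z. ?e (w z) + ?ee z) + real k * \<mu>"
        unfolding max_weight_add_const
        by (intro add_right_mono order_trans[OF max_weight_add])+ simp
      also have "max_weight P (\<lambda>z. ?e (w z) + ?ee z) \<le> ?S w"
      proof -
        have "0 \<le> ?ee z" for z by (intro integral_nonneg_AE) auto
        then have "(\<Sum>z\<in>J. \<bar>?e (w z) + ?ee z\<bar>) = ?S w"
          by (intro sum.cong refl abs_of_nonneg add_nonneg_nonneg) auto
        then show ?thesis using abs_max_weight_le[of "\<lambda>z. ?e (w z) + ?ee z"] by linarith
      qed
      finally show ?thesis by simp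
    qed
    have I1: "integrable (?J) (\<lambda>w. ?mw a b w)" if "a \<le> b" for a b
      by (intro integrable_max_weight comp int_D that)
    have I2: "integrable (?J) ?S"
      by (intro Bochner_Integration.integrable_sum Bochner_Integration.integrable_add comp int_e P.integrable_const)
    have "(\<integral>w. max_weight P w \<partial>?J) \<le> (\<integral>w. ?mw (- B) B w + ?mw (- N) (- B) w +
        ?mw B N w + ?S w + real k * \<mu> \<partial>?J)"
      using pw by (intro integral_mono integrable_max_weight comp V_integrable[OF v] Bochner_Integration.integrable_add
          I1 I2 BN P.integrable_const)
    also have "\<dots> = (\<integral>w. ?mw (- B) B w \<partial>?J) + (\<integral>w. ?mw (- N) (- B) w \<partial>?J) +
        (\<integral>w. ?mw B N w \<partial>?J) + (\<integral>w. ?S w \<partial>?J) + real k * \<mu>"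
      using I1[OF BN(1)] I1[OF BN(2)] I1[OF BN(3)] I2 P.prob_space
      by (simp del: Bochner_Integration.integral_sum Bochner_Integration.integral_diff)
    also have "(\<integral>w. ?S w \<partial>?J) = (\<Sum>z\<in>J. 2 * ?ee z)"
      using integral_PiM_component[of v, OF vp _ int_e] comp[OF _ int_e] P.prob_space
      by (subst Bochner_Integration.integral_sum) (auto intro!: sum.cong)
    also have "(\<integral>w. ?mw (- N) (- B) w \<partial>?J) \<le> real (card V) * (2 * sqrt K * d)"
      by (rule centred_clip_bound[OF vd v finite_V V_dist cb BN(2) spread_le(2) d_nonneg])
    also have "(\<integral>w. ?mw B N w \<partial>?J) \<le> real (card V) * (2 * sqrt K * d)"
      by (rule centred_clip_bound[OF vd v finite_V V_dist cb BN(1) spread_le(1) d_nonneg])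
    also have "(\<integral>w. ?mw (- B) B w \<partial>?J) \<le>
        2 * \<sigma> * sqrt K + ln (real (card P)) / \<beta> + real k * (20 * \<beta>\<^sup>2 * (2 * B) ^ 3)"
    proof (rule bounded_field_bound[OF vp _ _ _ _ \<sigma> \<beta> cb])
      fix z
      interpret real_distribution "v z" by (rule vd)
      show "?D (- B) B z \<in> borel_measurable (v z)" using int_D[OF BN(3)] by auto
      show "(\<integral>t. ?D (- B) B z t \<partial>v z) = 0"
        using real_distribution.integrable_clip[OF vd BN(3)] prob_space.prob_space[OF vp[of z]] by simp
      show "(\<integral>t. (?D (- B) B z t)\<^sup>2 \<partial>v z) \<le> \<sigma>\<^sup>2"
        using clip_variance_le[OF V_square_integrable[OF v] BN(3)] var[OF v] by (rule order_trans)
      have c: "0 \<le> clip (- B) B t" "clip (- B) B t \<le> 2 * B" for t using clip_bounds[OF BN(3), of t] by auto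
      have "0 \<le> ?c (- B) B z" "?c (- B) B z \<le> 2 * B"
        using c by (auto intro!: prob_space.integral_le_const[OF vp[of z]] real_distribution.integrable_clip[OF vd BN(3)])
      then show "\<bar>?D (- B) B z t\<bar> \<le> 2 * B" for t using c[of t] by linarith
    qed
    finally show "(\<integral>w. max_weight P w \<partial>?J) \<le> real k * \<mu> +
      (2 * \<sigma> * sqrt K + ln (real (card P)) / \<beta> + real k * (20 * \<beta>\<^sup>2 * (2 * B) ^ 3)) + 4 * real (card V) * sqrt K * d +
      (\<Sum>z\<in>J. 2 * (\<integral>t. max 0 (\<bar>t\<bar> - real n) \<partial>v z))"
      unfolding N_def by (simp add: algebra_simps)
  qed
qed

text \<open>Here \<open>k\<close> will be the number of rows, a small fraction of the number of
  columns. No sharp constant is needed: the core is bounded pointwise by \<open>B\<close>, the lower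
  tail is dropped, and only the upper shoulder uses layers.\<close>

lemma vertical_bound:
  assumes "path_family J P k" and v: "\<And>z. v z \<in> V"
    and \<mu>: "\<And>Q. Q \<in> V \<Longrightarrow> (\<integral>t. \<bar>t\<bar> \<partial>Q) \<le> \<mu>"
    and cb: "coin_bound J P k K" "0 \<le> K"
  shows "(\<integral>w. max_weight P w \<partial>PiM J v) \<le> real k * (B + \<mu>) + 2 * real (card V) * sqrt K * d"
proof -
  interpret path_family J P k by fact
  have vd: "real_distribution (v z)" for z using V_dist v by auto
  have vp: "prob_space (v z)" for z using vd by (simp add: real_distribution_def)
  interpret product_prob_space v J using vp by (simp add: product_prob_spaceI)
  note comp = integrable_PiM_component[of v, OF vp]
  show ?thesis
  proof (rule le_of_excess_bound[OF finite_J vd V_integrable[OF v]])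
    fix n assume n: "B \<le> real n"
    define N where "N = real n"
    have BN: "B \<le> N" using n by (simp add: N_def)
    let ?D = "\<lambda>z t. clip B N t - (\<integral>t. clip B N t \<partial>v z)"
    let ?e = "\<lambda>t. max 0 (\<bar>t\<bar> - N)"
    have int_e: "integrable (v z) ?e" for z by (rule V_excess_integrable[OF v])
    have int_D: "integrable (v z) (?D z)" for z
      using real_distribution.integrable_clip[OF vd BN] finite_measure.integrable_const[OF prob_space.finite_measure[OF vp]]
      by (intro Bochner_Integration.integrable_diff) auto
    \<comment> \<open>One excess would do; the factor 2 matches the form of
      \<open>le_of_excess_bound\<close>.\<close>
    have dec: "t \<le> ?D z t + 2 * ?e t + (B + \<mu>)" for t z
    proof -
      have "clip B N t \<le> \<bar>t\<bar>" for t using B_nonneg BN by (auto simp: clip_def)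
      then have "(\<integral>t. clip B N t \<partial>v z) \<le> (\<integral>t. \<bar>t\<bar> \<partial>v z)"
        using real_distribution.integrable_clip[OF vd BN] V_integrable[OF v] by (intro integral_mono) auto
      also have "\<dots> \<le> \<mu>" by (rule \<mu>[OF v])
      finally have 1: "(\<integral>t. clip B N t \<partial>v z) \<le> \<mu>" .
      have 2: "t \<le> B + clip B N t + ?e t" using B_nonneg BN by (auto simp: clip_def)
      have 3: "0 \<le> ?e t" by simp
      have lin: "t \<le> c - E + 2 * e + (B + \<mu>)" if "E \<le> \<mu>" "t \<le> B + c + e" "0 \<le> e" for E c e
        using that by linarith
      show ?thesis by (rule lin[OF 1 2 3])
    qed
    have pw: "max_weight P w \<le> max_weight P (\<lambda>z. ?D z (w z)) + (\<Sum>z\<in>J. 2 * ?e (w z)) + real k * (B + \<mu>)" for w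
    proof -
      have "max_weight P w \<le> max_weight P (\<lambda>z. ?D z (w z) + 2 * ?e (w z) + (B + \<mu>))"
        by (intro max_weight_mono dec)
      also have "\<dots> \<le> max_weight P (\<lambda>z. ?D z (w z)) + max_weight P (\<lambda>z. 2 * ?e (w z)) + real k * (B + \<mu>)"
        unfolding max_weight_add_const by (intro add_right_mono max_weight_add)
      also have "max_weight P (\<lambda>z. 2 * ?e (w z)) \<le> (\<Sum>z\<in>J. 2 * ?e (w z))"
        using abs_max_weight_le[of "\<lambda>z. 2 * ?e (w z)"] by (simp add: abs_mult)
      finally show ?thesis by simp
    qed
    have I1: "integrable (PiM J v) (\<lambda>w. max_weight P (\<lambda>z. ?D z (w z)))"
      by (intro integrable_max_weight comp int_D)
    have I2: "integrable (PiM J v) (\<lambda>w. \<Sum>z\<in>J. 2 * ?e (w z))"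
      by (intro Bochner_Integration.integrable_sum integrable_mult_right comp int_e)
    have "(\<integral>w. max_weight P w \<partial>PiM J v) \<le>
        (\<integral>w. max_weight P (\<lambda>z. ?D z (w z)) + (\<Sum>z\<in>J. 2 * ?e (w z)) + real k * (B + \<mu>) \<partial>PiM J v)"
      using pw by (intro integral_mono integrable_max_weight comp V_integrable[OF v] Bochner_Integration.integrable_add
          I1 I2 P.integrable_const)
    also have "\<dots> = (\<integral>w. max_weight P (\<lambda>z. ?D z (w z)) \<partial>PiM J v) + (\<integral>w. (\<Sum>z\<in>J. 2 * ?e (w z)) \<partial>PiM J v) + real k * (B + \<mu>)"
      using I1 I2 P.prob_space by (simp del: Bochner_Integration.integral_sum Bochner_Integration.integral_diff)
    also have "(\<integral>w. (\<Sum>z\<in>J. 2 * ?e (w z)) \<partial>PiM J v) = (\<Sum>z\<in>J. 2 * (\<integral>t. ?e t \<partial>v z))"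
      using integral_PiM_component[of v, OF vp _ int_e] comp[OF _ int_e]
      by (subst Bochner_Integration.integral_sum) (auto intro!: sum.cong)
    also have "(\<integral>w. max_weight P (\<lambda>z. ?D z (w z)) \<partial>PiM J v) \<le> real (card V) * (2 * sqrt K * d)"
      by (rule centred_clip_bound[OF vd v finite_V V_dist cb BN spread_le(1) d_nonneg])
    finally show "(\<integral>w. max_weight P w \<partial>PiM J v) \<le> real k * (B + \<mu>) + 2 * real (card V) * sqrt K * d +
      (\<Sum>z\<in>J. 2 * (\<integral>t. max 0 (\<bar>t\<bar> - real n) \<partial>v z))"
      unfolding N_def by (simp add: algebra_simps)
  qed
qed

end

section \<open>Conditioning on the environment\<close>

lemma real_distribution_eqI_rat:
  assumes "real_distribution Q" "real_distribution R" and eq: "\<And>q. q \<in> \<rat> \<Longrightarrow> cdf Q q = cdf R q"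
  shows "Q = R"
proof -
  have le: "cdf Q x \<le> cdf R x" if Q: "real_distribution Q" and R: "real_distribution R"
    and eq: "\<And>q. q \<in> \<rat> \<Longrightarrow> cdf Q q = cdf R q" for Q R x
  proof (rule ccontr)
    interpret Q: real_distribution Q by fact
    interpret R: real_distribution R by fact
    assume "\<not> cdf Q x \<le> cdf R x"
    then have "cdf R x < cdf Q x" by simp
    moreover have "(cdf R \<longlongrightarrow> cdf R x) (at_right x)"
      using R.cdf_is_right_cont[of x] by (simp add: continuous_within)
    ultimately have "\<forall>\<^sub>F y in at_right x. cdf R y < cdf Q x" by (rule order_tendstoD(2)[rotated])
    then obtain b where b: "b > x" "\<And>y. x < y \<Longrightarrow> y < b \<Longrightarrow> cdf R y < cdf Q x"
      by (auto simp: eventually_at_right_field)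
    obtain q where q: "q \<in> \<rat>" "x < q" "q < b" using Rats_dense_in_real[OF b(1)] by auto
    have "cdf Q x \<le> cdf Q q" using q by (intro Q.cdf_nondecreasing) simp
    then show False using b(2)[OF q(2,3)] eq[OF q(1)] by simp
  qed
  have "cdf Q = cdf R" using le[OF assms(1,2) eq] le[OF assms(2,1) eq[symmetric]] by (intro ext antisym)
  then show ?thesis using assms by (intro cdf_unique)
qed

text \<open>A distribution is determined by its distribution function at the rationals, hence by
  countably many measurable conditions.\<close>

lemma singleton_prob_algebra:
  assumes "real_distribution Q"
  shows "{Q} \<in> sets (prob_algebra borel)"
proof -
  interpret Q: real_distribution Q by fact
  have dist: "real_distribution \<nu>" if "\<nu> \<in> space (prob_algebra borel)" for \<nu>
    using that by (intro real_distribution.intro) (auto simp: space_prob_algebra real_distribution_axioms_def)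
  have "{\<nu>\<in>space (prob_algebra borel). \<forall>r::rat. measure \<nu> {..(of_rat r :: real)} = measure Q {..(of_rat r :: real)}} \<in> sets (prob_algebra borel)"
  proof (rule sets.sets_Collect_countable_All)
    fix r :: rat
    have "(\<lambda>\<nu>. emeasure \<nu> {..of_rat r :: real}) \<in> borel_measurable (prob_algebra borel)"
      unfolding prob_algebra_def by (intro measurable_restrict_space1 measurable_emeasure_subprob_algebra) simp
    then have "(\<lambda>\<nu>. measure \<nu> {..of_rat r :: real}) \<in> borel_measurable (prob_algebra borel)"
      unfolding measure_def by (rule borel_measurable_enn2real)
    from measurable_sets[OF this, of "{measure Q {..(of_rat r :: real)}}"]
    show "{\<nu>\<in>space (prob_algebra borel). measure \<nu> {..(of_rat r :: real)} = measure Q {..(of_rat r :: real)}} \<in> sets (prob_algebra borel)"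
      by (simp add: vimage_def Int_def conj_commute)
  qed
  also have "{\<nu>\<in>space (prob_algebra borel). \<forall>r::rat. measure \<nu> {..(of_rat r :: real)} = measure Q {..(of_rat r :: real)}} = {Q}"
  proof -
    have "\<nu> = Q" if "\<nu> \<in> space (prob_algebra borel)" "\<forall>r::rat. measure \<nu> {..(of_rat r :: real)} = measure Q {..(of_rat r :: real)}" for \<nu>
      using that by (intro real_distribution_eqI_rat dist assms) (auto simp: cdf_def elim!: Rats_cases)
    moreover have "Q \<in> space (prob_algebra borel)"
      using Q.prob_space_axioms by (simp add: space_prob_algebra)
    ultimately show ?thesis by auto
  qed
  finally show ?thesis .
qed

context weights_in_environment begin

lemma environment_event:
  assumes v: "\<And>j. real_distribution (v j)"
  shows "{\<omega>\<in>space M. \<forall>j\<le>m. F j \<omega> = v j} \<in> events"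
proof -
  have "{\<omega>\<in>space M. F j \<omega> = v j} \<in> events" for j
  proof -
    have "{\<omega>\<in>space M. F j \<omega> = v j} = F j -` {v j} \<inter> space M" by auto
    then show ?thesis using measurable_sets[OF environment_measurable singleton_prob_algebra[OF v]] by simp
  qed
  then have "{\<omega>\<in>space M. \<forall>j\<in>{..m}. F j \<omega> = v j} \<in> events"
    by (rule sets.sets_Collect_finite_All) simp
  then show ?thesis by (simp only: Ball_def atMost_iff)
qed

text \<open>The environment is prescribed only in rows up to \<open>m\<close>, which include all
  rows of \<open>J\<close>. For such an event of positive probability conditioning is division, and
  the quenched law gives agreement on rectangles.\<close>

lemma conditional_law:
  assumes v: "\<And>j. real_distribution (v j)" and J: "finite J" "\<And>z. z \<in> J \<Longrightarrow> snd z \<le> m"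
  defines "C \<equiv> {\<omega>\<in>space M. \<forall>j\<le>m. F j \<omega> = v j}"
  assumes pos: "prob C \<noteq> 0"
  shows "distr (uniform_measure M C) (PiM J (\<lambda>_. borel)) (\<lambda>\<omega>. \<lambda>z\<in>J. X z \<omega>) = PiM J (\<lambda>z. v (snd z))"
proof -
  have sing: "{v j} \<in> sets (prob_algebra borel)" for j by (rule singleton_prob_algebra[OF v])
  have C: "C \<in> events" unfolding C_def by (rule environment_event[OF v])
  let ?U = "uniform_measure M C" and ?X = "\<lambda>\<omega>. \<lambda>z\<in>J. X z \<omega>" and ?B = "PiM J (\<lambda>_. borel)"
    and ?S = "\<Pi>\<^sub>M j\<in>UNIV. prob_algebra borel"
  interpret U: prob_space "uniform_measure M C"
    using pos by (intro prob_space_uniform_measure) (auto simp: emeasure_eq_measure)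
  have vp: "prob_space (v j)" and vs: "sets (v j) = sets borel" for j
    using v[of j] by (auto simp: real_distribution_def real_distribution_axioms_def)
  interpret PP: product_prob_space "\<lambda>z. v (snd z)" J using vp by (simp add: product_prob_spaceI)
  have Xvec: "?X \<in> ?U \<rightarrow>\<^sub>M ?B"
    using weights_measurable by (intro measurable_restrict) (simp add: measurable_def)
  show "distr ?U ?B ?X = PiM J (\<lambda>z. v (snd z))"
  proof (rule PP.PiM_eqI[OF J(1)])
    show "sets (distr ?U ?B ?X) = sets (PiM J (\<lambda>z. v (snd z)))"
      by (simp add: vs cong: sets_PiM_cong)
    fix A assume "\<And>z. z \<in> J \<Longrightarrow> A z \<in> sets (v (snd z))"
    then have A: "z \<in> J \<Longrightarrow> A z \<in> sets borel" for z by (simp add: vs)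
    let ?p = "\<Prod>z\<in>J. measure (v (snd z)) (A z)"
    let ?D = "{f \<in> space ?S. \<forall>j\<in>{..m}. f j = v j}"
    have D: "?D \<in> sets ?S"
    proof (rule sets.sets_Collect_finite_All)
      fix j
      have "{f \<in> space ?S. f j = v j} =
          (\<lambda>f. f j) -` {v j} \<inter> space ?S" by auto
      also have "\<dots> \<in> sets ?S"
        using sing by (intro measurable_sets[OF measurable_component_singleton]) auto
      finally show "{f \<in> space ?S. f j = v j} \<in> sets ?S" .
    qed simp
    have inD: "(\<lambda>j. F j \<omega>) \<in> ?D \<longleftrightarrow> \<omega> \<in> C" if "\<omega> \<in> space M" for \<omega>
      using that measurable_space[OF environment_measurable that] by (auto simp: C_def space_PiM)
    let ?E = "{\<omega>\<in>space M. \<forall>z\<in>J. X z \<omega> \<in> A z}"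
    have E: "?E \<in> events"
      using weights_measurable A J(1) by (intro sets.sets_Collect_finite_All) (auto intro: measurable_sets_Collect simp: pred_def)
    have "prob (C \<inter> ?E) = prob {\<omega> \<in> space M. (\<lambda>j. F j \<omega>) \<in> ?D \<and> (\<forall>z\<in>J. X z \<omega> \<in> A z)}"
      using inD by (intro arg_cong[where f=prob]) (auto simp: C_def)
    also have "\<dots> = expectation (\<lambda>\<omega>. indicator ?D (\<lambda>j. F j \<omega>) * (\<Prod>z\<in>J. measure (F (snd z) \<omega>) (A z)))"
      by (rule quenched_law[OF D J(1) A])
    also have "\<dots> = expectation (\<lambda>\<omega>. indicator C \<omega> * ?p)"
    proof (intro Bochner_Integration.integral_cong refl)
      fix \<omega> assume \<omega>: "\<omega> \<in> space M"
      have ind: "indicator ?D (\<lambda>j. F j \<omega>) = (indicator C \<omega> :: real)"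
        unfolding indicator_def inD[OF \<omega>] ..
      have "(\<Prod>z\<in>J. measure (F (snd z) \<omega>) (A z)) = ?p" if "\<omega> \<in> C"
        using J(2) that by (intro prod.cong refl) (auto simp: C_def)
      then show "indicator ?D (\<lambda>j. F j \<omega>) * (\<Prod>z\<in>J. measure (F (snd z) \<omega>) (A z)) =
         indicator C \<omega> * ?p"
        unfolding ind by (cases "\<omega> \<in> C") simp_all
    qed
    also have "\<dots> = prob C * ?p" using C by simp
    finally have *: "prob (C \<inter> ?E) = prob C * ?p" .
    have "emeasure (distr ?U ?B ?X) (Pi\<^sub>E J A) =
        emeasure ?U ?E"
      using A J(1) by (subst emeasure_distr[OF Xvec]) (auto intro!: sets_PiM_I_finite arg_cong[where f="emeasure ?U"] simp: PiE_iff)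
    also have "\<dots> = ennreal (measure ?U ?E)" by (rule U.emeasure_eq_measure)
    also have "measure ?U ?E = prob (C \<inter> ?E) / prob C"
      using C E pos by (intro measure_uniform_measure) (auto simp: emeasure_eq_measure)
    also have "\<dots> = ?p" unfolding * using pos by simp
    also have "ennreal \<dots> = (\<Prod>z\<in>J. ennreal (measure (v (snd z)) (A z)))" by (simp add: prod_ennreal)
    also have "\<dots> = (\<Prod>z\<in>J. emeasure (v (snd z)) (A z))"
      using finite_measure.emeasure_eq_measure[OF prob_space.finite_measure[OF vp]] by simp
    finally show "emeasure (distr ?U ?B ?X) (Pi\<^sub>E J A) =
        (\<Prod>z\<in>J. emeasure (v (snd z)) (A z))" .
  qed
qed

text \<open>With finitely many laws, the environment in rows \<open>0..m\<close> has finitely many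
  values up to a null set. The expectation is then a convex combination of quenched ones, and a
  uniform quenched bound carries over.\<close>

lemma expectation_le_quenched:
  fixes h :: "(nat \<times> nat \<Rightarrow> real) \<Rightarrow> real"
  assumes V: "finite V" "V \<noteq> {}" "\<And>Q. Q \<in> V \<Longrightarrow> real_distribution Q" and F: "\<And>j. AE \<omega> in M. F j \<omega> \<in> V"
    and J: "finite J" "\<And>z. z \<in> J \<Longrightarrow> snd z \<le> m" and h: "h \<in> borel_measurable (PiM J (\<lambda>_. borel))"
    and int: "\<And>v. (\<And>j. v j \<in> V) \<Longrightarrow> integrable (PiM J (\<lambda>z. v (snd z))) h"
    and le: "\<And>v. (\<And>j. v j \<in> V) \<Longrightarrow> (\<integral>w. h w \<partial>PiM J (\<lambda>z. v (snd z))) \<le> A"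
  shows "integrable M (\<lambda>\<omega>. h (\<lambda>z\<in>J. X z \<omega>))" and "expectation (\<lambda>\<omega>. h (\<lambda>z\<in>J. X z \<omega>)) \<le> A"
proof -
  obtain Q0 where Q0: "Q0 \<in> V" using V(2) by auto
  define VV where "VV = Pi\<^sub>E {..m} (\<lambda>_. V)"
  have fin: "finite VV" unfolding VV_def using V(1) by (intro finite_PiE) auto
  \<comment> \<open>Rows above \<open>m\<close> receive the filler \<open>Q0\<close>, so that every
    configuration in \<open>VV\<close> extends to an environment with values in
    \<open>V\<close>.\<close>
  define ext where "ext u j = (if j \<le> m then u j else Q0)" for u :: "nat \<Rightarrow> real measure" and j
  have ext: "ext u j \<in> V" if "u \<in> VV" for u j using that Q0 by (auto simp: ext_def VV_def PiE_iff)
  define C where "C u = {\<omega>\<in>space M. \<forall>j\<le>m. F j \<omega> = ext u j}" for u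
  let ?h = "\<lambda>\<omega>. h (\<lambda>z\<in>J. X z \<omega>)"
  let ?I = "\<lambda>u \<omega>. indicator (C u) \<omega> * ?h \<omega>" and ?U = "\<lambda>u. uniform_measure M (C u)"
  have Xvec: "(\<lambda>\<omega>. \<lambda>z\<in>J. X z \<omega>) \<in> M \<rightarrow>\<^sub>M PiM J (\<lambda>_. borel)"
    using weights_measurable by (intro measurable_restrict)
  have hX: "?h \<in> borel_measurable M" by (rule measurable_compose[OF Xvec h])
  have C: "C u \<in> events" if "u \<in> VV" for u
    unfolding C_def by (rule environment_event[OF V(3)[OF ext[OF that]]])
  have part: "AE \<omega> in M. (\<Sum>u\<in>VV. indicator (C u) \<omega>) = (1::real)"
  proof -
    have "AE \<omega> in M. \<forall>j\<in>{..m}. F j \<omega> \<in> V" using F by (intro AE_finite_allI) auto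
    then show ?thesis using AE_space
    proof eventually_elim
      case (elim \<omega>)
      define u0 where "u0 = (\<lambda>j\<in>{..m}. F j \<omega>)"
      have u0: "u0 \<in> VV" using elim by (auto simp: u0_def VV_def)
      have "\<omega> \<in> C u \<longleftrightarrow> u = u0" if "u \<in> VV" for u
      proof
        assume u: "\<omega> \<in> C u"
        show "u = u0"
        proof
          fix j show "u j = u0 j"
            using u that by (cases "j \<le> m") (auto simp: C_def ext_def u0_def VV_def PiE_def extensional_def)
        qed
      next
        assume "u = u0"
        then show "\<omega> \<in> C u" using elim by (auto simp: C_def ext_def u0_def)
      qed
      then have "(\<Sum>u\<in>VV. indicator (C u) \<omega>) = (\<Sum>u\<in>VV. if u = u0 then 1 else (0::real))"
        by (intro sum.cong) (auto simp: indicator_def)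
      then show ?case using fin u0 by simp
    qed
  qed
  have cond: "integrable M (\<lambda>\<omega>. ?I u \<omega>) \<and>
      expectation (\<lambda>\<omega>. ?I u \<omega>) \<le> prob (C u) * A" if u: "u \<in> VV" for u
  \<comment> \<open>A configuration of probability zero cannot be conditioned on, but it contributes
    nothing.\<close>
  proof (cases "prob (C u) = 0")
    case True
    then have "C u \<in> null_sets M" using C[OF u] by (auto simp: null_sets_def emeasure_eq_measure)
    from AE_not_in[OF this] have ae: "AE \<omega> in M. ?I u \<omega> = 0"
      by eventually_elim simp
    have "integrable M (\<lambda>\<omega>. ?I u \<omega>) \<longleftrightarrow> integrable M (\<lambda>_. 0 :: real)"
      using ae hX C[OF u] by (intro integrable_cong_AE) auto
    moreover have "expectation (\<lambda>\<omega>. ?I u \<omega>) = expectation (\<lambda>_. 0)"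
      using ae hX C[OF u] by (intro integral_cong_AE) auto
    ultimately show ?thesis using True by simp
  next
    case False
    have dens: "?U u = density M (\<lambda>\<omega>. ennreal (indicator (C u) \<omega> / prob (C u)))"
      unfolding uniform_measure_def
      using False by (intro arg_cong[where f="density M"] ext)
        (auto simp: emeasure_eq_measure divide_ennreal[symmetric] indicator_def zero_less_measure_iff)
    have XU: "(\<lambda>\<omega>. \<lambda>z\<in>J. X z \<omega>) \<in> ?U u \<rightarrow>\<^sub>M PiM J (\<lambda>_. borel)"
      using Xvec by (simp add: measurable_def)
    have eq: "distr (?U u) (PiM J (\<lambda>_. borel)) (\<lambda>\<omega>. \<lambda>z\<in>J. X z \<omega>) = PiM J (\<lambda>z. ext u (snd z))"
      unfolding C_def
      by (rule conditional_law[of "ext u" J m]) (use V(3)[OF ext[OF u]] J False in \<open>auto simp: C_def\<close>)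
    have "integrable (?U u) ?h"
      by (rule integrable_distr[OF XU]) (simp add: eq int ext[OF u])
    then have i: "integrable M (\<lambda>\<omega>. (indicator (C u) \<omega> / prob (C u)) * ?h \<omega>)"
      unfolding dens using hX C[OF u] by (subst (asm) integrable_density) auto
    have "(\<integral>w. h w \<partial>PiM J (\<lambda>z. ext u (snd z))) = (\<integral>\<omega>. ?h \<omega> \<partial>?U u)"
      unfolding eq[symmetric] by (rule integral_distr[OF XU h])
    also have "\<dots> = expectation (\<lambda>\<omega>. (indicator (C u) \<omega> / prob (C u)) * ?h \<omega>)"
      unfolding dens using hX C[OF u] by (subst integral_density) auto
    finally have le': "expectation (\<lambda>\<omega>. (indicator (C u) \<omega> / prob (C u)) * ?h \<omega>) \<le> A"
      using le[of "ext u"] ext[OF u] by simp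
    have e: "?I u \<omega> = prob (C u) * ((indicator (C u) \<omega> / prob (C u)) * ?h \<omega>)" for \<omega>
      using False by simp
    show ?thesis unfolding e using i le'
      by (auto intro!: mult_left_mono simp del: times_divide_eq_left times_divide_eq_right)
  qed
  have AEh: "AE \<omega> in M. ?h \<omega> = (\<Sum>u\<in>VV. ?I u \<omega>)"
    using part by eventually_elim (simp add: sum_distrib_right[symmetric])
  have int_sum: "integrable M (\<lambda>\<omega>. \<Sum>u\<in>VV. ?I u \<omega>)"
    using cond by auto
  show "integrable M ?h"
    using int_sum AEh hX integrable_cong_AE[of ?h M "\<lambda>\<omega>. \<Sum>u\<in>VV. ?I u \<omega>"] by auto
  have "expectation ?h = expectation (\<lambda>\<omega>. \<Sum>u\<in>VV. ?I u \<omega>)"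
    using int_sum AEh hX by (intro integral_cong_AE) auto
  also have "\<dots> = (\<Sum>u\<in>VV. expectation (\<lambda>\<omega>. ?I u \<omega>))"
    using cond by (intro Bochner_Integration.integral_sum) auto
  also have "\<dots> \<le> (\<Sum>u\<in>VV. prob (C u) * A)" using cond by (intro sum_mono) auto
  also have "\<dots> = A"
  proof -
    have "(\<Sum>u\<in>VV. prob (C u)) = (\<Sum>u\<in>VV. expectation (indicator (C u)))"
      using C by (intro sum.cong) auto
    also have "\<dots> = expectation (\<lambda>\<omega>. \<Sum>u\<in>VV. indicator (C u) \<omega>)"
      using C by (intro Bochner_Integration.integral_sum[symmetric]) (auto simp: emeasure_eq_measure)
    also have "\<dots> = expectation (\<lambda>_. 1)"
      using part C by (intro integral_cong_AE) auto
    finally show ?thesis by (simp add: sum_distrib_right[symmetric] prob_space)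
  qed
  finally show "expectation ?h \<le> A" .
qed

end

section \<open>Asymptotics\<close>

lemma hpaths_SucI: "\<pi> \<in> hpaths k l' \<Longrightarrow> l' \<le> l \<Longrightarrow> insert (k, l') \<pi> \<in> hpaths (Suc k) l"
  by auto

lemma vpaths_SucI: "\<pi> \<in> vpaths l k' \<Longrightarrow> k' \<le> k \<Longrightarrow> insert (k', l) \<pi> \<in> vpaths (Suc l) k"
proof -
  assume "\<pi> \<in> vpaths l k'" and k: "k' \<le> k"
  then obtain \<pi>' where \<pi>': "\<pi>' \<in> hpaths l k'" "\<pi> = prod.swap ` \<pi>'" by (auto simp: vpaths_def)
  have "insert (k', l) \<pi> = prod.swap ` insert (l, k') \<pi>'" using \<pi>'(2) by simp
  then show ?thesis unfolding vpaths_def using hpaths_SucI[OF \<pi>'(1) k] by blast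
qed

lemma vpaths_mono: "k \<le> k' \<Longrightarrow> vpaths l k \<subseteq> vpaths l k'"
  unfolding vpaths_def by (intro image_mono hpaths_mono)

text \<open>Split the points of a path according to whether the next step is horizontal or vertical.\<close>

lemma lattice_path_split:
  assumes "\<pi> \<in> lattice_paths n m"
  shows "\<exists>h\<in>hpaths n m. \<exists>u\<in>vpaths m n. (\<Sum>z\<leftarrow>butlast \<pi>. w z) = sum w h + (sum w u :: real)"
  using assms
proof (induction \<pi> arbitrary: n m rule: rev_induct)
  case Nil
  then show ?case by (simp add: lattice_paths_def)
next
  case (snoc x \<pi>)
  show ?case
  proof (cases "\<pi> = []")
    case True
    then have "n = 0" "m = 0" using snoc.prems by (auto simp: lattice_paths_def)
    then show ?thesis using True by (simp add: vpaths_def)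
  next
    case False
    obtain a b where ab: "last \<pi> = (a, b)" by (cases "last \<pi>")
    have x: "x = (n, m)" and step: "lattice_step (a, b) (n, m)" and \<pi>: "\<pi> \<in> lattice_paths a b"
      using snoc.prems False ab by (auto simp: lattice_paths_def successively_append_iff)
    obtain h u where hu: "h \<in> hpaths a b" "u \<in> vpaths b a" "(\<Sum>z\<leftarrow>butlast \<pi>. w z) = sum w h + sum w u"
      using snoc.IH[OF \<pi>] by blast
    have "(\<Sum>z\<leftarrow>butlast (\<pi> @ [x]). w z) = (\<Sum>z\<leftarrow>butlast \<pi> @ [last \<pi>]. w z)" using False by simp
    also have "\<dots> = sum w h + sum w u + w (a, b)" by (simp add: hu ab)
    finally have total: "(\<Sum>z\<leftarrow>butlast (\<pi> @ [x]). w z) = sum w h + sum w u + w (a, b)" .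
    have h: "finite h" "(a, b) \<notin> h" using hpaths_subset[OF hu(1)] by (auto intro: finite_subset)
    have u: "finite u" "(a, b) \<notin> u" using vpaths_subset[OF hu(2)] by (auto intro: finite_subset)
    \<comment> \<open>The new last point is excluded from the sum, so what is added is its
      predecessor \<open>(a, b)\<close>: it joins \<open>h\<close> as the point of column
      \<open>a\<close>, or \<open>u\<close> as the point of row \<open>b\<close>.\<close>
    from step consider "n = Suc a" "m = b" | "n = a" "m = Suc b" by (auto simp: lattice_step_def)
    then show ?thesis
    proof cases
      case 1
      then have "insert (a, b) h \<in> hpaths n m" "u \<in> vpaths m n"
        using hu hpaths_SucI[OF hu(1) order.refl] vpaths_mono[of a "Suc a" b] by auto
      moreover have "sum w (insert (a, b) h) + sum w u = sum w h + sum w u + w (a, b)" using h by simp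
      ultimately show ?thesis using total by metis
    next
      case 2
      then have "h \<in> hpaths n m" "insert (a, b) u \<in> vpaths m n"
        using hu vpaths_SucI[OF hu(2) order.refl] hpaths_mono[of b "Suc b" a] by auto
      moreover have "sum w h + sum w (insert (a, b) u) = sum w h + sum w u + w (a, b)" using u by simp
      ultimately show ?thesis using total by metis
    qed
  qed
qed

lemma last_passage_le:
  "last_passage w n m \<le> max_weight (hpaths n m) w + max_weight (vpaths m n) w"
  unfolding last_passage_def
proof (rule Max.boundedI)
  show "finite ((\<lambda>\<pi>. \<Sum>z\<leftarrow>butlast \<pi>. w z) ` lattice_paths n m)" by (intro finite_imageI finite_lattice_paths)
  show "(\<lambda>\<pi>. \<Sum>z\<leftarrow>butlast \<pi>. w z) ` lattice_paths n m \<noteq> {}" using lattice_paths_nonempty by simp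
  fix s assume "s \<in> (\<lambda>\<pi>. \<Sum>z\<leftarrow>butlast \<pi>. w z) ` lattice_paths n m"
  then obtain \<pi> where \<pi>: "\<pi> \<in> lattice_paths n m" "s = (\<Sum>z\<leftarrow>butlast \<pi>. w z)" by auto
  obtain h u where "h \<in> hpaths n m" "u \<in> vpaths m n" "s = sum w h + sum w u"
    using lattice_path_split[OF \<pi>(1), of w] \<pi>(2) by auto
  then show "s \<le> max_weight (hpaths n m) w + max_weight (vpaths m n) w"
    by (auto intro!: add_mono max_weight_ge finite_hpaths finite_vpaths)
qed

lemma column_family_hpaths: "column_family ({..<n} \<times> {..m}) (hpaths n m) n"
  by unfold_locales (simp_all add: finite_hpaths hpaths_nonempty hpaths_subset card_hpath hpaths_column Sigma_mono)

lemma path_family_vpaths: "path_family ({..n} \<times> {..<m}) (vpaths m n) m"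
  by unfold_locales (simp_all add: finite_vpaths vpaths_nonempty vpaths_subset card_vpath)

lemma ln_card_hpaths_le:
  assumes "0 < \<alpha>" "\<alpha> < 1"
  shows "ln (real (card (hpaths k l))) \<le> real l * - ln \<alpha> + real k * - ln (1 - \<alpha>)"
proof -
  have c: "0 < real (card (hpaths k l))"
    using finite_hpaths hpaths_nonempty by (simp add: card_gt_0_iff)
  have "ln (real (card (hpaths k l))) + real l * ln \<alpha> = ln (real (card (hpaths k l)) * \<alpha> ^ l)"
    using c assms by (simp add: ln_mult ln_realpow)
  also have "\<dots> \<le> ln ((1 / (1 - \<alpha>)) ^ k)"
    using c assms card_hpaths_le[OF assms, of k l] by (intro ln_mono) auto
  also have "\<dots> = real k * - ln (1 - \<alpha>)"
    using assms by (simp add: ln_realpow ln_div)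
  finally show ?thesis by simp
qed

section \<open>Passage to the limit shape\<close>

context weights_in_environment begin

text \<open>The majorant \<open>G\<close>, a sum of two maxima, carries the integrability; only a
  pointwise inequality is kept for the passage time itself.\<close>

lemma passage_expectation_bound:
  assumes V: "tame_distributions V B d" "V \<noteq> {}" and F: "\<And>j. AE \<omega> in M. F j \<omega> \<in> V"
    and \<mu>: "\<And>Q. Q \<in> V \<Longrightarrow> dist_mean Q \<le> \<mu>" and var: "\<And>Q. Q \<in> V \<Longrightarrow> dist_variance Q \<le> \<sigma>\<^sup>2"
    and \<nu>: "\<And>Q. Q \<in> V \<Longrightarrow> (\<integral>t. \<bar>t\<bar> \<partial>Q) \<le> \<nu>"
    and \<sigma>: "0 \<le> \<sigma>" "\<sigma> \<le> 2 * B" and \<beta>: "0 < \<beta>" "\<beta> * (2 * B) \<le> 1 / 4"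
  obtains G where "integrable M G" "\<And>\<omega>. last_passage (\<lambda>z. X z \<omega>) n m \<le> G \<omega>"
    "expectation G \<le> real n * \<mu> + (2 * \<sigma> * sqrt (real (n * Suc m)) + ln (real (card (hpaths n m))) / \<beta> +
        real n * (20 * \<beta>\<^sup>2 * (2 * B) ^ 3)) + 4 * real (card V) * sqrt (real (n * Suc m)) * d +
      (real m * (B + \<nu>) + 2 * real (card V) * sqrt (real (m * Suc n)) * d)"
proof -
  let ?A = "real n * \<mu> + (2 * \<sigma> * sqrt (real (n * Suc m)) + ln (real (card (hpaths n m))) / \<beta> +
        real n * (20 * \<beta>\<^sup>2 * (2 * B) ^ 3)) + 4 * real (card V) * sqrt (real (n * Suc m)) * d"
  let ?B = "real m * (B + \<nu>) + 2 * real (card V) * sqrt (real (m * Suc n)) * d"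
  let ?h = "\<lambda>\<omega>. max_weight (hpaths n m) (\<lambda>z. X z \<omega>)" and ?u = "\<lambda>\<omega>. max_weight (vpaths m n) (\<lambda>z. X z \<omega>)"
  interpret tame_distributions V B d by fact
  have single: "integrable M (\<lambda>\<omega>. max_weight P (\<lambda>z. X z \<omega>)) \<and> expectation (\<lambda>\<omega>. max_weight P (\<lambda>z. X z \<omega>)) \<le> A"
    if P: "path_family J P k" and J: "\<And>z. z \<in> J \<Longrightarrow> snd z \<le> m"
      and A: "\<And>v. (\<And>j. v j \<in> V) \<Longrightarrow> (\<integral>w. max_weight P w \<partial>PiM J (\<lambda>z. v (snd z))) \<le> A" for J P k A
  proof -
    interpret path_family J P k by fact
    have eq: "max_weight P (\<lambda>z\<in>J. X z \<omega>) = max_weight P (\<lambda>z. X z \<omega>)" for \<omega>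
      using P_subset by (intro max_weight_cong) auto
    have meas: "max_weight P \<in> borel_measurable (PiM J (\<lambda>_. borel))"
      by (rule borel_measurable_max_weight) (rule measurable_component_singleton)
    have int: "integrable (PiM J (\<lambda>z. v (snd z))) (max_weight P)" if v: "\<And>j. v j \<in> V" for v
    proof (intro integrable_max_weight integrable_PiM_component[of "\<lambda>z. v (snd z)"])
      show "prob_space (v (snd i))" for i using V_dist[OF v] by (simp add: real_distribution_def)
      show "integrable (v (snd z)) (\<lambda>t. t)" for z by (rule V_integrable[OF v])
    qed
    show ?thesis
      using expectation_le_quenched[OF finite_V V(2) V_dist F finite_J J meas int A] unfolding eq by blast
  qed
  have h: "integrable M (\<lambda>\<omega>. ?h \<omega>) \<and>
      expectation (\<lambda>\<omega>. ?h \<omega>) \<le> ?A"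
  proof (rule single[OF column_family.axioms(1)[OF column_family_hpaths[of n m]]])
    fix v :: "nat \<Rightarrow> real measure" assume v: "\<And>j. v j \<in> V"
    show "(\<integral>w. max_weight (hpaths n m) w \<partial>PiM ({..<n} \<times> {..m}) (\<lambda>z. v (snd z))) \<le> ?A"
      using v by (intro horizontal_bound column_family_hpaths \<mu> var \<sigma> \<beta> coin_bound_hpaths of_nat_0_le_iff) simp_all
  qed auto
  have u: "integrable M (\<lambda>\<omega>. ?u \<omega>) \<and>
      expectation (\<lambda>\<omega>. ?u \<omega>) \<le>
      ?B"
  proof (rule single[OF path_family_vpaths[of n m]])
    fix v :: "nat \<Rightarrow> real measure" assume v: "\<And>j. v j \<in> V"
    show "(\<integral>w. max_weight (vpaths m n) w \<partial>PiM ({..n} \<times> {..<m}) (\<lambda>z. v (snd z))) \<le>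
      ?B"
      using v by (intro vertical_bound path_family_vpaths \<nu> coin_bound_vpaths of_nat_0_le_iff) simp_all
  qed auto
  show ?thesis
  proof (rule that)
    show "integrable M (\<lambda>\<omega>. ?h \<omega> + ?u \<omega>)"
      using h u by auto
    show "last_passage (\<lambda>z. X z \<omega>) n m \<le> ?h \<omega> + ?u \<omega>" for \<omega>
      by (rule last_passage_le)
    show "expectation (\<lambda>\<omega>. ?h \<omega> + ?u \<omega>) \<le>
      ?A +
      ?B"
      using h u by (subst Bochner_Integration.integral_add) (auto intro: add_mono)
  qed
qed

text \<open>Since \<open>G n\<close> dominates, any shortfall of \<open>G n\<close> below
  \<open>\<Psi> x y\<close> is also a deviation of the scaled passage time. Its expectation vanishes
  by convergence in the mean, so bounds on expectations become bounds on the limit.\<close>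

lemma limit_shape_le:
  assumes lim: "is_limit_shape M X \<Psi>" and xy: "0 < x" "0 < y"
    and G: "\<And>n. integrable M (G n)" "\<And>n \<omega>. n > 0 \<Longrightarrow> scaled_passage X x y n \<omega> \<le> G n \<omega>"
    and a: "\<And>n. n > 0 \<Longrightarrow> expectation (G n) \<le> a n" "a \<longlonglongrightarrow> A"
  shows "\<Psi> x y \<le> A"
proof (rule field_le_epsilon)
  fix e :: real assume e: "0 < e"
  have "(\<lambda>n. \<integral>\<^sup>+\<omega>. ennreal \<bar>scaled_passage X x y n \<omega> - \<Psi> x y\<bar> \<partial>M) \<longlonglongrightarrow> 0"
    using lim xy by (simp add: is_limit_shape_def)
  then have "\<forall>\<^sub>F n in sequentially. (\<integral>\<^sup>+\<omega>. ennreal \<bar>scaled_passage X x y n \<omega> - \<Psi> x y\<bar> \<partial>M) < ennreal (e / 2)"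
    using e by (intro order_tendstoD(2)) auto
  moreover have "\<forall>\<^sub>F n in sequentially. a n < A + e / 2"
    using a(2) e by (intro order_tendstoD(2)) auto
  ultimately have "\<forall>\<^sub>F n in sequentially. \<Psi> x y \<le> A + e"
    using eventually_gt_at_top[of 0]
  proof eventually_elim
    case (elim n)
    let ?f = "\<lambda>\<omega>. \<Psi> x y - G n \<omega>"
    have int: "integrable M ?f" using G(1) by auto
    have int': "integrable M (\<lambda>\<omega>. max 0 (?f \<omega>))" using int by (intro Bochner_Integration.integrable_max) auto
    have "ennreal (expectation (\<lambda>\<omega>. max 0 (?f \<omega>))) = (\<integral>\<^sup>+\<omega>. ennreal (max 0 (?f \<omega>)) \<partial>M)"
      using int' by (intro nn_integral_eq_integral[symmetric]) auto
    also have "\<dots> \<le> (\<integral>\<^sup>+\<omega>. ennreal \<bar>scaled_passage X x y n \<omega> - \<Psi> x y\<bar> \<partial>M)"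
    proof (intro nn_integral_mono ennreal_leI)
      fix \<omega>
      show "max 0 (?f \<omega>) \<le> \<bar>scaled_passage X x y n \<omega> - \<Psi> x y\<bar>" using G(2)[OF elim(3), of \<omega>] by linarith
    qed
    also have "\<dots> < ennreal (e / 2)" by (rule elim(1))
    finally have "expectation (\<lambda>\<omega>. max 0 (?f \<omega>)) < e / 2" using e by (simp add: ennreal_less_iff)
    moreover have "expectation ?f \<le> expectation (\<lambda>\<omega>. max 0 (?f \<omega>))"
      using int int' by (intro integral_mono) auto
    moreover have "expectation ?f = \<Psi> x y - expectation (G n)" using G(1) prob_space by simp
    ultimately show ?case using a(1)[OF elim(3)] elim(2) by linarith
  qed
  then show "\<Psi> x y \<le> A + e" by simp
qed

text \<open>The 6 counts two horizontal shoulders and one vertical shoulder at 2 each; 160 is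
  \<open>20 * 2 ^ 3\<close>, from \<open>R = 2 * B\<close>. The entropy term is the path count with
  \<alpha> as discount per row.\<close>

lemma limit_shape_bound:
  assumes V: "tame_distributions V B d" "V \<noteq> {}" and F: "\<And>j. AE \<omega> in M. F j \<omega> \<in> V"
    and \<mu>: "\<And>Q. Q \<in> V \<Longrightarrow> dist_mean Q \<le> \<mu>" and var: "\<And>Q. Q \<in> V \<Longrightarrow> dist_variance Q \<le> \<sigma>\<^sup>2"
    and \<nu>: "\<And>Q. Q \<in> V \<Longrightarrow> (\<integral>t. \<bar>t\<bar> \<partial>Q) \<le> \<nu>" "0 \<le> \<nu>"
    and \<sigma>: "0 \<le> \<sigma>" "\<sigma> \<le> 2 * B" and \<beta>: "0 < \<beta>" "\<beta> * (2 * B) \<le> 1 / 4"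
    and lim: "is_limit_shape M X \<Psi>" and \<alpha>: "0 < \<alpha>" "\<alpha> < 1"
  shows "\<Psi> 1 \<alpha> \<le> \<mu> + (2 * \<sigma> + 6 * real (card V) * d) * sqrt \<alpha> +
    (- (\<alpha> * ln \<alpha>) - ln (1 - \<alpha>)) / \<beta> + 160 * \<beta>\<^sup>2 * B ^ 3 + \<alpha> * (B + \<nu>)"
proof -
  let ?E = "- (\<alpha> * ln \<alpha>) - ln (1 - \<alpha>)"
  interpret tame_distributions V B d by fact
  define m where "m n = nat \<lfloor>real n * \<alpha>\<rfloor>" for n
  have m_le: "real (m n) \<le> real n * \<alpha>" for n
    using \<alpha> of_int_floor_le[of "real n * \<alpha>"] by (simp add: m_def)
  define T where "T n = real n * \<mu> + (2 * \<sigma> * sqrt (real (n * Suc (m n))) + ln (real (card (hpaths n (m n)))) / \<beta> +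
        real n * (20 * \<beta>\<^sup>2 * (2 * B) ^ 3)) + 4 * real (card V) * sqrt (real (n * Suc (m n))) * d +
      (real (m n) * (B + \<nu>) + 2 * real (card V) * sqrt (real (m n * Suc n)) * d)" for n
  have "\<exists>G. integrable M G \<and> (\<forall>\<omega>. last_passage (\<lambda>z. X z \<omega>) n (m n) \<le> G \<omega>) \<and> expectation G \<le> T n" for n
    using passage_expectation_bound[OF V F \<mu> var \<nu>(1) \<sigma> \<beta>, of n "m n"] unfolding T_def by metis
  then obtain G where G: "\<And>n. integrable M (G n)" "\<And>n \<omega>. last_passage (\<lambda>z. X z \<omega>) n (m n) \<le> G n \<omega>"
    "\<And>n. expectation (G n) \<le> T n" by metis
  let ?c = "real (card V)"
  define a where "a n = \<mu> + (2 * \<sigma> + 4 * ?c * d) * sqrt (\<alpha> + 1 / real n) +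
    ?E / \<beta> + 160 * \<beta>\<^sup>2 * B ^ 3 + \<alpha> * (B + \<nu>) + 2 * ?c * d * sqrt (\<alpha> * (1 + 1 / real n))" for n
  have T_le: "T n / real n \<le> a n" if n: "n > 0" for n
  proof -
    have s1: "sqrt (real (n * Suc (m n))) \<le> real n * sqrt (\<alpha> + 1 / real n)"
    proof -
      have "real (n * Suc (m n)) \<le> real n * (real n * \<alpha> + 1)"
        unfolding of_nat_mult using m_le[of n] by (intro mult_left_mono) auto
      also have "\<dots> = (real n)\<^sup>2 * (\<alpha> + 1 / real n)"
        using n by (simp add: power2_eq_square field_simps)
      finally have "sqrt (real (n * Suc (m n))) \<le> sqrt ((real n)\<^sup>2 * (\<alpha> + 1 / real n))" by (rule real_sqrt_le_mono)
      then show ?thesis by (simp add: real_sqrt_mult)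
    qed
    have s2: "sqrt (real (m n * Suc n)) \<le> real n * sqrt (\<alpha> * (1 + 1 / real n))"
    proof -
      have "real (m n * Suc n) \<le> (real n * \<alpha>) * real (Suc n)"
        unfolding of_nat_mult using m_le[of n] by (intro mult_right_mono) auto
      also have "\<dots> = (real n)\<^sup>2 * (\<alpha> * (1 + 1 / real n))"
        using n by (simp add: power2_eq_square field_simps)
      finally have "sqrt (real (m n * Suc n)) \<le> sqrt ((real n)\<^sup>2 * (\<alpha> * (1 + 1 / real n)))" by (rule real_sqrt_le_mono)
      then show ?thesis by (simp add: real_sqrt_mult)
    qed
    have s3: "ln (real (card (hpaths n (m n)))) \<le> real n * ?E"
    proof -
      have "real (m n) * - ln \<alpha> \<le> (real n * \<alpha>) * - ln \<alpha>"
        using \<alpha> m_le[of n] by (intro mult_right_mono) auto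
      then show ?thesis using ln_card_hpaths_le[OF \<alpha>, of n "m n"] by (simp add: algebra_simps)
    qed
    have "T n \<le> real n * \<mu> + (2 * \<sigma> * (real n * sqrt (\<alpha> + 1 / real n)) + real n * ?E / \<beta> +
        real n * (20 * \<beta>\<^sup>2 * (2 * B) ^ 3)) + 4 * ?c * (real n * sqrt (\<alpha> + 1 / real n)) * d +
      ((real n * \<alpha>) * (B + \<nu>) + 2 * ?c * (real n * sqrt (\<alpha> * (1 + 1 / real n))) * d)"
      unfolding T_def
      using \<sigma> \<beta> d_nonneg B_nonneg \<nu>(2)
      by (intro add_mono mult_left_mono mult_right_mono divide_right_mono s1 s2 s3 m_le order.refl) auto
    also have "\<dots> = real n * a n"
      unfolding a_def by (simp add: algebra_simps add_divide_distrib diff_divide_distrib power_mult_distrib)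
    finally show ?thesis using n by (simp add: divide_le_eq mult.commute)
  qed
  show ?thesis
  proof (rule limit_shape_le[OF lim, where G="\<lambda>n \<omega>. G n \<omega> / real n" and a=a])
    show "integrable M (\<lambda>\<omega>. G n \<omega> / real n)" for n using G(1) by auto
    show "scaled_passage X 1 \<alpha> n \<omega> \<le> G n \<omega> / real n" for n \<omega>
      unfolding scaled_passage_def using G(2)[of \<omega> n] by (auto simp: m_def intro: divide_right_mono)
    show "expectation (\<lambda>\<omega>. G n \<omega> / real n) \<le> a n" if "n > 0" for n
    proof -
      have "expectation (\<lambda>\<omega>. G n \<omega> / real n) = expectation (G n) / real n" by simp
      also have "\<dots> \<le> T n / real n" using G(3) by (intro divide_right_mono) auto
      finally show ?thesis using T_le[OF that] by simp
    qed
    have "(\<lambda>n. 1 / real n) \<longlonglongrightarrow> 0" by (rule lim_1_over_n)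
    then have "a \<longlonglongrightarrow> \<mu> + (2 * \<sigma> + 4 * ?c * d) * sqrt (\<alpha> + 0) +
      ?E / \<beta> + 160 * \<beta>\<^sup>2 * B ^ 3 + \<alpha> * (B + \<nu>) + 2 * ?c * d * sqrt (\<alpha> * (1 + 0))"
      unfolding a_def by (intro tendsto_intros)
    then show "a \<longlonglongrightarrow> \<mu> + (2 * \<sigma> + 6 * ?c * d) * sqrt \<alpha> + ?E / \<beta> + 160 * \<beta>\<^sup>2 * B ^ 3 + \<alpha> * (B + \<nu>)"
      by (rule back_subst) (simp add: algebra_simps)
  qed (use \<alpha> in auto)
qed

text \<open>With \<open>\<beta> = \<alpha> powr (3/8)\<close> both the entropy error \<open>\<alpha> ln (1/\<alpha>) / \<beta>\<close> and the
  replacement error \<open>\<beta>\<^sup>2\<close> are \<open>o(sqrt \<alpha>)\<close>.\<close>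

lemma limit_shape_asymptotic_bound:
  assumes V: "finite V" "V \<noteq> {}" "\<And>Q. Q \<in> V \<Longrightarrow> real_distribution Q" "\<And>Q. Q \<in> V \<Longrightarrow> root_integral Q < \<infinity>"
    and F: "\<And>j. AE \<omega> in M. F j \<omega> \<in> V"
    and \<mu>: "\<And>Q. Q \<in> V \<Longrightarrow> dist_mean Q \<le> \<mu>" and var: "\<And>Q. Q \<in> V \<Longrightarrow> dist_variance Q \<le> \<sigma>\<^sup>2" "0 \<le> \<sigma>"
    and lim: "is_limit_shape M X \<Psi>" and \<eta>: "\<eta> > 0"
  shows "\<forall>\<^sub>F \<alpha> in at_right 0. \<Psi> 1 \<alpha> \<le> \<mu> + 2 * \<sigma> * sqrt \<alpha> + \<eta> * sqrt \<alpha>"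
proof -
  let ?e = "\<lambda>\<alpha>. (- (\<alpha> * ln \<alpha>) - ln (1 - \<alpha>)) / \<alpha> powr (3/8)"
  have cV: "real (card V) > 0" using V by (simp add: card_gt_0_iff)
  \<comment> \<open>Half of \<open>\<eta>\<close> pays for the three shoulders, the other half for
    the errors that are small against \<open>sqrt \<alpha>\<close>.\<close>
  define d where "d = \<eta> / (12 * real (card V))"
  have d: "d > 0" "6 * real (card V) * d = \<eta> / 2" using \<eta> cV by (auto simp: d_def)
  have "\<forall>\<^sub>F B in at_top. \<forall>Q\<in>V. \<forall>N. spread Q B N \<le> ennreal d \<and> spread Q (- N) (- B) \<le> ennreal d"
    using V d(1) by (intro eventually_ball_finite ballI real_distribution.spread_small) auto
  then have "\<forall>\<^sub>F B in at_top. (\<forall>Q\<in>V. \<forall>N. spread Q B N \<le> ennreal d \<and> spread Q (- N) (- B) \<le> ennreal d) \<and> B \<ge> max 1 \<sigma>"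
    using eventually_ge_at_top by (rule eventually_conj)
  \<comment> \<open>\<open>B\<close> above \<open>\<sigma>\<close> keeps the comparison signs within
    \<open>R = 2 * B\<close>.\<close>
  then obtain B where B: "\<And>Q N. Q \<in> V \<Longrightarrow> spread Q B N \<le> ennreal d \<and> spread Q (- N) (- B) \<le> ennreal d" "B \<ge> 1" "B \<ge> \<sigma>"
    by (auto simp: eventually_at_top_linorder)
  have tame: "tame_distributions V B d"
    using V B d(1) by (intro tame_distributions.intro) auto
  define \<nu> where "\<nu> = (\<Sum>Q\<in>V. \<integral>t. \<bar>t\<bar> \<partial>Q)"
  have \<nu>: "0 \<le> \<nu>" "(\<integral>t. \<bar>t\<bar> \<partial>Q) \<le> \<nu>" if "Q \<in> V" for Q
    unfolding \<nu>_def using V(1) that by (auto intro!: sum_nonneg member_le_sum)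
  have \<nu>0: "0 \<le> \<nu>" unfolding \<nu>_def by (intro sum_nonneg) auto
  have lim1: "((\<lambda>\<alpha>::real. ?e \<alpha> / sqrt \<alpha>) \<longlongrightarrow> 0) (at_right 0)"
    by real_asymp
  have lim2: "((\<lambda>\<alpha>::real. (\<alpha> powr (3/8))\<^sup>2 / sqrt \<alpha>) \<longlongrightarrow> 0) (at_right 0)" by real_asymp
  have lim3: "((\<lambda>\<alpha>::real. \<alpha> / sqrt \<alpha>) \<longlongrightarrow> 0) (at_right 0)" by real_asymp
  have lim4: "((\<lambda>\<alpha>::real. \<alpha> powr (3/8)) \<longlongrightarrow> 0) (at_right 0)" by real_asymp
  have "((\<lambda>\<alpha>. ?e \<alpha> / sqrt \<alpha> + 160 * B ^ 3 * ((\<alpha> powr (3/8))\<^sup>2 / sqrt \<alpha>) +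
      (B + \<nu>) * (\<alpha> / sqrt \<alpha>)) \<longlongrightarrow> 0 + 160 * B ^ 3 * 0 + (B + \<nu>) * 0) (at_right 0)"
    by (intro tendsto_intros lim1 lim2 lim3)
  then have ev1: "\<forall>\<^sub>F \<alpha> in at_right 0. ?e \<alpha> / sqrt \<alpha> +
      160 * B ^ 3 * ((\<alpha> powr (3/8))\<^sup>2 / sqrt \<alpha>) + (B + \<nu>) * (\<alpha> / sqrt \<alpha>) < \<eta> / 2"
    using \<eta> by (intro order_tendstoD(2)) auto
  have "((\<lambda>\<alpha>. \<alpha> powr (3/8) * (2 * B)) \<longlongrightarrow> 0 * (2 * B)) (at_right 0)"
    by (intro tendsto_intros lim4)
  then have ev2: "\<forall>\<^sub>F \<alpha> in at_right 0. \<alpha> powr (3/8) * (2 * B) < 1 / 4"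
    by (intro order_tendstoD(2)) auto
  have ev3: "\<forall>\<^sub>F \<alpha> in at_right (0::real). 0 < \<alpha> \<and> \<alpha> < 1"
    by (auto simp: eventually_at_right_field intro!: exI[of _ 1])
  from ev1 ev2 ev3 show ?thesis
  proof eventually_elim
    case (elim \<alpha>)
    let ?b = "\<alpha> powr (3/8)"
    have sq: "0 < sqrt \<alpha>" using elim by simp
    have "\<Psi> 1 \<alpha> \<le> \<mu> + (2 * \<sigma> + 6 * real (card V) * d) * sqrt \<alpha> +
      (- (\<alpha> * ln \<alpha>) - ln (1 - \<alpha>)) / ?b + 160 * ?b\<^sup>2 * B ^ 3 + \<alpha> * (B + \<nu>)"
      using elim B var(2) by (intro limit_shape_bound[OF tame V(2) F \<mu> var(1) \<nu>(2) \<nu>0 _ _ _ _ lim]) auto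
    also have "\<dots> = \<mu> + 2 * \<sigma> * sqrt \<alpha> + (\<eta> / 2) * sqrt \<alpha> +
      (((- (\<alpha> * ln \<alpha>) - ln (1 - \<alpha>)) / ?b) / sqrt \<alpha> + 160 * B ^ 3 * (?b\<^sup>2 / sqrt \<alpha>) + (B + \<nu>) * (\<alpha> / sqrt \<alpha>)) * sqrt \<alpha>"
    proof -
      have "(x / s + c * (y / s) + d * (z / s)) * s = x + c * y + d * z" if "s > 0" for x y z c d s :: real
        using that by (simp add: field_simps)
      from this[OF sq] show ?thesis unfolding d(2) by (simp only:) (simp add: algebra_simps)
    qed
    also have "\<dots> \<le> \<mu> + 2 * \<sigma> * sqrt \<alpha> + (\<eta> / 2) * sqrt \<alpha> + (\<eta> / 2) * sqrt \<alpha>"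
      using elim(1) sq by (intro add_left_mono mult_right_mono) auto
    finally show ?case by (simp add: distrib_right[symmetric])
  qed
qed

end

theorem theorem4p2p4:
  fixes M :: "'w measure"
    and F :: "nat \<Rightarrow> 'w \<Rightarrow> real measure"
    and X :: "nat \<times> nat \<Rightarrow> 'w \<Rightarrow> real"
    and \<Psi> :: "real \<Rightarrow> real \<Rightarrow> real"
    and H :: "nat \<Rightarrow> real measure"
    and L :: nat
  assumes "weights_in_environment M F X"
    and "iid_environment M F"
    and "\<And>l. l \<in> {1..L} \<Longrightarrow> real_distribution (H l)"
    and "\<And>j. AE \<omega> in M. F j \<omega> \<in> H ` {1..L}"
    and "\<And>l. l \<in> {1..L} \<Longrightarrow>
           (\<integral>\<^sup>+x\<in>{..0}. ennreal (cdf (H l) x powr (1/2)) \<partial>lborel) +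
           (\<integral>\<^sup>+x\<in>{0..}. ennreal ((1 - cdf (H l) x) powr (1/2)) \<partial>lborel) < \<infinity>"
    and "is_limit_shape M X \<Psi>"
  defines "\<mu>s \<equiv> Max ((\<lambda>l. dist_mean (H l)) ` {1..L})"
    and "\<sigma>s \<equiv> sqrt (Max ((\<lambda>l. dist_variance (H l)) ` {1..L}))"
  shows "\<exists>r \<in> o[at_right 0](\<lambda>\<alpha>. sqrt \<alpha>).
           \<forall>\<^sub>F \<alpha> in at_right 0. \<Psi> 1 \<alpha> \<le> \<mu>s + 2 * \<sigma>s * sqrt \<alpha> + r \<alpha>"
proof -
  let ?v = "Max ((\<lambda>l. dist_variance (H l)) ` {1..L})"
  interpret weights_in_environment M F X by fact
  define V where "V = H ` {1..L}"
  \<comment> \<open>The case \<open>L = 0\<close> is excluded by total mass 1, so both maxima are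
    taken over nonempty sets.\<close>
  have V_nonempty: "V \<noteq> {}"
  proof
    assume "V = {}"
    then have "AE \<omega> in M. False" using assms(4)[of 0] by (simp add: V_def)
    then show False by simp
  qed
  have mean: "dist_mean Q \<le> \<mu>s" and var: "dist_variance Q \<le> ?v" if "Q \<in> V" for Q
    using that by (auto simp: V_def \<mu>s_def intro!: Max_ge)
  have var_nonneg: "0 \<le> dist_variance Q" for Q by (simp add: dist_variance_def)
  obtain Q0 where "Q0 \<in> V" using V_nonempty by auto
  then have max_nonneg: "0 \<le> ?v"
    using var[of Q0] var_nonneg[of Q0] by linarith
  have \<sigma>s: "0 \<le> \<sigma>s" "\<sigma>s\<^sup>2 = ?v"
    using max_nonneg by (auto simp: \<sigma>s_def)
  have bound: "\<forall>\<^sub>F \<alpha> in at_right 0. \<Psi> 1 \<alpha> \<le> \<mu>s + 2 * \<sigma>s * sqrt \<alpha> + \<eta> * sqrt \<alpha>" if "\<eta> > 0" for \<eta>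
  proof (rule limit_shape_asymptotic_bound[OF _ V_nonempty _ _ _ mean _ \<sigma>s(1) assms(6) that])
    show "finite V" by (simp add: V_def)
    show "real_distribution Q" "root_integral Q < \<infinity>" if "Q \<in> V" for Q
      using that assms(3,5) by (auto simp: V_def root_integral_def)
    show "AE \<omega> in M. F j \<omega> \<in> V" for j using assms(4) by (simp add: V_def)
    show "dist_variance Q \<le> \<sigma>s\<^sup>2" if "Q \<in> V" for Q using var[OF that] \<sigma>s(2) by simp
  qed
  \<comment> \<open>The Landau condition concerns the absolute value of \<open>r\<close> whereas the
    bound on \<open>\<Psi>\<close> is one-sided, so only the positive part of the excess is
    kept.\<close>
  define r where "r \<alpha> = max 0 (\<Psi> 1 \<alpha> - \<mu>s - 2 * \<sigma>s * sqrt \<alpha>)" for \<alpha>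
  show ?thesis
  proof
    show "r \<in> o[at_right 0](\<lambda>\<alpha>. sqrt \<alpha>)"
    proof (rule landau_o.smallI)
      fix \<eta> :: real assume "\<eta> > 0"
      from bound[OF this] eventually_at_right_less[of 0]
      show "\<forall>\<^sub>F \<alpha> in at_right 0. norm (r \<alpha>) \<le> \<eta> * norm (sqrt \<alpha>)"
      proof eventually_elim
        case (elim \<alpha>)
        then have "0 \<le> \<eta> * sqrt \<alpha>" using \<open>\<eta> > 0\<close> by simp
        then show ?case using elim by (simp add: r_def)
      qed
    qed
    show "\<forall>\<^sub>F \<alpha> in at_right 0. \<Psi> 1 \<alpha> \<le> \<mu>s + 2 * \<sigma>s * sqrt \<alpha> + r \<alpha>"
      by (intro always_eventually allI) (simp add: r_def)
  qed
qed

end
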